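(* Let $\alpha\in\mathbb{R}$ and let $\varphi:]\alpha,+\infty[\to\mathbb{R}$ be a smooth function with $\dot\varphi>0$ and $\ddot\varphi\ge 0$ on $]\alpha,+\infty[$. Let $\Sigma$ be an oriented $[\varphi,\vec e_3]$-minimal immersion in $\mathbb{R}^3_\alpha$ with $H\le 0$. Then $\Sigma$ is stable.
   Context: $\vec e_3=(0,0,1)$, $\mathbb{R}^3_\alpha=\{p\in\mathbb{R}^3:\langle p,\vec e_3\rangle>\alpha\}$. A dot denotes the derivative of the one-variable function $\varphi$, regarded as a function of the third coordinate $x_3$. Surfaces $\Sigma$ are connected, orientable, with empty boundary and unit normal $N$. For $p\in\Sigma$: $\mu(p)=\langle p,\vec e_3\rangle$, $\eta(p)=\langle N(p),\vec e_3\rangle$. Second fundamental form: $\mathcal S(X,Y)=\langle D_XN,Y\rangle$ with $D$ the Euclidean connection; $k_1,k_2$ its eigenvalues; $H=k_1+k_2$, $|\mathcal S|^2=k_1^2+k_2^2$. $\Sigma$ is $[\varphi,\vec e_3]$-minimal if $H=-\dot\varphi(\mu)\,\eta$ on $\Sigma$. A $[\varphi,\vec e_3]$-minimal surface $\Sigma$ is stable if for every compactly supported smooth function $u$ on $\Sigma$, $$\mathcal Q_\varphi(u,u)=\int_\Sigma e^{\varphi(\mu)}\left(|\nabla u|^2-(|\mathcal S|^2-\ddot\varphi(\mu)\,\eta^2)u^2\right)d\Sigma\ge 0,$$ where $\nabla$ and $d\Sigma$ are taken with respect to the metric induced from Euclidean $\mathbb{R}^3$. *)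

theory Defs
  imports "HOL-Analysis.Analysis"
begin

section \<open>Smooth functions on open subsets of Euclidean spaces\<close>

primrec Ck_on :: "nat \<Rightarrow> 'a::euclidean_space set \<Rightarrow> ('a \<Rightarrow> 'b::real_normed_vector) \<Rightarrow> bool" where
  "Ck_on 0 S f \<longleftrightarrow> continuous_on S f"
| "Ck_on (Suc k) S f \<longleftrightarrow>
     (\<forall>x\<in>S. f differentiable (at x)) \<and> (\<forall>v. Ck_on k S (\<lambda>x. frechet_derivative f (at x) v))"

text \<open>Only meaningful for open \<open>S\<close>, since the derivatives are two-sided.\<close>

definition smooth_on :: "'a::euclidean_space set \<Rightarrow> ('a \<Rightarrow> 'b::real_normed_vector) \<Rightarrow> bool" where
  "smooth_on S f \<longleftrightarrow> (\<forall>k. Ck_on k S f)"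


section \<open>Smooth surfaces\<close>

text \<open>The underlying point set of the abstract surface is the whole type \<open>'m\<close>; the classes
  \<open>t2_space\<close> and \<open>second_countable_topology\<close> are the usual separation and countability axioms.
  An atlas is given by local parametrizations \<open>(V, f)\<close>, that is, inverses of charts:
  \<open>f\<close> maps the open set \<open>V\<close> of the plane homeomorphically onto an open set of the surface
  (its values outside \<open>V\<close> are irrelevant). As the sets \<open>V\<close> are open in the plane,
  the surface has empty boundary.\<close>

type_synonym 'm param = "(real^2) set \<times> (real^2 \<Rightarrow> 'm)"

definition smooth_surface :: "'m::{t2_space, second_countable_topology} param set \<Rightarrow> bool" where
  "smooth_surface A \<longleftrightarrow>
     connected (UNIV :: 'm set) \<and>
     (\<forall>(V, f)\<in>A. open V \<and> open (f ` V) \<and> (\<exists>g. homeomorphism V (f ` V) f g)) \<and>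
     (\<Union>(V, f)\<in>A. f ` V) = UNIV \<and>
     (\<forall>(V, f)\<in>A. \<forall>(W, h)\<in>A. smooth_on {x\<in>V. f x \<in> h ` W} (the_inv_into W h \<circ> f))"

definition smooth_map ::
    "'m::{t2_space, second_countable_topology} param set \<Rightarrow> ('m \<Rightarrow> 'b::real_normed_vector) \<Rightarrow> bool" where
  "smooth_map A u \<longleftrightarrow> (\<forall>(V, f)\<in>A. smooth_on V (u \<circ> f))"


section \<open>Oriented immersed surfaces in Euclidean 3-space\<close>

text \<open>\<open>A\<close> is a smooth atlas, \<open>\<psi>\<close> an immersion. The tangent plane at \<open>p\<close> is identified, as usual,
  with its image under the differential of \<open>\<psi>\<close>, a plane in \<open>real^3\<close>.\<close>

definition tangent_plane ::
    "'m::{t2_space, second_countable_topology} param set \<Rightarrow> ('m \<Rightarrow> real^3) \<Rightarrow> 'm \<Rightarrow> (real^3) set" where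
  "tangent_plane A \<psi> p =
     {X. \<exists>(V, f)\<in>A. \<exists>x\<in>V. \<exists>v. f x = p \<and> X = frechet_derivative (\<psi> \<circ> f) (at x) v}"

text \<open>The derivative of a function \<open>u\<close> on the surface in the direction of a tangent vector \<open>X\<close>
  at \<open>p\<close>. By the chain rule (and injectivity of the differential of \<open>\<psi>\<close>) the value is the same for
  every parametrization around \<open>p\<close>. For vector-valued \<open>u\<close> this is the Euclidean connection applied to
  vector fields along the immersion.\<close>

definition dir_deriv ::
    "'m::{t2_space, second_countable_topology} param set \<Rightarrow> ('m \<Rightarrow> real^3) \<Rightarrow>
     ('m \<Rightarrow> 'b::real_normed_vector) \<Rightarrow> 'm \<Rightarrow> real^3 \<Rightarrow> 'b" where
  "dir_deriv A \<psi> u p X =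
     (THE d. \<exists>(V, f)\<in>A. \<exists>x\<in>V. \<exists>v. f x = p \<and>
        X = frechet_derivative (\<psi> \<circ> f) (at x) v \<and> d = frechet_derivative (u \<circ> f) (at x) v)"

definition immersion ::
    "'m::{t2_space, second_countable_topology} param set \<Rightarrow> ('m \<Rightarrow> real^3) \<Rightarrow> bool" where
  "immersion A \<psi> \<longleftrightarrow> smooth_map A \<psi> \<and>
     (\<forall>(V, f)\<in>A. \<forall>x\<in>V. inj (frechet_derivative (\<psi> \<circ> f) (at x)))"

definition unit_normal ::
    "'m::{t2_space, second_countable_topology} param set \<Rightarrow> ('m \<Rightarrow> real^3) \<Rightarrow> ('m \<Rightarrow> real^3) \<Rightarrow> bool" where
  "unit_normal A \<psi> N \<longleftrightarrow> smooth_map A N \<and>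
     (\<forall>p. norm (N p) = 1 \<and> (\<forall>X\<in>tangent_plane A \<psi> p. N p \<bullet> X = 0))"

text \<open>The orientation is the choice of the global unit normal field \<open>N\<close>.\<close>

definition oriented_immersed_surface ::
    "'m::{t2_space, second_countable_topology} param set \<Rightarrow> ('m \<Rightarrow> real^3) \<Rightarrow> ('m \<Rightarrow> real^3) \<Rightarrow> bool" where
  "oriented_immersed_surface A \<psi> N \<longleftrightarrow> smooth_surface A \<and> immersion A \<psi> \<and> unit_normal A \<psi> N"

text \<open>Note the sign convention: no minus sign in front of the derivative of \<open>N\<close>.\<close>

definition second_form ::
    "'m::{t2_space, second_countable_topology} param set \<Rightarrow> ('m \<Rightarrow> real^3) \<Rightarrow> ('m \<Rightarrow> real^3) \<Rightarrow>
     'm \<Rightarrow> real^3 \<Rightarrow> real^3 \<Rightarrow> real" where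
  "second_form A \<psi> N p X Y = dir_deriv A \<psi> N p X \<bullet> Y"

definition shape_eigenvalues ::
    "'m::{t2_space, second_countable_topology} param set \<Rightarrow> ('m \<Rightarrow> real^3) \<Rightarrow> ('m \<Rightarrow> real^3) \<Rightarrow>
     'm \<Rightarrow> real set" where
  "shape_eigenvalues A \<psi> N p =
     {k. \<exists>X\<in>tangent_plane A \<psi> p. X \<noteq> 0 \<and>
           (\<forall>Y\<in>tangent_plane A \<psi> p. second_form A \<psi> N p X Y = k * (X \<bullet> Y))}"

text \<open>The second fundamental form is symmetric on a 2-dimensional space, so there are either two distinct
  eigenvalues or a single one of multiplicity two; taking the minimum and the maximum
  lists them with multiplicity in both cases.\<close>

definition k1 ::
    "'m::{t2_space, second_countable_topology} param set \<Rightarrow> ('m \<Rightarrow> real^3) \<Rightarrow> ('m \<Rightarrow> real^3) \<Rightarrow> 'm \<Rightarrow> real" where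
  "k1 A \<psi> N p = Min (shape_eigenvalues A \<psi> N p)"

definition k2 ::
    "'m::{t2_space, second_countable_topology} param set \<Rightarrow> ('m \<Rightarrow> real^3) \<Rightarrow> ('m \<Rightarrow> real^3) \<Rightarrow> 'm \<Rightarrow> real" where
  "k2 A \<psi> N p = Max (shape_eigenvalues A \<psi> N p)"

definition mean_curvature ::
    "'m::{t2_space, second_countable_topology} param set \<Rightarrow> ('m \<Rightarrow> real^3) \<Rightarrow> ('m \<Rightarrow> real^3) \<Rightarrow> 'm \<Rightarrow> real" where
  "mean_curvature A \<psi> N p = k1 A \<psi> N p + k2 A \<psi> N p"

definition second_form_norm_sq ::
    "'m::{t2_space, second_countable_topology} param set \<Rightarrow> ('m \<Rightarrow> real^3) \<Rightarrow> ('m \<Rightarrow> real^3) \<Rightarrow> 'm \<Rightarrow> real" where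
  "second_form_norm_sq A \<psi> N p = (k1 A \<psi> N p)\<^sup>2 + (k2 A \<psi> N p)\<^sup>2"

definition surface_gradient ::
    "'m::{t2_space, second_countable_topology} param set \<Rightarrow> ('m \<Rightarrow> real^3) \<Rightarrow> ('m \<Rightarrow> real) \<Rightarrow> 'm \<Rightarrow> real^3" where
  "surface_gradient A \<psi> u p =
     (THE G. G \<in> tangent_plane A \<psi> p \<and> (\<forall>X\<in>tangent_plane A \<psi> p. G \<bullet> X = dir_deriv A \<psi> u p X))"

text \<open>The matrix \<open>g\<^sub>i\<^sub>j\<close> of the induced metric in the parametrization \<open>f\<close>.\<close>

definition metric_matrix :: "('m \<Rightarrow> real^3) \<Rightarrow> (real^2 \<Rightarrow> 'm) \<Rightarrow> real^2 \<Rightarrow> real^2^2" where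
  "metric_matrix \<psi> f x =
     (\<chi> i j. frechet_derivative (\<psi> \<circ> f) (at x) (axis i 1) \<bullet> frechet_derivative (\<psi> \<circ> f) (at x) (axis j 1))"

text \<open>The area measure \<open>d\<Sigma>\<close> of the induced metric: the unique Borel measure on the surface that
  is given by \<open>sqrt (det g) dx\<close> in every parametrization of the atlas.\<close>

definition area_measure ::
    "'m::{t2_space, second_countable_topology} param set \<Rightarrow> ('m \<Rightarrow> real^3) \<Rightarrow> 'm measure" where
  "area_measure A \<psi> =
     (THE m. sets m = sets borel \<and>
        (\<forall>(V, f)\<in>A. \<forall>B\<in>sets borel. B \<subseteq> V \<longrightarrow>
           emeasure m (f ` B) = (\<integral>\<^sup>+x\<in>B. ennreal (sqrt (det (metric_matrix \<psi> f x))) \<partial>lborel)))"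


section \<open>\<open>[\<phi>, e\<^sub>3]\<close>-minimal surfaces and stability\<close>

definition e3 :: "real^3" where
  "e3 = vector [0, 0, 1]"

definition height :: "('m \<Rightarrow> real^3) \<Rightarrow> 'm \<Rightarrow> real" where
  "height \<psi> p = \<psi> p \<bullet> e3"

definition angle_fun :: "('m \<Rightarrow> real^3) \<Rightarrow> 'm \<Rightarrow> real" where
  "angle_fun N p = N p \<bullet> e3"

definition phi_minimal ::
    "(real \<Rightarrow> real) \<Rightarrow> 'm::{t2_space, second_countable_topology} param set \<Rightarrow>
     ('m \<Rightarrow> real^3) \<Rightarrow> ('m \<Rightarrow> real^3) \<Rightarrow> bool" where
  "phi_minimal \<phi> A \<psi> N \<longleftrightarrow>
     (\<forall>p. mean_curvature A \<psi> N p = - deriv \<phi> (height \<psi> p) * angle_fun N p)"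

definition Q_form ::
    "(real \<Rightarrow> real) \<Rightarrow> 'm::{t2_space, second_countable_topology} param set \<Rightarrow>
     ('m \<Rightarrow> real^3) \<Rightarrow> ('m \<Rightarrow> real^3) \<Rightarrow> ('m \<Rightarrow> real) \<Rightarrow> real" where
  "Q_form \<phi> A \<psi> N u =
     (LINT p|area_measure A \<psi>. exp (\<phi> (height \<psi> p)) *
        ((norm (surface_gradient A \<psi> u p))\<^sup>2
          - (second_form_norm_sq A \<psi> N p - deriv (deriv \<phi>) (height \<psi> p) * (angle_fun N p)\<^sup>2) * (u p)\<^sup>2))"

definition phi_stable ::
    "(real \<Rightarrow> real) \<Rightarrow> 'm::{t2_space, second_countable_topology} param set \<Rightarrow>
     ('m \<Rightarrow> real^3) \<Rightarrow> ('m \<Rightarrow> real^3) \<Rightarrow> bool" where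
  "phi_stable \<phi> A \<psi> N \<longleftrightarrow>
     (\<forall>u. smooth_map A u \<and> compact (closure {p. u p \<noteq> 0}) \<longrightarrow> Q_form \<phi> A \<psi> N u \<ge> 0)"

end

theory Submission
  imports Defs
begin

text \<open>The angle function \<open>\<eta>\<close> is nonnegative, since \<open>H = - \<phi>' \<eta> \<le> 0\<close> and \<open>\<phi>' > 0\<close>.
  Writing \<open>\<nabla>\<eta>\<close> through \<open>H\<close> and \<open>N\<close> gives
  \<open>div (e\<^sup>\<phi> \<nabla>\<eta>) = - e\<^sup>\<phi> (|S|\<^sup>2 + \<phi>'' (1 - \<eta>\<^sup>2)) \<eta>\<close>, which holds weakly on the whole surface
  by a partition of unity. Testing it with \<open>u\<^sup>2 / (\<eta> + \<epsilon>)\<close> and using Picone's inequality and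
  \<open>\<phi>'' \<ge> 0\<close> yields
  \<open>Q(u,u) \<ge> - \<integral> e\<^sup>\<phi> |S|\<^sup>2 u\<^sup>2 \<epsilon> / (\<eta> + \<epsilon>)\<close>. At a zero of \<open>\<eta>\<close> the gradient of \<open>\<eta>\<close> and \<open>H\<close> vanish,
  which forces \<open>|S| = 0\<close> there; so the right-hand side tends to \<open>0\<close> as \<open>\<epsilon> \<rightarrow> 0\<close>, and no strong
  maximum principle is needed.\<close>

section \<open>Functions of class C1 in the plane\<close>

text \<open>In a parametrization with coordinate tangent vectors X_i and derivatives n_i of the
  normal, the flux of e^phi grad eta is, up to sign and order of the indices, P_i = e^phi (h <n x
  X_i, e3> + <n x n_i, e3>) with h = phi' eta = -H. Only first derivatives enter, and in the
  divergence d_1 P_2 - d_2 P_1 the second derivatives cancel by symmetry, which leaves products of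
  first derivatives: an identity of linear algebra at one point. The sign of P depends on the
  orientation of the parametrization and that of the area element does not, so the equation is
  integrated over connected patches before it is glued. The equation contains |S|^2 + phi'' (1 -
  eta^2), the form Q contains |S|^2 - phi'' eta^2. They differ by phi'', and this is where convexity
  acts. The natural test function u^2 / eta may blow up, since eta may have zeros; hence the shift
  by epsilon, whose price is the error term. Tangential derivative, gradient and area measure are
  definite descriptions, so each must first be shown to be well defined before an integral over the
  surface can be read in a chart.\<close>

abbreviation C1_on :: "'a::euclidean_space set \<Rightarrow> ('a \<Rightarrow> 'b::real_normed_vector) \<Rightarrow> bool" where
  "C1_on S f \<equiv> Ck_on (Suc 0) S f"

lemma C1_on_iff:
  "C1_on S f \<longleftrightarrow>
     (\<forall>x\<in>S. f differentiable (at x)) \<and> (\<forall>v. continuous_on S (\<lambda>x. frechet_derivative f (at x) v))"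
  by simp

declare Ck_on.simps [simp del]

lemma C1_onI:
  assumes "\<And>x. x \<in> S \<Longrightarrow> (f has_derivative f' x) (at x)"
    and "\<And>v. continuous_on S (\<lambda>x. f' x v)"
  shows "C1_on S f"
proof -
  have "frechet_derivative f (at x) = f' x" if "x \<in> S" for x
    using assms(1)[OF that] frechet_derivative_at by metis
  then have "continuous_on S (\<lambda>x. frechet_derivative f (at x) v)" for v
    using assms(2)[of v] by (simp cong: continuous_on_cong)
  then show ?thesis
    using assms(1) by (auto simp: differentiable_def C1_on_iff)
qed

lemma C1_on_has_derivative:
  "C1_on S f \<Longrightarrow> x \<in> S \<Longrightarrow> (f has_derivative frechet_derivative f (at x)) (at x)"
  by (simp add: frechet_derivative_works C1_on_iff)

lemma C1_on_differentiable: "C1_on S f \<Longrightarrow> x \<in> S \<Longrightarrow> f differentiable at x"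
  by (simp add: C1_on_iff)

lemma C1_on_continuous_derivative:
  "C1_on S f \<Longrightarrow> continuous_on S (\<lambda>x. frechet_derivative f (at x) v)"
  by (simp add: C1_on_iff)

lemma C1_on_imp_continuous_on: "C1_on S f \<Longrightarrow> continuous_on S f"
  by (meson C1_on_has_derivative continuous_at_imp_continuous_on has_derivative_continuous)

lemma C1_on_subset: "C1_on S f \<Longrightarrow> T \<subseteq> S \<Longrightarrow> C1_on T f"
  by (auto simp: C1_on_iff intro: continuous_on_subset)

lemma Ck_on_subset: "Ck_on k S f \<Longrightarrow> T \<subseteq> S \<Longrightarrow> Ck_on k T f"
proof (induction k arbitrary: f)
  case 0
  then show ?case by (auto simp: Ck_on.simps intro: continuous_on_subset)
next
  case (Suc k)
  then show ?case by (auto simp: Ck_on.simps)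
qed

lemma C1_on_cong:
  assumes "C1_on S f" "open S" "\<And>x. x \<in> S \<Longrightarrow> g x = f x"
  shows "C1_on S g"
proof (rule C1_onI)
  fix x assume "x \<in> S"
  then show "(g has_derivative frechet_derivative f (at x)) (at x)"
    using assms has_derivative_transform_within_open[OF C1_on_has_derivative[OF assms(1)] assms(2)] by simp
qed (use assms(1) in \<open>simp add: C1_on_iff\<close>)

lemma C1_on_Un:
  assumes "C1_on S f" "C1_on T f" "open S" "open T"
  shows "C1_on (S \<union> T) f"
  using assms by (auto simp: C1_on_iff intro!: continuous_on_open_Un)

lemma C1_on_const: "C1_on S (\<lambda>x. c)"
  by (rule C1_onI[where f' = "\<lambda>x v. 0"]) auto

lemma C1_on_add:
  assumes "C1_on S f" "C1_on S g"
  shows "C1_on S (\<lambda>x. f x + g x)"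
  by (rule C1_onI[OF has_derivative_add[OF C1_on_has_derivative[OF assms(1)] C1_on_has_derivative[OF assms(2)]]])
    (auto intro!: continuous_intros C1_on_continuous_derivative assms)

lemma C1_on_bounded_linear:
  assumes "C1_on S f" "bounded_linear h"
  shows "C1_on S (\<lambda>x. h (f x))"
  by (rule C1_onI[OF bounded_linear.has_derivative[OF assms(2) C1_on_has_derivative[OF assms(1)]]])
    (auto intro!: bounded_linear.continuous_on[OF assms(2)] C1_on_continuous_derivative assms)

lemma C1_on_bilinear:
  assumes "C1_on S f" "C1_on S g" "bounded_bilinear h"
  shows "C1_on S (\<lambda>x. h (f x) (g x))"
  by (rule C1_onI[OF bounded_bilinear.FDERIV[OF assms(3) C1_on_has_derivative[OF assms(1)] C1_on_has_derivative[OF assms(2)]]])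
    (assumption | intro continuous_on_add bounded_bilinear.continuous_on[OF assms(3)]
        C1_on_continuous_derivative[OF assms(1)] C1_on_continuous_derivative[OF assms(2)]
        C1_on_imp_continuous_on[OF assms(1)] C1_on_imp_continuous_on[OF assms(2)])+

lemmas C1_on_mult = C1_on_bilinear[OF _ _ bounded_bilinear_mult]
lemmas C1_on_inner = C1_on_bilinear[OF _ _ bounded_bilinear_inner]
lemmas C1_on_minus = C1_on_bounded_linear[OF _ bounded_linear_minus[OF bounded_linear_ident]]

lemma C1_on_diff:
  assumes "C1_on S f" "C1_on S g"
  shows "C1_on S (\<lambda>x. f x - g x)"
  using C1_on_add[OF assms(1) C1_on_minus[OF assms(2)]] by simp

lemma C1_on_compose_real:
  fixes f :: "'a::euclidean_space \<Rightarrow> real" and h :: "real \<Rightarrow> real"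
  assumes f: "C1_on S f"
    and h: "\<And>x. x \<in> S \<Longrightarrow> (h has_real_derivative h' (f x)) (at (f x))"
    and c: "continuous_on S (\<lambda>x. h' (f x))"
  shows "C1_on S (\<lambda>x. h (f x))"
proof (rule C1_onI)
  fix x assume x: "x \<in> S"
  have "(h has_derivative (\<lambda>v. h' (f x) * v)) (at (f x))"
    using h[OF x] by (simp add: has_field_derivative_def)
  then show "((\<lambda>x. h (f x)) has_derivative (\<lambda>v. h' (f x) * frechet_derivative f (at x) v)) (at x)"
    by (rule has_derivative_compose[OF C1_on_has_derivative[OF f x]])
qed (intro continuous_on_mult c C1_on_continuous_derivative f)

lemma C1_on_exp:
  fixes f :: "'a::euclidean_space \<Rightarrow> real"
  assumes "C1_on S f"
  shows "C1_on S (\<lambda>x. exp (f x))"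
  by (rule C1_on_compose_real[OF assms, where h' = exp])
    (auto intro: DERIV_exp continuous_on_exp C1_on_imp_continuous_on[OF assms])

lemma C1_on_divide:
  fixes f g :: "'a::euclidean_space \<Rightarrow> real"
  assumes f: "C1_on S f" and g: "C1_on S g" and nz: "\<And>x. x \<in> S \<Longrightarrow> g x \<noteq> 0"
  shows "C1_on S (\<lambda>x. f x / g x)"
proof -
  have "C1_on S (\<lambda>x. inverse (g x))"
  proof (rule C1_on_compose_real[OF g])
    show "(inverse has_real_derivative - (inverse (g x) ^ Suc (Suc 0))) (at (g x))" if "x \<in> S" for x
      by (rule DERIV_inverse) (rule nz[OF that])
    show "continuous_on S (\<lambda>x. - (inverse (g x) ^ Suc (Suc 0)))"
      by (intro continuous_on_minus continuous_on_power continuous_on_inverse C1_on_imp_continuous_on[OF g])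
        (simp add: nz)
  qed
  then show ?thesis
    using C1_on_mult[OF f] by (simp add: divide_inverse)
qed

lemma C1_on_compose:
  fixes f :: "'a::euclidean_space \<Rightarrow> 'b::euclidean_space" and g :: "'b \<Rightarrow> 'c::real_normed_vector"
  assumes f: "C1_on S f" and g: "C1_on T g" and sub: "\<And>x. x \<in> S \<Longrightarrow> f x \<in> T"
  shows "C1_on S (\<lambda>x. g (f x))"
proof (rule C1_onI)
  fix x assume x: "x \<in> S"
  show "((\<lambda>x. g (f x)) has_derivative
      (\<lambda>v. frechet_derivative g (at (f x)) (frechet_derivative f (at x) v))) (at x)"
    by (rule has_derivative_compose[OF C1_on_has_derivative[OF f x] C1_on_has_derivative[OF g sub[OF x]]])
next
  fix v
  \<comment> \<open>Being C1 gives continuity of the derivative of \<open>g\<close> in a fixed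
    direction only, but here the direction moves with \<open>x\<close>. Expanding it in
    \<open>Basis\<close> leaves finitely many fixed directions.\<close>
  have lin: "frechet_derivative g (at (f x)) w =
      (\<Sum>b\<in>Basis. (w \<bullet> b) *\<^sub>R frechet_derivative g (at (f x)) b)" if x: "x \<in> S" for x w
  proof -
    have l: "linear (frechet_derivative g (at (f x)))"
      using C1_on_has_derivative[OF g sub[OF x]] has_derivative_linear by blast
    have "frechet_derivative g (at (f x)) (\<Sum>b\<in>Basis. (w \<bullet> b) *\<^sub>R b) =
        (\<Sum>b\<in>Basis. (w \<bullet> b) *\<^sub>R frechet_derivative g (at (f x)) b)"
      by (simp add: linear_sum[OF l] linear_scale[OF l])
    then show ?thesis
      by (simp add: euclidean_representation)
  qed
  have c: "continuous_on S (\<lambda>x. frechet_derivative g (at (f x)) b)" for b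
    using continuous_on_compose2[OF C1_on_continuous_derivative[OF g] C1_on_imp_continuous_on[OF f]] sub
    by blast
  have "continuous_on S (\<lambda>x. \<Sum>b\<in>Basis. (frechet_derivative f (at x) v \<bullet> b) *\<^sub>R frechet_derivative g (at (f x)) b)"
    by (intro continuous_intros c C1_on_continuous_derivative f)
  then show "continuous_on S (\<lambda>x. frechet_derivative g (at (f x)) (frechet_derivative f (at x) v))"
    by (simp cong: continuous_on_cong add: lin[symmetric])
qed

section \<open>Partial derivatives in the plane\<close>

definition pd :: "2 \<Rightarrow> (real^2 \<Rightarrow> 'b::real_normed_vector) \<Rightarrow> real^2 \<Rightarrow> 'b" where
  "pd i f x = frechet_derivative f (at x) (axis i 1)"

lemma pd_eqI: "(f has_derivative f') (at x) \<Longrightarrow> pd i f x = f' (axis i 1)"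
  using frechet_derivative_at unfolding pd_def by metis

lemma pd_decompose:
  fixes f :: "real^2 \<Rightarrow> 'b::real_normed_vector"
  assumes "f differentiable at x"
  shows "frechet_derivative f (at x) v = v$1 *\<^sub>R pd 1 f x + v$2 *\<^sub>R pd 2 f x"
proof -
  have l: "linear (frechet_derivative f (at x))"
    using assms linear_frechet_derivative by blast
  have v: "v = v$1 *\<^sub>R axis 1 1 + v$2 *\<^sub>R axis 2 1"
    by (simp add: vec_eq_iff forall_2 axis_def)
  have "frechet_derivative f (at x) (v$1 *\<^sub>R axis 1 1 + v$2 *\<^sub>R axis 2 1) =
      v$1 *\<^sub>R pd 1 f x + v$2 *\<^sub>R pd 2 f x"
    by (simp add: linear_add[OF l] linear_scale[OF l] pd_def)
  with v show ?thesis by simp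
qed

text \<open>Differentiability is not assumed: both functions have the same derivatives at
  \<open>x\<close>, so the choice operator in \<open>frechet_derivative\<close> returns the same map
  even where there is none.\<close>

lemma pd_cong:
  assumes "open S" "x \<in> S" "\<And>y. y \<in> S \<Longrightarrow> f y = g y"
  shows "pd i f x = pd i g x"
proof -
  have "(f has_derivative D) (at x) \<longleftrightarrow> (g has_derivative D) (at x)" for D
    using assms has_derivative_transform_within_open[OF _ assms(1,2), of f D UNIV g]
      has_derivative_transform_within_open[OF _ assms(1,2), of g D UNIV f] by auto
  then show ?thesis
    by (simp add: pd_def frechet_derivative_def)
qed

lemma C1_on_pd: "Ck_on (Suc (Suc 0)) S f \<Longrightarrow> C1_on S (pd i f)"
  unfolding pd_def[abs_def] by (simp add: Ck_on.simps)

lemma continuous_on_pd: "C1_on S f \<Longrightarrow> continuous_on S (pd i f)"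
  unfolding pd_def[abs_def] by (simp add: C1_on_iff)

lemma Ck_on_2_imp_1:
  assumes "Ck_on (Suc (Suc 0)) S f"
  shows "C1_on S f"
proof -
  have "continuous_on S (\<lambda>x. frechet_derivative f (at x) v)" for v
    by (rule C1_on_imp_continuous_on) (use assms in \<open>simp add: Ck_on.simps\<close>)
  with assms show ?thesis by (simp add: Ck_on.simps)
qed

lemma smooth_onD: "smooth_on S f \<Longrightarrow> Ck_on k S f"
  by (simp add: smooth_on_def)

lemma pd_add:
  "f differentiable at x \<Longrightarrow> g differentiable at x \<Longrightarrow> pd i (\<lambda>x. f x + g x) x = pd i f x + pd i g x"
  using pd_eqI[OF has_derivative_add] unfolding frechet_derivative_works pd_def by blast

lemma pd_bilinear:
  assumes "bounded_bilinear h"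
  shows "f differentiable at x \<Longrightarrow> g differentiable at x \<Longrightarrow>
    pd i (\<lambda>x. h (f x) (g x)) x = h (f x) (pd i g x) + h (pd i f x) (g x)"
  using pd_eqI[OF bounded_bilinear.FDERIV[OF assms]] unfolding frechet_derivative_works pd_def by blast

lemmas pd_mult = pd_bilinear[OF bounded_bilinear_mult]
lemmas pd_inner = pd_bilinear[OF bounded_bilinear_inner]

lemma pd_const [simp]: "pd i (\<lambda>x. c) x = 0"
  by (simp add: pd_def frechet_derivative_const)

lemma pd_compose_real:
  fixes f :: "real^2 \<Rightarrow> real"
  assumes f: "f differentiable at x" and h: "(h has_real_derivative h') (at (f x))"
  shows "pd i (\<lambda>x. h (f x)) x = h' * pd i f x"
proof -
  have "(h has_derivative (\<lambda>v. h' * v)) (at (f x))"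
    using h by (simp add: has_field_derivative_def)
  moreover have "(f has_derivative frechet_derivative f (at x)) (at x)"
    using f by (simp add: frechet_derivative_works)
  ultimately have "((\<lambda>x. h (f x)) has_derivative (\<lambda>v. h' * frechet_derivative f (at x) v)) (at x)"
    using has_derivative_compose by blast
  from pd_eqI[OF this] show ?thesis
    by (simp add: pd_def)
qed

section \<open>Mean value theorem and symmetry of second partial derivatives\<close>

lemma mvt_pd:
  fixes f :: "real^2 \<Rightarrow> real"
  assumes "0 < h" and d: "\<And>t. 0 \<le> t \<Longrightarrow> t \<le> h \<Longrightarrow> f differentiable at (y + t *\<^sub>R axis i 1)"
  obtains t where "0 < t" "t < h" "f (y + h *\<^sub>R axis i 1) - f y = h * pd i f (y + t *\<^sub>R axis i 1)"
proof -
  let ?e = "axis i 1 :: real^2"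
  have der: "((\<lambda>t. f (y + t *\<^sub>R ?e)) has_real_derivative pd i f (y + t *\<^sub>R ?e)) (at t)"
    if t: "0 \<le> t" "t \<le> h" for t
  proof -
    let ?D = "frechet_derivative f (at (y + t *\<^sub>R ?e))"
    have D: "(f has_derivative ?D) (at (y + t *\<^sub>R ?e))"
      using d[OF t] by (simp add: frechet_derivative_works)
    have "((\<lambda>t. y + t *\<^sub>R ?e) has_derivative (\<lambda>s. s *\<^sub>R ?e)) (at t)"
      by (auto intro!: derivative_eq_intros)
    from has_derivative_compose[OF this D]
    have "((\<lambda>t. f (y + t *\<^sub>R ?e)) has_derivative (\<lambda>s. ?D (s *\<^sub>R ?e))) (at t)" .
    moreover have "?D (s *\<^sub>R ?e) = pd i f (y + t *\<^sub>R ?e) * s" for s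
      using linear_scale[OF has_derivative_linear[OF D], of s ?e] by (simp add: pd_def)
    ultimately show ?thesis
      by (simp add: has_field_derivative_def)
  qed
  obtain t where "0 < t" "t < h"
    "f (y + h *\<^sub>R ?e) - f (y + 0 *\<^sub>R ?e) = (h - 0) * pd i f (y + t *\<^sub>R ?e)"
    using MVT2[OF \<open>0 < h\<close>, of "\<lambda>t. f (y + t *\<^sub>R ?e)" "\<lambda>t. pd i f (y + t *\<^sub>R ?e)"] der by blast
  with that show ?thesis by auto
qed

text \<open>The mean value theorem is applied along \<open>a\<close> to the increment of
  \<open>f\<close> in direction \<open>b\<close>, then along \<open>b\<close> to
  \<open>pd i f\<close>. The second difference is symmetric in the two directions, so exchanging
  \<open>i\<close> and \<open>j\<close> expresses it by the other mixed derivative.\<close>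

lemma second_difference:
  fixes f :: "real^2 \<Rightarrow> real" and i j :: 2
  defines "a \<equiv> axis i 1 :: real^2" and "b \<equiv> axis j 1 :: real^2"
  assumes f: "Ck_on (Suc (Suc 0)) (ball x r) f" and h: "0 < h" "2 * h < r"
  obtains z where "dist x z \<le> 2 * h"
    "f (x + h *\<^sub>R a + h *\<^sub>R b) - f (x + h *\<^sub>R a) - f (x + h *\<^sub>R b) + f x = h * h * pd j (pd i f) z"
proof -
  have ab: "norm a = 1" "norm b = 1"
    by (simp_all add: a_def b_def)
  have ball: "x + s *\<^sub>R a + t *\<^sub>R b \<in> ball x r" and dist: "dist x (x + s *\<^sub>R a + t *\<^sub>R b) \<le> 2 * h"
    if "0 \<le> s" "s \<le> h" "0 \<le> t" "t \<le> h" for s t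
  proof -
    have "norm (s *\<^sub>R a + t *\<^sub>R b) \<le> 2 * h"
      using norm_triangle_ineq[of "s *\<^sub>R a" "t *\<^sub>R b"] that ab by simp
    then show "dist x (x + s *\<^sub>R a + t *\<^sub>R b) \<le> 2 * h"
      by (metis add.assoc dist_norm dist_commute add_diff_cancel_left')
    with h show "x + s *\<^sub>R a + t *\<^sub>R b \<in> ball x r" by simp
  qed
  have f1: "f differentiable at y" if "y \<in> ball x r" for y
    using C1_on_differentiable[OF Ck_on_2_imp_1[OF f] that] .
  have f2: "pd i f differentiable at y" if "y \<in> ball x r" for y
    using C1_on_differentiable[OF C1_on_pd[OF f] that] .
  define F where "F = (\<lambda>y. f (y + h *\<^sub>R b) - f y)"
  have F: "(F has_derivative (\<lambda>v. frechet_derivative f (at (y + h *\<^sub>R b)) v - frechet_derivative f (at y) v)) (at y)"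
    if "y \<in> ball x r" "y + h *\<^sub>R b \<in> ball x r" for y
  proof -
    have "((\<lambda>y. y + h *\<^sub>R b) has_derivative (\<lambda>v. v)) (at y)"
      by (auto intro!: derivative_eq_intros)
    from has_derivative_compose[OF this] f1[OF that(2)]
    have "((\<lambda>y. f (y + h *\<^sub>R b)) has_derivative frechet_derivative f (at (y + h *\<^sub>R b))) (at y)"
      by (simp add: frechet_derivative_works)
    from has_derivative_diff[OF this] f1[OF that(1)] show ?thesis
      by (simp add: frechet_derivative_works F_def)
  qed
  have ballF: "x + s *\<^sub>R a \<in> ball x r" "x + s *\<^sub>R a + h *\<^sub>R b \<in> ball x r" if "0 \<le> s" "s \<le> h" for s
    using ball[of s 0] ball[of s h] that h by auto
  have dF: "F differentiable at (x + s *\<^sub>R axis i 1)" if "0 \<le> s" "s \<le> h" for s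
    using F[OF ballF[OF that]] by (auto simp: differentiable_def a_def)
  obtain s where s: "0 < s" "s < h" "F (x + h *\<^sub>R a) - F x = h * pd i F (x + s *\<^sub>R a)"
    using mvt_pd[OF h(1) dF] unfolding a_def by blast
  have pF: "pd i F (x + s *\<^sub>R a) = pd i f (x + s *\<^sub>R a + h *\<^sub>R b) - pd i f (x + s *\<^sub>R a)"
    using pd_eqI[OF F[OF ballF[of s]]] s by (simp add: pd_def)
  have dp: "pd i f differentiable at (x + s *\<^sub>R a + t *\<^sub>R axis j 1)" if "0 \<le> t" "t \<le> h" for t
    using f2[OF ball[of s t]] that s by (simp add: b_def)
  obtain t where t: "0 < t" "t < h"
    "pd i f (x + s *\<^sub>R a + h *\<^sub>R b) - pd i f (x + s *\<^sub>R a) = h * pd j (pd i f) (x + s *\<^sub>R a + t *\<^sub>R b)"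
    using mvt_pd[OF h(1) dp] unfolding b_def by blast
  show ?thesis
  proof (rule that)
    show "dist x (x + s *\<^sub>R a + t *\<^sub>R b) \<le> 2 * h"
      using dist[of s t] s t by simp
    show "f (x + h *\<^sub>R a + h *\<^sub>R b) - f (x + h *\<^sub>R a) - f (x + h *\<^sub>R b) + f x =
        h * h * pd j (pd i f) (x + s *\<^sub>R a + t *\<^sub>R b)"
      using s(3) pF t(3) by (simp add: F_def algebra_simps)
  qed
qed

lemma pd_commute_real:
  fixes f :: "real^2 \<Rightarrow> real"
  assumes f: "Ck_on (Suc (Suc 0)) S f" and S: "open S" "x \<in> S"
  shows "pd j (pd i f) x = pd i (pd j f) x"
proof (rule ccontr)
  assume ne: "pd j (pd i f) x \<noteq> pd i (pd j f) x"
  define e where "e = \<bar>pd j (pd i f) x - pd i (pd j f) x\<bar> / 2"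
  have "e > 0" using ne by (simp add: e_def)
  obtain r where r: "r > 0" "ball x r \<subseteq> S"
    using S openE by blast
  have near: "\<exists>d>0. \<forall>z. dist x z < d \<longrightarrow> \<bar>pd k (pd l f) z - pd k (pd l f) x\<bar> < e" for k l
  proof -
    have "isCont (pd k (pd l f)) x"
      using continuous_on_pd[OF C1_on_pd[OF f]] S continuous_on_eq_continuous_at by blast
    then show ?thesis
      using \<open>e > 0\<close> unfolding continuous_at_eps_delta by (simp add: dist_real_def dist_commute)
  qed
  obtain d1 where d1: "d1 > 0" "\<And>z. dist x z < d1 \<Longrightarrow> \<bar>pd j (pd i f) z - pd j (pd i f) x\<bar> < e"
    using near[of j i] by blast
  obtain d2 where d2: "d2 > 0" "\<And>z. dist x z < d2 \<Longrightarrow> \<bar>pd i (pd j f) z - pd i (pd j f) x\<bar> < e"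
    using near[of i j] by blast
  \<comment> \<open>The intermediate points lie within \<open>2 * h\<close> of \<open>x\<close>; the
    divisor 3 keeps this strictly below all three radii.\<close>
  define h where "h = min r (min d1 d2) / 3"
  have h: "0 < h" "2 * h < r" "2 * h < d1" "2 * h < d2"
    using r d1(1) d2(1) by (auto simp: h_def)
  have fr: "Ck_on (Suc (Suc 0)) (ball x r) f"
    using f r(2) Ck_on_subset by blast
  obtain z1 where z1: "dist x z1 \<le> 2 * h"
    "f (x + h *\<^sub>R axis i 1 + h *\<^sub>R axis j 1) - f (x + h *\<^sub>R axis i 1) - f (x + h *\<^sub>R axis j 1) + f x =
      h * h * pd j (pd i f) z1"
    using second_difference[OF fr h(1,2)] by blast
  obtain z2 where z2: "dist x z2 \<le> 2 * h"
    "f (x + h *\<^sub>R axis j 1 + h *\<^sub>R axis i 1) - f (x + h *\<^sub>R axis j 1) - f (x + h *\<^sub>R axis i 1) + f x =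
      h * h * pd i (pd j f) z2"
    using second_difference[OF fr h(1,2)] by blast
  have "x + h *\<^sub>R axis i 1 + h *\<^sub>R axis j 1 = x + h *\<^sub>R axis j 1 + h *\<^sub>R axis i 1"
    by simp
  then have "h * h * pd j (pd i f) z1 = h * h * pd i (pd j f) z2"
    using z1(2) z2(2) by (simp add: algebra_simps)
  then have "pd j (pd i f) z1 = pd i (pd j f) z2"
    using h(1) by simp
  moreover have "\<bar>pd j (pd i f) z1 - pd j (pd i f) x\<bar> < e" "\<bar>pd i (pd j f) z2 - pd i (pd j f) x\<bar> < e"
    using d1(2) d2(2) z1(1) z2(1) h by force+
  ultimately show False
    unfolding e_def by argo
qed

lemma Ck_on_cong:
  assumes "open S" "Ck_on k S f" "\<And>x. x \<in> S \<Longrightarrow> g x = f x"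
  shows "Ck_on k S g"
  using assms(2,3)
proof (induction k arbitrary: f g)
  case 0
  then show ?case by (simp add: Ck_on.simps cong: continuous_on_cong)
next
  case (Suc k)
  have D: "(g has_derivative D) (at x) \<longleftrightarrow> (f has_derivative D) (at x)" if "x \<in> S" for x D
    using Suc.prems(2) has_derivative_transform_within_open[OF _ assms(1) that, of f D UNIV g]
      has_derivative_transform_within_open[OF _ assms(1) that, of g D UNIV f] by auto
  then have "frechet_derivative g (at x) = frechet_derivative f (at x)" if "x \<in> S" for x
    using that by (simp add: frechet_derivative_def)
  then have "Ck_on k S (\<lambda>x. frechet_derivative g (at x) v)" for v
    using Suc.IH[of "\<lambda>x. frechet_derivative f (at x) v" "\<lambda>x. frechet_derivative g (at x) v"] Suc.prems(1)
    by (simp add: Ck_on.simps)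
  with Suc.prems(1) D show ?case
    by (simp add: Ck_on.simps differentiable_def)
qed

lemma Ck_on_bounded_linear:
  assumes "bounded_linear h" "open S" "Ck_on k S f"
  shows "Ck_on k S (\<lambda>x. h (f x))"
proof -
  interpret bounded_linear h by fact
  show ?thesis
    using assms(3)
  proof (induction k arbitrary: f)
    case 0
    then show ?case by (simp add: Ck_on.simps continuous_on)
  next
    case (Suc k)
    have D: "((\<lambda>x. h (f x)) has_derivative (\<lambda>v. h (frechet_derivative f (at x) v))) (at x)" if "x \<in> S" for x
      using Suc.prems that by (auto intro!: has_derivative simp: Ck_on.simps frechet_derivative_works)
    have eq: "frechet_derivative (\<lambda>x. h (f x)) (at x) v = h (frechet_derivative f (at x) v)" if "x \<in> S" for x v
      using fun_cong[OF frechet_derivative_at[OF D[OF that]], of v] by simp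
    have "Ck_on k S (\<lambda>x. h (frechet_derivative f (at x) v))" for v
      using Suc by (simp add: Ck_on.simps)
    from Ck_on_cong[OF assms(2) this eq]
    have "Ck_on k S (\<lambda>x. frechet_derivative (\<lambda>x. h (f x)) (at x) v)" for v .
    with D show ?case by (auto simp: Ck_on.simps differentiable_def)
  qed
qed

lemma pd_bounded_linear:
  assumes "bounded_linear h" "f differentiable at x"
  shows "pd i (\<lambda>x. h (f x)) x = h (pd i f x)"
  using pd_eqI[OF bounded_linear.has_derivative[OF assms(1)]] assms(2)
  unfolding frechet_derivative_works pd_def by blast

text \<open>The scalar case rests on a mean value theorem with equality, so vector values are tested
  against every fixed vector \<open>c\<close>.\<close>

lemma pd_commute:
  fixes f :: "real^2 \<Rightarrow> 'b::real_inner"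
  assumes f: "Ck_on (Suc (Suc 0)) S f" and S: "open S" "x \<in> S"
  shows "pd j (pd i f) x = pd i (pd j f) x"
proof -
  have *: "pd k (pd l (\<lambda>y. f y \<bullet> c)) x = pd k (pd l f) x \<bullet> c" for k l c
  proof -
    have "pd l (\<lambda>y. f y \<bullet> c) y = pd l f y \<bullet> c" if "y \<in> S" for y
      using pd_bounded_linear[OF bounded_linear_inner_left C1_on_differentiable[OF Ck_on_2_imp_1[OF f] that]] .
    from pd_cong[OF S this]
    have "pd k (pd l (\<lambda>y. f y \<bullet> c)) x = pd k (\<lambda>y. pd l f y \<bullet> c) x" .
    also have "\<dots> = pd k (pd l f) x \<bullet> c"
      using pd_bounded_linear[OF bounded_linear_inner_left C1_on_differentiable[OF C1_on_pd[OF f] S(2)]] .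
    finally show ?thesis .
  qed
  have "pd j (pd i (\<lambda>y. f y \<bullet> c)) x = pd i (pd j (\<lambda>y. f y \<bullet> c)) x" for c
    by (rule pd_commute_real[OF Ck_on_bounded_linear[OF bounded_linear_inner_left S(1) f] S])
  then have "(pd j (pd i f) x - pd i (pd j f) x) \<bullet> c = 0" for c
    by (simp add: * inner_diff_left)
  then show ?thesis
    using inner_eq_zero_iff[of "pd j (pd i f) x - pd i (pd j f) x"] by simp
qed

text \<open>Translation invariance of Lebesgue measure makes the integral of every difference
  quotient of \<open>g\<close> vanish. The quotients converge to \<open>pd i g\<close> and are
  dominated by a constant on a ball.\<close>

lemma integral_pd_eq_0:
  fixes g :: "real^2 \<Rightarrow> real"
  assumes g: "C1_on UNIV g" and supp: "\<And>x. x \<notin> cball 0 R \<Longrightarrow> g x = 0"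
  shows "has_bochner_integral lborel (pd i g) 0"
proof -
  let ?e = "axis i 1 :: real^2"
  have gd: "g differentiable at x" for x
    using C1_on_differentiable[OF g] by simp
  have cg: "continuous_on UNIV g" and cD: "continuous_on UNIV (pd i g)"
    using C1_on_imp_continuous_on[OF g] continuous_on_pd[OF g] .
  have D0: "pd i g x = 0" if "x \<notin> cball 0 R" for x
  proof -
    have "pd i g x = pd i (\<lambda>x. 0::real) x"
      by (rule pd_cong[of "- cball 0 R"]) (use that supp in auto)
    then show ?thesis by (simp add: pd_def frechet_derivative_const)
  qed
  obtain C where C: "\<And>x. \<bar>pd i g x\<bar> \<le> C"
  proof -
    have "bounded (pd i g ` cball 0 R)"
      by (intro compact_imp_bounded compact_continuous_image continuous_on_subset[OF cD]) auto
    then obtain C where C: "\<And>x. x \<in> cball 0 R \<Longrightarrow> \<bar>pd i g x\<bar> \<le> C"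
      unfolding bounded_iff by (metis imageI real_norm_def)
    have "\<bar>pd i g x\<bar> \<le> max C 0" for x
      using C[of x] D0[of x] by (cases "x \<in> cball 0 R") auto
    then show ?thesis using that by blast
  qed
  define s where "s = (\<lambda>n x. (g (x + (1 / real (Suc n)) *\<^sub>R ?e) - g x) * real (Suc n))"
  have mv: "\<exists>t. 0 < t \<and> t < 1 / real (Suc n) \<and> s n x = pd i g (x + t *\<^sub>R ?e)" for n x
  proof -
    obtain t where "0 < t" "t < 1 / real (Suc n)"
      "g (x + (1 / real (Suc n)) *\<^sub>R ?e) - g x = 1 / real (Suc n) * pd i g (x + t *\<^sub>R ?e)"
      using mvt_pd[of "1 / real (Suc n)" g x i] gd by auto
    then show ?thesis by (auto simp: s_def simp del: of_nat_Suc)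
  qed
  have lim: "(\<lambda>n. s n x) \<longlonglongrightarrow> pd i g x" for x
  proof -
    obtain t where t: "\<And>n. 0 < t n" "\<And>n. t n < 1 / real (Suc n)" "\<And>n. s n x = pd i g (x + t n *\<^sub>R ?e)"
      using mv[of _ x] by metis
    have "t \<longlonglongrightarrow> 0"
      by (rule tendsto_sandwich[OF _ _ tendsto_const LIMSEQ_inverse_real_of_nat])
        (use t(1,2) in \<open>auto intro!: always_eventually less_imp_le simp: inverse_eq_divide\<close>)
    then have "(\<lambda>n. x + t n *\<^sub>R ?e) \<longlonglongrightarrow> x + 0 *\<^sub>R ?e"
      by (intro tendsto_intros)
    moreover have "isCont (pd i g) (x + 0 *\<^sub>R ?e)"
      using cD continuous_on_eq_continuous_at[OF open_UNIV] by blast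
    ultimately have "(\<lambda>n. pd i g (x + t n *\<^sub>R ?e)) \<longlonglongrightarrow> pd i g (x + 0 *\<^sub>R ?e)"
      using isCont_tendsto_compose by blast
    then show ?thesis by (simp add: t(3))
  qed
  \<comment> \<open>The increments have length at most 1, so by the mean value theorem all quotients
    vanish outside the ball of radius \<open>R + 1\<close>.\<close>
  have bound: "\<bar>s n x\<bar> \<le> C * indicator (cball 0 (R + 1)) x" for n x
  proof (cases "x \<in> cball 0 (R + 1)")
    case True
    then show ?thesis using mv[of n x] C by (metis indicator_simps(1) mult.right_neutral)
  next
    case False
    obtain t where t: "0 < t" "t < 1 / real (Suc n)" "s n x = pd i g (x + t *\<^sub>R ?e)"
      using mv by blast
    have "1 / real (Suc n) \<le> 1" by simp
    then have "t \<le> 1" using t by linarith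
    then have "norm (t *\<^sub>R ?e) \<le> 1" using t by simp
    then have "x + t *\<^sub>R ?e \<notin> cball 0 R"
      using False norm_triangle_ineq4[of "x + t *\<^sub>R ?e" "t *\<^sub>R ?e"] by simp
    then show ?thesis using t D0 False by simp
  qed
  have cball_fin: "emeasure lborel (cball 0 r :: (real^2) set) < \<infinity>" for r
    by (rule emeasure_lborel_cball_finite)
  have int_const: "integrable lborel (\<lambda>x::real^2. c * indicator (cball 0 r) x :: real)" for c r
    by (intro integrable_mult_right integrable_real_indicator) (use cball_fin in auto)
  have meas: "g \<in> borel_measurable borel" "pd i g \<in> borel_measurable borel"
    using cg cD borel_measurable_continuous_onI by blast+
  then have smeas: "s n \<in> borel_measurable lborel" for n
    unfolding s_def by measurable
  have intg: "integrable lborel g"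
  proof -
    have "integrable lborel (\<lambda>x. indicator (cball 0 R) x *\<^sub>R g x)"
      by (rule borel_integrable_compact[OF compact_cball continuous_on_subset[OF cg subset_UNIV]])
    moreover have "(\<lambda>x. indicator (cball 0 R) x *\<^sub>R g x) = g"
    proof
      show "indicator (cball 0 R) x *\<^sub>R g x = g x" for x
        using supp[of x] by (cases "x \<in> cball 0 R") auto
    qed
    ultimately show ?thesis by metis
  qed
  have "integral\<^sup>L lborel (s n) = 0" for n
  proof -
    let ?t = "(1 / real (Suc n)) *\<^sub>R ?e"
    have eq: "distr lborel borel ((+) ?t) = lborel"
      by (rule lborel_distr_plus)
    have "integrable (distr lborel borel ((+) ?t)) g"
      unfolding eq by (rule intg)
    then have "integrable lborel (\<lambda>x. g (x + ?t))"
      using meas by (subst (asm) integrable_distr_eq) (auto simp: add.commute)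
    moreover have "integral\<^sup>L lborel (\<lambda>x. g (x + ?t)) = integral\<^sup>L lborel g"
      using integral_distr[of "(+) ?t" lborel borel g] meas unfolding eq by (simp add: add.commute)
    ultimately show ?thesis
      using intg by (simp add: s_def)
  qed
  moreover have "(\<lambda>n. integral\<^sup>L lborel (s n)) \<longlonglongrightarrow> integral\<^sup>L lborel (pd i g)"
    and "integrable lborel (pd i g)"
    using integral_dominated_convergence[of "pd i g" lborel s "\<lambda>x. C * indicator (cball 0 (R + 1)) x"]
      integrable_dominated_convergence[of "pd i g" lborel s "\<lambda>x. C * indicator (cball 0 (R + 1)) x"]
      lim bound smeas meas int_const by auto
  ultimately show ?thesis
    by (simp add: has_bochner_integral_iff LIMSEQ_const_iff)
qed

text \<open>Because \<open>f\<close> vanishes off a compact subset of \<open>U\<close>, the product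
  \<open>f x * P x\<close> extends by zero to a C1 function on the whole plane, however
  \<open>P\<close> behaves near the boundary of \<open>U\<close>.\<close>

lemma integral_by_parts:
  fixes f P :: "real^2 \<Rightarrow> real"
  assumes U: "open U" and K: "compact K" "K \<subseteq> U" and f: "C1_on U f" and f0: "\<And>x. x \<in> U - K \<Longrightarrow> f x = 0"
    and P: "C1_on U P"
  shows "has_bochner_integral lborel (\<lambda>x. indicator U x * (pd i f x * P x + f x * pd i P x)) 0"
proof -
  define g where "g = (\<lambda>x. if x \<in> U then f x * P x else 0)"
  have "C1_on U g"
    by (rule C1_on_cong[OF C1_on_mult[OF f P] U]) (simp add: g_def)
  moreover have "C1_on (- K) g"
    by (rule C1_on_cong[OF C1_on_const[of _ 0]])
      (use K f0 compact_imp_closed in \<open>auto simp: g_def\<close>)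
  ultimately have "C1_on (U \<union> - K) g"
    using U K compact_imp_closed by (intro C1_on_Un) auto
  moreover have "U \<union> - K = UNIV" using K by auto
  ultimately have g: "C1_on UNIV g" by simp
  obtain R where R: "K \<subseteq> cball 0 R"
    using bounded_subset_ballD[OF compact_imp_bounded[OF K(1)]] ball_subset_cball by (metis subset_trans)
  have g0: "g x = 0" if "x \<notin> K" for x
    using that f0 by (auto simp: g_def)
  have "pd i g x = indicator U x * (pd i f x * P x + f x * pd i P x)" for x
  proof (cases "x \<in> U")
    case True
    have "pd i g x = pd i (\<lambda>x. f x * P x) x"
      by (rule pd_cong[OF U True]) (simp add: g_def)
    also have "\<dots> = pd i f x * P x + f x * pd i P x"
      using pd_eqI[OF has_derivative_mult[OF C1_on_has_derivative[OF f True] C1_on_has_derivative[OF P True]]]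
      by (simp add: pd_def)
    finally show ?thesis using True by simp
  next
    case False
    have "pd i g x = pd i (\<lambda>x. 0::real) x"
      by (rule pd_cong[of "- K"]) (use False K g0 compact_imp_closed in auto)
    then show ?thesis using False by (simp add: pd_def frechet_derivative_const)
  qed
  then have "pd i g = (\<lambda>x. indicator U x * (pd i f x * P x + f x * pd i P x))"
    by auto
  moreover have "g x = 0" if "x \<notin> cball 0 R" for x
    using g0 R that by blast
  ultimately show ?thesis
    using integral_pd_eq_0[OF g, of R i] by simp
qed

section \<open>The angle function in a parametrization\<close>

text \<open>For a unit normal \<open>n\<close> and a tangent vector \<open>X\<close>,
  \<open>cross_e3 n X\<close> is the vertical component of \<open>X\<close> turned by a right angle
  in the tangent plane. Fluxes of gradients are expressed by it.\<close>

definition cross_e3 :: "real^3 \<Rightarrow> real^3 \<Rightarrow> real" where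
  "cross_e3 u v = cross3 u v \<bullet> e3"

lemma e3_nth [simp]: "e3 $ 1 = 0" "e3 $ 2 = 0" "e3 $ 3 = 1"
  by (simp_all add: e3_def)

lemma cross_e3_bilinear: "bounded_bilinear cross_e3"
proof -
  have "bilinear cross_e3"
    by (simp add: bilinear_def linear_iff cross_e3_def cross_add_left cross_add_right cross_mult_left
        cross_mult_right inner_add_left)
  then show ?thesis
    using bilinear_conv_bounded_bilinear by blast
qed

text \<open>Cramer's rule in the basis \<open>a\<close>, \<open>b\<close>, \<open>c\<close>, where
  the factor on the left is the Gram determinant. Cleared of denominators it is a polynomial
  identity in the components.\<close>

lemma frame_expansion:
  fixes a b w :: "real^3"
  defines "c \<equiv> cross3 a b"
  shows "((a \<bullet> a) * (b \<bullet> b) - (a \<bullet> b)\<^sup>2) *\<^sub>R w =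
    ((b \<bullet> b) * (w \<bullet> a) - (a \<bullet> b) * (w \<bullet> b)) *\<^sub>R a +
    ((a \<bullet> a) * (w \<bullet> b) - (a \<bullet> b) * (w \<bullet> a)) *\<^sub>R b + (w \<bullet> c) *\<^sub>R c"
  unfolding c_def
  by (simp add: cross3_simps forall_3 power2_eq_square)

text \<open>Isolates the linear algebra at one point: \<open>a\<close> and \<open>b\<close> stand
  for the coordinate tangent vectors, and positivity of their Gram determinant expresses linear
  independence.\<close>

locale adapted_frame =
  fixes a b n :: "real^3"
  assumes D: "(a \<bullet> a) * (b \<bullet> b) - (a \<bullet> b)\<^sup>2 > 0"
    and na: "n \<bullet> a = 0" and nb: "n \<bullet> b = 0" and nn: "n \<bullet> n = 1"
begin

text \<open>Its absolute value is the area density. Its sign tells whether the parametrization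
  agrees with the orientation by \<open>n\<close>, which an atlas need not do.\<close>

definition "signed_area = n \<bullet> cross3 a b"

lemma signed_area_sq: "signed_area\<^sup>2 = (a \<bullet> a) * (b \<bullet> b) - (a \<bullet> b)\<^sup>2"
proof -
  have "((a \<bullet> a) * (b \<bullet> b) - (a \<bullet> b)\<^sup>2) *\<^sub>R n = signed_area *\<^sub>R cross3 a b"
    using frame_expansion[of a b n] na nb by (simp add: signed_area_def)
  then have "(((a \<bullet> a) * (b \<bullet> b) - (a \<bullet> b)\<^sup>2) *\<^sub>R n) \<bullet> n = (signed_area *\<^sub>R cross3 a b) \<bullet> n"
    by simp
  then show ?thesis
    by (simp add: nn power2_eq_square inner_commute signed_area_def)
qed

lemma signed_area_nz: "signed_area \<noteq> 0"
  using signed_area_sq D by auto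

lemma cross_eq: "cross3 a b = signed_area *\<^sub>R n"
proof -
  have "((a \<bullet> a) * (b \<bullet> b) - (a \<bullet> b)\<^sup>2) *\<^sub>R n = signed_area *\<^sub>R cross3 a b"
    using frame_expansion[of a b n] na nb by (simp add: signed_area_def)
  then have "signed_area *\<^sub>R (signed_area *\<^sub>R n) = signed_area *\<^sub>R cross3 a b"
    unfolding signed_area_sq[symmetric] by (simp add: power2_eq_square)
  then have "signed_area *\<^sub>R n = cross3 a b"
    unfolding real_vector.scale_cancel_left using signed_area_nz by blast
  then show ?thesis ..
qed

lemma tangential_combination:
  assumes "w \<bullet> n = 0"
  obtains p q where "w = p *\<^sub>R a + q *\<^sub>R b"
proof -
  define p where "p = (b \<bullet> b) * (w \<bullet> a) - (a \<bullet> b) * (w \<bullet> b)"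
  define q where "q = (a \<bullet> a) * (w \<bullet> b) - (a \<bullet> b) * (w \<bullet> a)"
  have "signed_area\<^sup>2 *\<^sub>R w = p *\<^sub>R a + q *\<^sub>R b"
    unfolding signed_area_sq p_def q_def using frame_expansion[of a b w] assms by (simp add: cross_eq)
  moreover have "w = (1 / signed_area\<^sup>2) *\<^sub>R (signed_area\<^sup>2 *\<^sub>R w)"
    using signed_area_nz by simp
  ultimately have "w = (1 / signed_area\<^sup>2) *\<^sub>R (p *\<^sub>R a + q *\<^sub>R b)"
    by simp
  also have "\<dots> = (p / signed_area\<^sup>2) *\<^sub>R a + (q / signed_area\<^sup>2) *\<^sub>R b"
    by (simp add: scaleR_add_right)
  finally show ?thesis by (rule that)
qed

text \<open>Multiplication by \<open>signed_area\<close> replaces \<open>n\<close> by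
  \<open>cross3 a b\<close>, and the vector triple product formula applies. Up to sign, the
  right-hand sides are the coefficients of the gradient of the height in the basis \<open>a\<close>,
  \<open>b\<close>, times the Gram determinant.\<close>

lemma cross_e3_normal:
  "signed_area * cross_e3 n a = (a \<bullet> a) * (b \<bullet> e3) - (a \<bullet> b) * (a \<bullet> e3)"
  "signed_area * cross_e3 n b = (a \<bullet> b) * (b \<bullet> e3) - (b \<bullet> b) * (a \<bullet> e3)"
proof -
  have "signed_area * cross_e3 n w = cross3 (cross3 a b) w \<bullet> e3" for w
    unfolding cross_eq by (simp add: cross_e3_def cross_mult_left)
  then show "signed_area * cross_e3 n a = (a \<bullet> a) * (b \<bullet> e3) - (a \<bullet> b) * (a \<bullet> e3)"
    "signed_area * cross_e3 n b = (a \<bullet> b) * (b \<bullet> e3) - (b \<bullet> b) * (a \<bullet> e3)"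
    by (simp_all only:) (simp_all add: cross3_simps)
qed

lemma cross_e3_tangent: "cross_e3 a b = signed_area * (n \<bullet> e3)"
  by (simp add: cross_e3_def cross_eq)

text \<open>Splitting \<open>e3\<close> into its tangential part grad mu and its normal part
  \<open>(n \<bullet> e3) *\<^sub>R n\<close> gives |grad mu|^2 = 1 - eta^2, which appears here
  multiplied by the Gram determinant.\<close>

lemma height_gradient:
  "(b \<bullet> b) * (a \<bullet> e3)\<^sup>2 - 2 * (a \<bullet> b) * (a \<bullet> e3) * (b \<bullet> e3) + (a \<bullet> a) * (b \<bullet> e3)\<^sup>2 =
    signed_area\<^sup>2 * (1 - (n \<bullet> e3)\<^sup>2)"
proof -
  have "((a \<bullet> a) * (b \<bullet> b) - (a \<bullet> b)\<^sup>2) *\<^sub>R e3 \<bullet> e3 =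
    ((b \<bullet> b) * (e3 \<bullet> a) - (a \<bullet> b) * (e3 \<bullet> b)) * (a \<bullet> e3) +
    ((a \<bullet> a) * (e3 \<bullet> b) - (a \<bullet> b) * (e3 \<bullet> a)) * (b \<bullet> e3) + (e3 \<bullet> cross3 a b) * (cross3 a b \<bullet> e3)"
    by (subst frame_expansion) (simp add: inner_add_left)
  moreover have "e3 \<bullet> e3 = 1"
    by (simp add: inner_vec_def sum_3)
  ultimately have "signed_area\<^sup>2 = ((b \<bullet> b) * (e3 \<bullet> a) - (a \<bullet> b) * (e3 \<bullet> b)) * (a \<bullet> e3) +
    ((a \<bullet> a) * (e3 \<bullet> b) - (a \<bullet> b) * (e3 \<bullet> a)) * (b \<bullet> e3) + (signed_area * (n \<bullet> e3))\<^sup>2"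
    unfolding signed_area_sq[symmetric] by (simp add: cross_eq inner_commute power2_eq_square)
  then show ?thesis
    by (simp add: inner_commute power2_eq_square algebra_simps)
qed

end

text \<open>\<open>n1\<close> and \<open>n2\<close> stand for the partial derivatives of the normal;
  \<open>sym\<close> is the symmetry of the second fundamental form.\<close>

locale weingarten_frame = adapted_frame +
  fixes n1 n2 :: "real^3"
  assumes n1n: "n1 \<bullet> n = 0" and n2n: "n2 \<bullet> n = 0" and sym: "n1 \<bullet> b = n2 \<bullet> a"
begin

text \<open>\<open>tr\<close> and \<open>gauss\<close> are the trace and determinant of the shape
  operator, that is H (without a factor 1/2) and the Gauss curvature, in terms of the coefficients
  of the two fundamental forms.\<close>

definition "tr = ((b \<bullet> b) * (n1 \<bullet> a) - (a \<bullet> b) * (n1 \<bullet> b + n2 \<bullet> a) + (a \<bullet> a) * (n2 \<bullet> b)) /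
  ((a \<bullet> a) * (b \<bullet> b) - (a \<bullet> b)\<^sup>2)"

definition "gauss = ((n1 \<bullet> a) * (n2 \<bullet> b) - (n1 \<bullet> b) * (n2 \<bullet> a)) / ((a \<bullet> a) * (b \<bullet> b) - (a \<bullet> b)\<^sup>2)"

text \<open>\<open>p\<close>, \<open>q\<close>, \<open>r\<close>, \<open>t\<close> are the entries
  of the shape operator in the basis \<open>a\<close>, \<open>b\<close>, and the third equation is
  its self-adjointness. In these entries the later identities become polynomial.\<close>

lemma weingarten:
  obtains p q r t where "n1 = p *\<^sub>R a + q *\<^sub>R b" "n2 = r *\<^sub>R a + t *\<^sub>R b"
    "p * (a \<bullet> b) + q * (b \<bullet> b) = r * (a \<bullet> a) + t * (a \<bullet> b)"
    "tr = p + t" "gauss = p * t - q * r"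
proof -
  obtain p q where 1: "n1 = p *\<^sub>R a + q *\<^sub>R b"
    using tangential_combination[OF n1n] by blast
  obtain r t where 2: "n2 = r *\<^sub>R a + t *\<^sub>R b"
    using tangential_combination[OF n2n] by blast
  have "(b \<bullet> b) * (n1 \<bullet> a) - (a \<bullet> b) * (n1 \<bullet> b + n2 \<bullet> a) + (a \<bullet> a) * (n2 \<bullet> b) =
      (p + t) * ((a \<bullet> a) * (b \<bullet> b) - (a \<bullet> b)\<^sup>2)"
    unfolding 1 2 by (simp add: inner_add_left inner_commute power2_eq_square algebra_simps)
  then have "tr = p + t"
    unfolding tr_def using D by simp
  have "(n1 \<bullet> a) * (n2 \<bullet> b) - (n1 \<bullet> b) * (n2 \<bullet> a) =
      (p * t - q * r) * ((a \<bullet> a) * (b \<bullet> b) - (a \<bullet> b)\<^sup>2)"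
    unfolding 1 2 by (simp add: inner_add_left inner_commute power2_eq_square algebra_simps)
  then have "gauss = p * t - q * r"
    unfolding gauss_def using D by simp
  moreover have "p * (a \<bullet> b) + q * (b \<bullet> b) = r * (a \<bullet> a) + t * (a \<bullet> b)"
    using sym unfolding 1 2 by (simp add: inner_add_left inner_commute[of b a])
  ultimately show ?thesis
    using that 1 2 \<open>tr = p + t\<close> by blast
qed

text \<open>For the shape operator \<open>S\<close> and the rotation \<open>J\<close> of the tangent plane by a right angle,
  \<open>S = (tr S) id + J S J\<close>. The flux of the gradient of the angle function thus consists of a curl and a
  multiple of the flux of the gradient of the height, so that in its divergence only the trace is
  differentiated.\<close>

lemma angle_flux:
  "signed_area * (- tr * cross_e3 n b + cross_e3 n n2) = (b \<bullet> b) * (n1 \<bullet> e3) - (a \<bullet> b) * (n2 \<bullet> e3)"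
  "signed_area * (tr * cross_e3 n a - cross_e3 n n1) = (a \<bullet> a) * (n2 \<bullet> e3) - (a \<bullet> b) * (n1 \<bullet> e3)"
proof -
  obtain p q r t where 1: "n1 = p *\<^sub>R a + q *\<^sub>R b" "n2 = r *\<^sub>R a + t *\<^sub>R b"
    and s: "p * (a \<bullet> b) + q * (b \<bullet> b) = r * (a \<bullet> a) + t * (a \<bullet> b)"
    and tr: "tr = p + t" "gauss = p * t - q * r"
    by (rule weingarten)
  interpret cross_e3: bounded_bilinear cross_e3 by (rule cross_e3_bilinear)
  have e: "n1 \<bullet> e3 = p * (a \<bullet> e3) + q * (b \<bullet> e3)" "n2 \<bullet> e3 = r * (a \<bullet> e3) + t * (b \<bullet> e3)"
    "cross_e3 n n1 = p * cross_e3 n a + q * cross_e3 n b" "cross_e3 n n2 = r * cross_e3 n a + t * cross_e3 n b"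
    by (simp_all add: 1 inner_add_left cross_e3.add_right cross_e3.scaleR_right)
  show "signed_area * (- tr * cross_e3 n b + cross_e3 n n2) = (b \<bullet> b) * (n1 \<bullet> e3) - (a \<bullet> b) * (n2 \<bullet> e3)"
    unfolding e tr using cross_e3_normal s by algebra
  show "signed_area * (tr * cross_e3 n a - cross_e3 n n1) = (a \<bullet> a) * (n2 \<bullet> e3) - (a \<bullet> b) * (n1 \<bullet> e3)"
    unfolding e tr using cross_e3_normal s by algebra
qed

text \<open>Every endomorphism S of a plane satisfies Sa x Sb = (det S) a x b and Sa x b + a x Sb =
  (tr S) a x b. Vertical components are taken.\<close>

lemma cross_e3_shape:
  "cross_e3 n1 n2 = gauss * signed_area * (n \<bullet> e3)"
  "cross_e3 n1 b - cross_e3 n2 a = tr * signed_area * (n \<bullet> e3)"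
proof -
  obtain p q r t where 1: "n1 = p *\<^sub>R a + q *\<^sub>R b" "n2 = r *\<^sub>R a + t *\<^sub>R b"
    and s: "p * (a \<bullet> b) + q * (b \<bullet> b) = r * (a \<bullet> a) + t * (a \<bullet> b)"
    and tr: "tr = p + t" "gauss = p * t - q * r"
    by (rule weingarten)
  interpret cross_e3: bounded_bilinear cross_e3 by (rule cross_e3_bilinear)
  have cross_e3: "cross_e3 a a = 0" "cross_e3 b b = 0" "cross_e3 b a = - cross_e3 a b"
    by (simp_all add: cross_e3_def cross3_simps)
  have "cross_e3 n1 n2 = (p * t - q * r) * cross_e3 a b" "cross_e3 n1 b - cross_e3 n2 a = (p + t) * cross_e3 a b"
    unfolding 1
    by (simp_all add: cross_e3.add_right cross_e3.scaleR_right cross_e3.add_left cross_e3.scaleR_left cross_e3 algebra_simps)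
  then show "cross_e3 n1 n2 = gauss * signed_area * (n \<bullet> e3)" "cross_e3 n1 b - cross_e3 n2 a = tr * signed_area * (n \<bullet> e3)"
    unfolding tr cross_e3_tangent by simp_all
qed

text \<open>The left-hand side is e^(-phi) times the divergence of the flux P after the second
  derivatives have cancelled, with \<open>d\<close> and \<open>dd\<close> for phi' and phi'', and
  \<open>h1\<close>, \<open>h2\<close> for the derivatives of \<open>h\<close>. The drift term d
  <grad mu, grad eta> cancels against the part of \<open>h1\<close>, \<open>h2\<close> that contains
  \<open>d\<close>, so that phi'' eta |grad mu|^2 remains. The last two terms give H^2 - 2K, which
  is |S|^2.\<close>

lemma divergence_identity:
  assumes "tr = - h" and h: "h = d * (n \<bullet> e3)"
    and h1: "h1 = dd * (a \<bullet> e3) * (n \<bullet> e3) + d * (n1 \<bullet> e3)"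
    and h2: "h2 = dd * (b \<bullet> e3) * (n \<bullet> e3) + d * (n2 \<bullet> e3)"
  shows "d * ((a \<bullet> e3) * (h * cross_e3 n b + cross_e3 n n2) - (b \<bullet> e3) * (h * cross_e3 n a + cross_e3 n n1))
      + h1 * cross_e3 n b - h2 * cross_e3 n a + h * (cross_e3 n1 b - cross_e3 n2 a) + 2 * cross_e3 n1 n2
    = - signed_area * ((tr\<^sup>2 - 2 * gauss) + dd * (1 - (n \<bullet> e3)\<^sup>2)) * (n \<bullet> e3)"
proof -
  have f: "signed_area * (h * cross_e3 n b + cross_e3 n n2) = (b \<bullet> b) * (n1 \<bullet> e3) - (a \<bullet> b) * (n2 \<bullet> e3)"
    "signed_area * (h * cross_e3 n a + cross_e3 n n1) = - ((a \<bullet> a) * (n2 \<bullet> e3) - (a \<bullet> b) * (n1 \<bullet> e3))"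
    using angle_flux assms(1) by (simp_all add: algebra_simps)
  let ?L = "d * ((a \<bullet> e3) * (h * cross_e3 n b + cross_e3 n n2) - (b \<bullet> e3) * (h * cross_e3 n a + cross_e3 n n1))
      + h1 * cross_e3 n b - h2 * cross_e3 n a"
  \<comment> \<open>The extra factor \<open>signed_area\<close> turns every flux into an expression
    in the coefficients of the metric, so that the claim becomes polynomial.\<close>
  have "signed_area * ?L = - (signed_area\<^sup>2 * (1 - (n \<bullet> e3)\<^sup>2)) * dd * (n \<bullet> e3)"
    unfolding height_gradient[symmetric] h1 h2 using f cross_e3_normal by algebra
  then have "signed_area * ?L = signed_area * (- signed_area * (1 - (n \<bullet> e3)\<^sup>2) * dd * (n \<bullet> e3))"
    by (simp add: power2_eq_square)
  then have "?L = - signed_area * (1 - (n \<bullet> e3)\<^sup>2) * dd * (n \<bullet> e3)"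
    using signed_area_nz mult_left_cancel by blast
  then show ?thesis
    unfolding cross_e3_shape assms(1) by (simp add: algebra_simps power2_eq_square)
qed

end

section \<open>Fundamental forms and the flux equation on a parametrized patch\<close>

definition gE :: "(real^2 \<Rightarrow> real^3) \<Rightarrow> real^2 \<Rightarrow> real" where "gE \<Psi> x = pd 1 \<Psi> x \<bullet> pd 1 \<Psi> x"
definition gF :: "(real^2 \<Rightarrow> real^3) \<Rightarrow> real^2 \<Rightarrow> real" where "gF \<Psi> x = pd 1 \<Psi> x \<bullet> pd 2 \<Psi> x"
definition gG :: "(real^2 \<Rightarrow> real^3) \<Rightarrow> real^2 \<Rightarrow> real" where "gG \<Psi> x = pd 2 \<Psi> x \<bullet> pd 2 \<Psi> x"
definition gD :: "(real^2 \<Rightarrow> real^3) \<Rightarrow> real^2 \<Rightarrow> real" where "gD \<Psi> x = gE \<Psi> x * gG \<Psi> x - (gF \<Psi> x)\<^sup>2"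

text \<open>The inner product of the gradients of \<open>u\<close> and \<open>w\<close>, with the
  inverse of the metric matrix written out.\<close>

definition gprod :: "(real^2 \<Rightarrow> real^3) \<Rightarrow> (real^2 \<Rightarrow> real) \<Rightarrow> (real^2 \<Rightarrow> real) \<Rightarrow> real^2 \<Rightarrow> real" where
  "gprod \<Psi> u w x = (gG \<Psi> x * pd 1 u x * pd 1 w x - gF \<Psi> x * (pd 1 u x * pd 2 w x + pd 2 u x * pd 1 w x)
     + gE \<Psi> x * pd 2 u x * pd 2 w x) / gD \<Psi> x"

definition shape_trace :: "(real^2 \<Rightarrow> real^3) \<Rightarrow> (real^2 \<Rightarrow> real^3) \<Rightarrow> real^2 \<Rightarrow> real" where
  "shape_trace \<Psi> n x = (gG \<Psi> x * (pd 1 n x \<bullet> pd 1 \<Psi> x) - gF \<Psi> x * (pd 1 n x \<bullet> pd 2 \<Psi> x + pd 2 n x \<bullet> pd 1 \<Psi> x)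
     + gE \<Psi> x * (pd 2 n x \<bullet> pd 2 \<Psi> x)) / gD \<Psi> x"

definition shape_det :: "(real^2 \<Rightarrow> real^3) \<Rightarrow> (real^2 \<Rightarrow> real^3) \<Rightarrow> real^2 \<Rightarrow> real" where
  "shape_det \<Psi> n x = ((pd 1 n x \<bullet> pd 1 \<Psi> x) * (pd 2 n x \<bullet> pd 2 \<Psi> x)
     - (pd 1 n x \<bullet> pd 2 \<Psi> x) * (pd 2 n x \<bullet> pd 1 \<Psi> x)) / gD \<Psi> x"

locale surface_patch =
  fixes U :: "(real^2) set" and \<Psi> n :: "real^2 \<Rightarrow> real^3"
  assumes U: "open U"
    and \<Psi>2: "Ck_on (Suc (Suc 0)) U \<Psi>" and n2: "Ck_on (Suc (Suc 0)) U n"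
    and gD_pos: "\<And>x. x \<in> U \<Longrightarrow> gD \<Psi> x > 0"
    and unit: "\<And>x. x \<in> U \<Longrightarrow> n x \<bullet> n x = 1"
    and normal: "\<And>x i. x \<in> U \<Longrightarrow> n x \<bullet> pd i \<Psi> x = 0"
begin

lemmas \<Psi>1 = Ck_on_2_imp_1[OF \<Psi>2]
lemmas n1 = Ck_on_2_imp_1[OF n2]

lemma pd_eq_0:
  assumes "x \<in> U" "\<And>y. y \<in> U \<Longrightarrow> f y = c"
  shows "pd i f x = 0"
  using pd_cong[OF U assms(1), of f "\<lambda>_. c"] assms(2) by simp

text \<open>Differentiating <n, n> = 1 shows that the derivatives of the normal are tangent.
  Differentiating the orthogonality to the tangent vectors turns the symmetry of the second form
  into that of the second derivatives of \<open>\<Psi>\<close>.\<close>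

lemma weingarten_frame:
  assumes x: "x \<in> U"
  shows "weingarten_frame (pd 1 \<Psi> x) (pd 2 \<Psi> x) (n x) (pd 1 n x) (pd 2 n x)"
proof
  show "pd 1 \<Psi> x \<bullet> pd 1 \<Psi> x * (pd 2 \<Psi> x \<bullet> pd 2 \<Psi> x) - (pd 1 \<Psi> x \<bullet> pd 2 \<Psi> x)\<^sup>2 > 0"
    using gD_pos[OF x] by (simp add: gD_def gE_def gF_def gG_def)
  show "n x \<bullet> pd 1 \<Psi> x = 0" "n x \<bullet> pd 2 \<Psi> x = 0" "n x \<bullet> n x = 1"
    using normal unit x by auto
  have "pd i n x \<bullet> n x = 0" for i
    using pd_inner[OF C1_on_differentiable[OF n1 x] C1_on_differentiable[OF n1 x], of i] pd_eq_0[OF x unit, where i = i] by (simp add: inner_commute)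
  then show "pd 1 n x \<bullet> n x = 0" "pd 2 n x \<bullet> n x = 0" by auto
  have "pd i n x \<bullet> pd j \<Psi> x = - (n x \<bullet> pd i (pd j \<Psi>) x)" for i j
    using pd_inner[OF C1_on_differentiable[OF n1 x] C1_on_differentiable[OF C1_on_pd[OF \<Psi>2, of j] x], of i] pd_eq_0[OF x normal[of _ j], where i = i] by simp
  then show "pd 1 n x \<bullet> pd 2 \<Psi> x = pd 2 n x \<bullet> pd 1 \<Psi> x"
    using pd_commute[OF \<Psi>2 U x, of 1 2] by simp
qed

lemma shape_trace_eq: "x \<in> U \<Longrightarrow> shape_trace \<Psi> n x =
    weingarten_frame.tr (pd 1 \<Psi> x) (pd 2 \<Psi> x) (pd 1 n x) (pd 2 n x)"
  by (simp add: shape_trace_def weingarten_frame.tr_def[OF weingarten_frame] gD_def gE_def gF_def gG_def)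

lemma shape_det_eq: "x \<in> U \<Longrightarrow> shape_det \<Psi> n x =
    weingarten_frame.gauss (pd 1 \<Psi> x) (pd 2 \<Psi> x) (pd 1 n x) (pd 2 n x)"
  by (simp add: shape_det_def weingarten_frame.gauss_def[OF weingarten_frame] gD_def gE_def gF_def gG_def)

lemma gD_sqrt: "x \<in> U \<Longrightarrow> sqrt (gD \<Psi> x) = \<bar>n x \<bullet> cross3 (pd 1 \<Psi> x) (pd 2 \<Psi> x)\<bar>"
proof -
  assume x: "x \<in> U"
  interpret weingarten_frame "pd 1 \<Psi> x" "pd 2 \<Psi> x" "n x" "pd 1 n x" "pd 2 n x"
    by (rule weingarten_frame[OF x])
  have "gD \<Psi> x = signed_area\<^sup>2"
    by (simp add: signed_area_sq gD_def gE_def gF_def gG_def)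
  then show ?thesis by (simp add: signed_area_def)
qed

text \<open>The triple product is continuous without zeros, so it has one sign on a connected patch.
  The constant \<open>s\<close> can then be taken out of integrals, which converts signed fluxes
  into integrals against the area element.\<close>

lemma orientation_sign:
  assumes "connected U"
  obtains s where "s\<^sup>2 = (1::real)" "\<And>x. x \<in> U \<Longrightarrow> sqrt (gD \<Psi> x) = s * (n x \<bullet> cross3 (pd 1 \<Psi> x) (pd 2 \<Psi> x))"
proof -
  define A where "A = (\<lambda>x. n x \<bullet> cross3 (pd 1 \<Psi> x) (pd 2 \<Psi> x))"
  have "continuous_on U A"
    unfolding A_def
    by (intro continuous_on_inner C1_on_imp_continuous_on[OF n1] continuous_on_cross
        continuous_on_pd[OF \<Psi>1])
  then have con: "connected (A ` U)"
    using connected_continuous_image assms by blast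
  have sq: "sqrt (gD \<Psi> x) = \<bar>A x\<bar>" "A x \<noteq> 0" if "x \<in> U" for x
    using gD_sqrt[OF that] gD_pos[OF that] by (auto simp: A_def)
  have "(\<forall>x\<in>U. A x > 0) \<or> (\<forall>x\<in>U. A x < 0)"
  proof (rule ccontr)
    assume "\<not> ?thesis"
    then obtain x y where xy: "x \<in> U" "y \<in> U" "A x \<le> 0" "A y \<ge> 0"
      by (auto simp: not_less)
    then have "0 \<in> A ` U"
      using connectedD_interval[OF con, of "A x" "A y" 0] by auto
    then show False using sq(2) by auto
  qed
  then show ?thesis
  proof
    assume "\<forall>x\<in>U. A x > 0"
    then show ?thesis using that[of 1] sq(1) by (simp add: A_def abs_of_pos)
  next
    assume "\<forall>x\<in>U. A x < 0"
    then show ?thesis using that[of "-1"] sq(1) by (simp add: A_def abs_of_neg)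
  qed
qed

text \<open>The integrand is \<open>s\<close> times d_1 (f P_2) - d_2 (f P_1), and both terms
  integrate to zero since \<open>f\<close> has compact support. The term
  \<open>(shape_trace \<Psi> n x)\<^sup>2 - 2 * shape_det \<Psi> n x\<close> is |S|^2.\<close>

lemma weak_angle_equation:
  fixes f :: "real^2 \<Rightarrow> real"
  defines "\<mu> \<equiv> \<lambda>x. \<Psi> x \<bullet> e3" and "\<eta> \<equiv> \<lambda>x. n x \<bullet> e3"
  assumes con: "connected U"
    and \<phi>: "\<And>t. t > \<alpha> \<Longrightarrow> (\<phi> has_real_derivative \<phi>' t) (at t)"
    and \<phi>': "\<And>t. t > \<alpha> \<Longrightarrow> (\<phi>' has_real_derivative \<phi>'' t) (at t)"
    and \<phi>'': "continuous_on {\<alpha><..} \<phi>''"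
    and \<mu>: "\<And>x. x \<in> U \<Longrightarrow> \<mu> x > \<alpha>"
    and H: "\<And>x. x \<in> U \<Longrightarrow> shape_trace \<Psi> n x = - \<phi>' (\<mu> x) * \<eta> x"
    and K: "compact K" "K \<subseteq> U" and f: "C1_on U f" and f0: "\<And>x. x \<in> U - K \<Longrightarrow> f x = 0"
  shows "has_bochner_integral lborel (\<lambda>x. indicator U x * (exp (\<phi> (\<mu> x)) * sqrt (gD \<Psi> x) *
    (gprod \<Psi> f \<eta> x - ((shape_trace \<Psi> n x)\<^sup>2 - 2 * shape_det \<Psi> n x + \<phi>'' (\<mu> x) * (1 - (\<eta> x)\<^sup>2)) * \<eta> x * f x))) 0"
proof -
  have C\<mu>: "C1_on U \<mu>" and C\<eta>: "C1_on U \<eta>"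
    unfolding \<mu>_def \<eta>_def by (rule C1_on_inner[OF \<Psi>1 C1_on_const] C1_on_inner[OF n1 C1_on_const])+
  have cont: "continuous_on U (\<lambda>x. g (\<mu> x))" if "continuous_on {\<alpha><..} g" for g :: "real \<Rightarrow> real"
    using continuous_on_compose2[OF that C1_on_imp_continuous_on[OF C\<mu>]] \<mu> by auto
  have c\<phi>': "continuous_on {\<alpha><..} \<phi>'"
    using \<phi>' by (auto intro!: continuous_at_imp_continuous_on DERIV_isCont)
  have C\<phi>: "C1_on U (\<lambda>x. \<phi> (\<mu> x))"
    by (rule C1_on_compose_real[OF C\<mu>, where h' = \<phi>']) (use \<phi> \<mu> cont c\<phi>' in auto)
  have C\<phi>': "C1_on U (\<lambda>x. \<phi>' (\<mu> x))"
    by (rule C1_on_compose_real[OF C\<mu>, where h' = \<phi>'']) (use \<phi>' \<mu> cont \<phi>'' in auto)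
  define e where "e = (\<lambda>x. exp (\<phi> (\<mu> x)))"
  define h where "h = (\<lambda>x. \<phi>' (\<mu> x) * \<eta> x)"
  define a b where "a = (\<lambda>i x. cross_e3 (n x) (pd i \<Psi> x))" and "b = (\<lambda>i x. cross_e3 (n x) (pd i n x))"
  \<comment> \<open>Up to the factor \<open>s\<close>, \<open>P 2\<close> and \<open>- P 1\<close>
    are the coordinates of e^phi grad eta times the area density. They involve only first
    derivatives of \<open>\<Psi>\<close> and \<open>n\<close>, so they are C1.\<close>
  define P where "P = (\<lambda>i x. e x * (h x * a i x + b i x))"
  have Ce: "C1_on U e" and Ch: "C1_on U h"
    unfolding e_def h_def by (rule C1_on_exp[OF C\<phi>] C1_on_mult[OF C\<phi>' C\<eta>])+
  have Ca: "C1_on U (a i)" and Cb: "C1_on U (b i)" for i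
    unfolding a_def b_def
    by (rule C1_on_bilinear[OF n1 C1_on_pd[OF \<Psi>2] cross_e3_bilinear] C1_on_bilinear[OF n1 C1_on_pd[OF n2] cross_e3_bilinear])+
  have Chab: "C1_on U (\<lambda>x. h x * a i x + b i x)" for i
    by (rule C1_on_add[OF C1_on_mult[OF Ch Ca] Cb])
  have CP: "C1_on U (P i)" for i
    unfolding P_def by (rule C1_on_mult[OF Ce Chab])
  obtain s where s: "s\<^sup>2 = 1"
    "\<And>x. x \<in> U \<Longrightarrow> sqrt (gD \<Psi> x) = s * (n x \<bullet> cross3 (pd 1 \<Psi> x) (pd 2 \<Psi> x))"
    using orientation_sign[OF con] by blast
  have pw: "s * ((pd 1 f x * P 2 x + f x * pd 1 (P 2) x) - (pd 2 f x * P 1 x + f x * pd 2 (P 1) x)) =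
    e x * sqrt (gD \<Psi> x) * (gprod \<Psi> f \<eta> x -
      ((shape_trace \<Psi> n x)\<^sup>2 - 2 * shape_det \<Psi> n x + \<phi>'' (\<mu> x) * (1 - (\<eta> x)\<^sup>2)) * \<eta> x * f x)"
    if x: "x \<in> U" for x
  proof -
    note diff = C1_on_differentiable[OF _ x]
    interpret weingarten_frame "pd 1 \<Psi> x" "pd 2 \<Psi> x" "n x" "pd 1 n x" "pd 2 n x"
      by (rule weingarten_frame[OF x])
    have \<mu>i: "pd i \<mu> x = pd i \<Psi> x \<bullet> e3" and \<eta>i: "pd i \<eta> x = pd i n x \<bullet> e3" for i
      unfolding \<mu>_def \<eta>_def
      using pd_bounded_linear[OF bounded_linear_inner_left diff[OF \<Psi>1]]
        pd_bounded_linear[OF bounded_linear_inner_left diff[OF n1]] by blast+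
    have ei: "pd i e x = e x * (\<phi>' (\<mu> x) * pd i \<mu> x)" for i
      unfolding e_def
      using pd_compose_real[OF diff[OF C\<phi>] DERIV_exp] pd_compose_real[OF diff[OF C\<mu>] \<phi>[OF \<mu>[OF x]]] by simp
    have hi: "pd i h x = \<phi>'' (\<mu> x) * pd i \<mu> x * \<eta> x + \<phi>' (\<mu> x) * pd i \<eta> x" for i
      unfolding h_def pd_mult[OF diff[OF C\<phi>'] diff[OF C\<eta>]] pd_compose_real[OF diff[OF C\<mu>] \<phi>'[OF \<mu>[OF x]]]
      by simp
    have ai: "pd i (a j) x = cross_e3 (n x) (pd i (pd j \<Psi>) x) + cross_e3 (pd i n x) (pd j \<Psi> x)"
      and bi: "pd i (b j) x = cross_e3 (n x) (pd i (pd j n) x) + cross_e3 (pd i n x) (pd j n x)" for i j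
      unfolding a_def b_def
      by (rule pd_bilinear[OF cross_e3_bilinear diff[OF n1] diff[OF C1_on_pd[OF \<Psi>2]]]
          pd_bilinear[OF cross_e3_bilinear diff[OF n1] diff[OF C1_on_pd[OF n2]]])+
    have Pi: "pd i (P j) x = e x * (h x * pd i (a j) x + pd i h x * a j x + pd i (b j) x)
        + e x * (\<phi>' (\<mu> x) * pd i \<mu> x) * (h x * a j x + b j x)" for i j
      unfolding P_def pd_mult[OF diff[OF Ce] diff[OF Chab]] pd_add[OF diff[OF C1_on_mult[OF Ch Ca]] diff[OF Cb]]
        pd_mult[OF diff[OF Ch] diff[OF Ca]] ei by simp
    have skew: "cross_e3 (pd 2 n x) (pd 1 n x) = - cross_e3 (pd 1 n x) (pd 2 n x)"
      by (simp add: cross_e3_def cross3_simps)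
    have sym: "pd 2 (pd 1 \<Psi>) x = pd 1 (pd 2 \<Psi>) x" "pd 2 (pd 1 n) x = pd 1 (pd 2 n) x"
      using pd_commute[OF \<Psi>2 U x] pd_commute[OF n2 U x] by blast+
    have trh: "tr = - h x"
      using H[OF x] shape_trace_eq[OF x] by (simp add: h_def)
    have sq: "sqrt (gD \<Psi> x) = s * signed_area"
      using s(2)[OF x] by (simp add: signed_area_def)
    have gD: "gD \<Psi> x = signed_area\<^sup>2"
      by (simp add: signed_area_sq gD_def gE_def gF_def gG_def)
    \<comment> \<open>The second derivatives of \<open>\<Psi>\<close> and \<open>n\<close> cancel by
      \<open>sym\<close>; by \<open>skew\<close> the two products of derivatives of \<open>n\<close>
      add up, whence the factor 2.\<close>
    have "pd 1 (P 2) x - pd 2 (P 1) x = e x * (\<phi>' (\<mu> x) * (pd 1 \<mu> x * (h x * a 2 x + b 2 x)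
        - pd 2 \<mu> x * (h x * a 1 x + b 1 x)) + pd 1 h x * a 2 x - pd 2 h x * a 1 x
        + h x * (cross_e3 (pd 1 n x) (pd 2 \<Psi> x) - cross_e3 (pd 2 n x) (pd 1 \<Psi> x)) + 2 * cross_e3 (pd 1 n x) (pd 2 n x))"
      unfolding Pi ai bi skew sym by (simp add: algebra_simps)
    also have "\<dots> = e x * (- signed_area * ((tr\<^sup>2 - 2 * gauss) + \<phi>'' (\<mu> x) * (1 - (\<eta> x)\<^sup>2)) * \<eta> x)"
      using divergence_identity[OF trh, of "\<phi>' (\<mu> x)" "pd 1 h x" "\<phi>'' (\<mu> x)" "pd 2 h x"]
      unfolding hi unfolding \<mu>i \<eta>i unfolding h_def a_def b_def \<eta>_def \<mu>_def by simp
    finally have div: "pd 1 (P 2) x - pd 2 (P 1) x =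
        - e x * signed_area * ((tr\<^sup>2 - 2 * gauss) + \<phi>'' (\<mu> x) * (1 - (\<eta> x)\<^sup>2)) * \<eta> x"
      by simp
    have flux: "signed_area * (h x * a 2 x + b 2 x) = gG \<Psi> x * pd 1 \<eta> x - gF \<Psi> x * pd 2 \<eta> x"
      "- (signed_area * (h x * a 1 x + b 1 x)) = gE \<Psi> x * pd 2 \<eta> x - gF \<Psi> x * pd 1 \<eta> x"
      using angle_flux by (simp_all add: trh a_def b_def gG_def gF_def gE_def \<eta>i algebra_simps)
    have "gprod \<Psi> f \<eta> x = (pd 1 f x * (gG \<Psi> x * pd 1 \<eta> x - gF \<Psi> x * pd 2 \<eta> x)
        + pd 2 f x * (gE \<Psi> x * pd 2 \<eta> x - gF \<Psi> x * pd 1 \<eta> x)) / gD \<Psi> x"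
      by (simp add: gprod_def algebra_simps)
    also have "\<dots> = (pd 1 f x * (h x * a 2 x + b 2 x) - pd 2 f x * (h x * a 1 x + b 1 x)) / signed_area"
      unfolding flux[symmetric] gD using signed_area_nz by (simp add: field_simps power2_eq_square)
    finally have gp: "signed_area * gprod \<Psi> f \<eta> x =
        pd 1 f x * (h x * a 2 x + b 2 x) - pd 2 f x * (h x * a 1 x + b 1 x)"
      using signed_area_nz by simp
    have "s * ((pd 1 f x * P 2 x + f x * pd 1 (P 2) x) - (pd 2 f x * P 1 x + f x * pd 2 (P 1) x))
        = s * (e x * (pd 1 f x * (h x * a 2 x + b 2 x) - pd 2 f x * (h x * a 1 x + b 1 x))
          + f x * (pd 1 (P 2) x - pd 2 (P 1) x))"
      by (simp add: P_def algebra_simps)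
    also have "\<dots> = e x * (s * signed_area) * (gprod \<Psi> f \<eta> x -
        ((tr\<^sup>2 - 2 * gauss) + \<phi>'' (\<mu> x) * (1 - (\<eta> x)\<^sup>2)) * \<eta> x * f x)"
      unfolding gp[symmetric] div by (simp add: algebra_simps)
    finally show ?thesis
      by (simp add: sq shape_trace_eq[OF x] shape_det_eq[OF x])
  qed
  have "has_bochner_integral lborel (\<lambda>x. s * (indicator U x * (pd 1 f x * P 2 x + f x * pd 1 (P 2) x)
      - indicator U x * (pd 2 f x * P 1 x + f x * pd 2 (P 1) x))) (s * (0 - 0))"
    by (intro has_bochner_integral_mult_right has_bochner_integral_diff
        integral_by_parts[OF U K f f0 CP])
  moreover have "s * (indicator U x * (pd 1 f x * P 2 x + f x * pd 1 (P 2) x)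
      - indicator U x * (pd 2 f x * P 1 x + f x * pd 2 (P 1) x)) =
    indicator U x * (e x * sqrt (gD \<Psi> x) * (gprod \<Psi> f \<eta> x -
      ((shape_trace \<Psi> n x)\<^sup>2 - 2 * shape_det \<Psi> n x + \<phi>'' (\<mu> x) * (1 - (\<eta> x)\<^sup>2)) * \<eta> x * f x))" for x
    using pw[of x] by (cases "x \<in> U") (auto simp: algebra_simps)
  ultimately show ?thesis
    by (simp add: e_def)
qed

end

section \<open>Geometry in charts\<close>

text \<open>Vieta's formulas. A double root leaves a singleton, for which minimum and maximum
  coincide and thus still count multiplicity.\<close>

lemma quadratic_roots_Min_Max:
  fixes T K :: real
  assumes "T\<^sup>2 - 4 * K \<ge> 0"
  defines "S \<equiv> {k. k\<^sup>2 - T * k + K = 0}"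
  shows "Min S + Max S = T" "(Min S)\<^sup>2 + (Max S)\<^sup>2 = T\<^sup>2 - 2 * K"
proof -
  define d where "d = sqrt (T\<^sup>2 - 4 * K)"
  have d: "d \<ge> 0" "d\<^sup>2 = T\<^sup>2 - 4 * K"
    using assms by (simp_all add: d_def)
  have "k\<^sup>2 - T * k + K = 0 \<longleftrightarrow> k = (T - d) / 2 \<or> k = (T + d) / 2" for k
  proof -
    have "4 * (k\<^sup>2 - T * k + K) = (2 * k - T - d) * (2 * k - T + d)"
      using d(2) by (simp add: power2_eq_square algebra_simps)
    then have "k\<^sup>2 - T * k + K = 0 \<longleftrightarrow> 2 * k - T - d = 0 \<or> 2 * k - T + d = 0"
      by (metis mult_eq_0_iff zero_neq_numeral)
    then show ?thesis by auto
  qed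
  then have S: "S = {(T - d) / 2, (T + d) / 2}"
    unfolding S_def by blast
  have mm: "Min S = (T - d) / 2" "Max S = (T + d) / 2"
    using d(1) by (auto simp: S)
  show "Min S + Max S = T" "(Min S)\<^sup>2 + (Max S)\<^sup>2 = T\<^sup>2 - 2 * K"
    unfolding mm using d(2) by (simp_all add: power2_eq_square field_simps)
qed

section \<open>Principal curvatures in a frame\<close>

context adapted_frame
begin

lemma independent_frame:
  assumes "v *\<^sub>R a + w *\<^sub>R b = 0"
  shows "v = 0" "w = 0"
proof -
  have "(v *\<^sub>R a + w *\<^sub>R b) \<bullet> a = 0" "(v *\<^sub>R a + w *\<^sub>R b) \<bullet> b = 0"
    using assms by simp_all
  then have *: "v * (a \<bullet> a) + w * (a \<bullet> b) = 0" "v * (a \<bullet> b) + w * (b \<bullet> b) = 0"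
    by (simp_all add: inner_add_left inner_commute[of b a])
  have "v * ((a \<bullet> a) * (b \<bullet> b) - (a \<bullet> b)\<^sup>2) = 0" "w * ((a \<bullet> a) * (b \<bullet> b) - (a \<bullet> b)\<^sup>2) = 0"
    using * by algebra+
  then show "v = 0" "w = 0" using D by auto
qed

end

context weingarten_frame
begin

text \<open>A self-adjoint operator has real eigenvalues. Concretely, self-adjointness eliminates
  \<open>r\<close>, and after multiplication by the square of \<open>a \<bullet> a\<close> the
  discriminant is a square plus a nonnegative multiple of the Gram determinant.\<close>

lemma discriminant_nonneg: "tr\<^sup>2 - 4 * gauss \<ge> 0"
proof -
  obtain p q r t where 1: "n1 = p *\<^sub>R a + q *\<^sub>R b" "n2 = r *\<^sub>R a + t *\<^sub>R b"
    and s: "p * (a \<bullet> b) + q * (b \<bullet> b) = r * (a \<bullet> a) + t * (a \<bullet> b)"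
    and tr: "tr = p + t" "gauss = p * t - q * r"
    by (rule weingarten)
  have "(a \<bullet> a)\<^sup>2 * (tr\<^sup>2 - 4 * gauss) =
      ((a \<bullet> a) * (p - t) + 2 * q * (a \<bullet> b))\<^sup>2 + 4 * q\<^sup>2 * ((a \<bullet> a) * (b \<bullet> b) - (a \<bullet> b)\<^sup>2)"
    unfolding tr using s by algebra
  also have "\<dots> \<ge> 0"
    using D by (intro add_nonneg_nonneg mult_nonneg_nonneg) auto
  finally have "(a \<bullet> a)\<^sup>2 * (tr\<^sup>2 - 4 * gauss) \<ge> 0" .
  moreover have "a \<bullet> a \<noteq> 0"
    using D by auto
  ultimately show ?thesis
    by (metis zero_le_mult_iff zero_less_power2 not_less)
qed

text \<open>The left-hand side is membership in \<open>shape_eigenvalues\<close> spelled out in the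
  frame; the right-hand side is the characteristic equation.\<close>

lemma eigenvalue_iff:
  "(\<exists>v w. v *\<^sub>R a + w *\<^sub>R b \<noteq> 0 \<and> (\<forall>v' w'. (v *\<^sub>R n1 + w *\<^sub>R n2) \<bullet> (v' *\<^sub>R a + w' *\<^sub>R b) =
      k * ((v *\<^sub>R a + w *\<^sub>R b) \<bullet> (v' *\<^sub>R a + w' *\<^sub>R b)))) \<longleftrightarrow> k\<^sup>2 - tr * k + gauss = 0"
  (is "?L \<longleftrightarrow> ?R")
proof -
  obtain p q r t where 1: "n1 = p *\<^sub>R a + q *\<^sub>R b" "n2 = r *\<^sub>R a + t *\<^sub>R b"
    and tr: "tr = p + t" "gauss = p * t - q * r"
    by (rule weingarten)
  have Z: "v *\<^sub>R n1 + w *\<^sub>R n2 - k *\<^sub>R (v *\<^sub>R a + w *\<^sub>R b) =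
      (v * p + w * r - k * v) *\<^sub>R a + (v * q + w * t - k * w) *\<^sub>R b" for v w
    unfolding 1 by (simp add: algebra_simps)
  show ?thesis
  proof
    assume ?L
    then obtain v w where vw: "v *\<^sub>R a + w *\<^sub>R b \<noteq> 0"
      and eig: "\<And>v' w'. (v *\<^sub>R n1 + w *\<^sub>R n2) \<bullet> (v' *\<^sub>R a + w' *\<^sub>R b) =
        k * ((v *\<^sub>R a + w *\<^sub>R b) \<bullet> (v' *\<^sub>R a + w' *\<^sub>R b))"
      by blast
    have "(v *\<^sub>R n1 + w *\<^sub>R n2 - k *\<^sub>R (v *\<^sub>R a + w *\<^sub>R b)) \<bullet> (v' *\<^sub>R a + w' *\<^sub>R b) = 0" for v' w'
      using eig[of v' w'] by (simp add: inner_diff_left)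
    then have "v *\<^sub>R n1 + w *\<^sub>R n2 - k *\<^sub>R (v *\<^sub>R a + w *\<^sub>R b) = 0"
      unfolding Z by (metis inner_eq_zero_iff)
    then have z: "v * p + w * r - k * v = 0" "v * q + w * t - k * w = 0"
      unfolding Z by (rule independent_frame)+
    have "v * (k\<^sup>2 - tr * k + gauss) = 0" "w * (k\<^sup>2 - tr * k + gauss) = 0"
      unfolding tr using z by algebra+
    with vw show ?R by auto
  next
    assume ?R
    then have det: "(p - k) * (t - k) - q * r = 0"
      unfolding tr by (simp add: power2_eq_square algebra_simps)
    \<comment> \<open>The coordinates of an eigenvector are perpendicular to a nonzero row of the
      system; the second row is then satisfied because the determinant is zero. If both rows vanish,
      every vector is an eigenvector.\<close>
    obtain v w where vw: "v \<noteq> 0 \<or> w \<noteq> 0" and z: "v * p + w * r - k * v = 0" "v * q + w * t - k * w = 0"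
    proof (cases "r = 0 \<and> p = k")
      case False
      show ?thesis
        by (rule that[of "-r" "p - k"]) (use False det in \<open>auto simp: algebra_simps\<close>)
    next
      case r: True
      show ?thesis
      proof (cases "t = k \<and> q = 0")
        case True
        then show ?thesis using r that[of 1 0] by auto
      next
        case False
        show ?thesis
          by (rule that[of "t - k" "- q"]) (use False r in \<open>auto simp: algebra_simps\<close>)
      qed
    qed
    have "v *\<^sub>R n1 + w *\<^sub>R n2 - k *\<^sub>R (v *\<^sub>R a + w *\<^sub>R b) = 0"
      unfolding Z z by simp
    then have "v *\<^sub>R n1 + w *\<^sub>R n2 = k *\<^sub>R (v *\<^sub>R a + w *\<^sub>R b)"
      by simp
    moreover have "v *\<^sub>R a + w *\<^sub>R b \<noteq> 0"
      using vw independent_frame[of v w] by blast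
    ultimately show ?L by (metis inner_scaleR_left)
  qed
qed

text \<open>Under these assumptions \<open>e3\<close> is a nonzero tangent vector in the kernel of
  the second fundamental form, which is therefore singular.\<close>

lemma gauss_eq_0_if_vertical:
  assumes "n \<bullet> e3 = 0" "n1 \<bullet> e3 = 0" "n2 \<bullet> e3 = 0"
  shows "gauss = 0"
proof -
  obtain p q where e: "e3 = p *\<^sub>R a + q *\<^sub>R b"
    using tangential_combination[of e3] assms(1) by (auto simp: inner_commute)
  have "e3 \<noteq> 0"
    using e3_nth(3) by force
  then have "p \<noteq> 0 \<or> q \<noteq> 0" using e by auto
  moreover have "p * (n1 \<bullet> a) + q * (n1 \<bullet> b) = 0" "p * (n2 \<bullet> a) + q * (n2 \<bullet> b) = 0"
    using assms(2,3) by (simp_all add: e inner_add_right)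
  then have "p * ((n1 \<bullet> a) * (n2 \<bullet> b) - (n1 \<bullet> b) * (n2 \<bullet> a)) = 0"
    "q * ((n1 \<bullet> a) * (n2 \<bullet> b) - (n1 \<bullet> b) * (n2 \<bullet> a)) = 0"
    by algebra+
  ultimately have "(n1 \<bullet> a) * (n2 \<bullet> b) - (n1 \<bullet> b) * (n2 \<bullet> a) = 0"
    by auto
  then show ?thesis by (simp add: gauss_def)
qed

end

section \<open>Charts of an oriented immersed surface\<close>

locale oriented_surface =
  fixes A :: "'m::{t2_space, second_countable_topology} param set" and \<psi> N :: "'m \<Rightarrow> real^3"
  assumes surface: "oriented_immersed_surface A \<psi> N"
begin

lemma chart_open: "(V, f) \<in> A \<Longrightarrow> open V" "(V, f) \<in> A \<Longrightarrow> open (f ` V)"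
  using surface by (auto simp: oriented_immersed_surface_def smooth_surface_def)

lemma chart_homeomorphism:
  assumes "(V, f) \<in> A"
  shows "continuous_on V f" "inj_on f V" "continuous_on (f ` V) (the_inv_into V f)"
proof -
  obtain g where g: "homeomorphism V (f ` V) f g"
    using surface assms by (auto simp: oriented_immersed_surface_def smooth_surface_def)
  show f: "continuous_on V f" "inj_on f V"
    using g by (auto simp: homeomorphism_def intro: inj_on_inverseI)
  have "the_inv_into V f y = g y" if "y \<in> f ` V" for y
    using that g f(2) by (auto simp: homeomorphism_def the_inv_into_f_f)
  then show "continuous_on (f ` V) (the_inv_into V f)"
    using g by (simp add: homeomorphism_def cong: continuous_on_cong)
qed

lemma chart_cover: obtains V f x where "(V, f) \<in> A" "x \<in> V" "f x = p"
proof -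
  have "p \<in> (\<Union>(V, f)\<in>A. f ` V)"
    using surface by (auto simp: oriented_immersed_surface_def smooth_surface_def)
  then show ?thesis using that by auto
qed

text \<open>The preimage under \<open>f\<close> cut down to \<open>V\<close>, because
  \<open>f\<close> is arbitrary elsewhere. It serves open sets (domains of transition maps) as well
  as Borel sets (pulling back measures).\<close>

definition overlap :: "(real^2) set \<Rightarrow> (real^2 \<Rightarrow> 'm) \<Rightarrow> 'm set \<Rightarrow> (real^2) set" where
  "overlap V f O' = {x \<in> V. f x \<in> O'}"

lemma open_overlap: "(V, f) \<in> A \<Longrightarrow> open O' \<Longrightarrow> open (overlap V f O')"
  using continuous_open_preimage[of V f O'] chart_open chart_homeomorphism
  by (simp add: overlap_def vimage_def Int_def)

lemma transition:
  assumes "(V, f) \<in> A" "(W, h) \<in> A"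
  shows "C1_on (overlap V f (h ` W)) (the_inv_into W h \<circ> f)"
    and "x \<in> overlap V f (h ` W) \<Longrightarrow> the_inv_into W h (f x) \<in> overlap W h (f ` V)"
    and "x \<in> overlap V f (h ` W) \<Longrightarrow> h (the_inv_into W h (f x)) = f x"
proof -
  have "\<forall>(V, f)\<in>A. \<forall>(W, h)\<in>A. smooth_on {x\<in>V. f x \<in> h ` W} (the_inv_into W h \<circ> f)"
    using surface by (simp add: oriented_immersed_surface_def smooth_surface_def)
  from bspec[OF this assms(1)] have "\<forall>(W, h)\<in>A. smooth_on (overlap V f (h ` W)) (the_inv_into W h \<circ> f)"
    by (simp add: overlap_def)
  from bspec[OF this assms(2)] show "C1_on (overlap V f (h ` W)) (the_inv_into W h \<circ> f)"
    by (simp add: smooth_onD)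
  show *: "h (the_inv_into W h (f x)) = f x" if "x \<in> overlap V f (h ` W)" for x
    using that chart_homeomorphism(2)[OF assms(2)] by (simp add: overlap_def f_the_inv_into_f)
  show "the_inv_into W h (f x) \<in> overlap W h (f ` V)" if "x \<in> overlap V f (h ` W)" for x
  proof -
    have "f x \<in> h ` W" "x \<in> V"
      using that by (simp_all add: overlap_def)
    then have "the_inv_into W h (f x) \<in> W"
      using the_inv_into_into[OF chart_homeomorphism(2)[OF assms(2)]] by blast
    then show ?thesis
      using *[OF that] \<open>x \<in> V\<close> by (simp add: overlap_def)
  qed
qed

lemma transition_chain:
  assumes c: "(V, f) \<in> A" "(W, h) \<in> A" and x: "x \<in> overlap V f (h ` W)"
    and u: "(u \<circ> h) differentiable at (the_inv_into W h (f x))"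
  shows "((u \<circ> f) has_derivative (\<lambda>v. frechet_derivative (u \<circ> h) (at (the_inv_into W h (f x)))
    (frechet_derivative (the_inv_into W h \<circ> f) (at x) v))) (at x)"
proof -
  let ?\<tau> = "the_inv_into W h \<circ> f"
  have "((u \<circ> h) has_derivative frechet_derivative (u \<circ> h) (at (?\<tau> x))) (at (?\<tau> x))"
    using u by (simp add: frechet_derivative_works)
  from diff_chain_at[OF C1_on_has_derivative[OF transition(1)[OF c] x] this]
  have "((u \<circ> h) \<circ> ?\<tau> has_derivative
      frechet_derivative (u \<circ> h) (at (?\<tau> x)) \<circ> frechet_derivative ?\<tau> (at x)) (at x)" .
  from has_derivative_transform_within_open[OF this open_overlap[OF c(1) chart_open(2)[OF c(2)]] x, of "u \<circ> f"]
  have "(u \<circ> f has_derivative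
      frechet_derivative (u \<circ> h) (at (?\<tau> x)) \<circ> frechet_derivative ?\<tau> (at x)) (at x)"
    by (simp add: transition(3)[OF c])
  moreover have "frechet_derivative (u \<circ> h) (at (?\<tau> x)) \<circ> frechet_derivative ?\<tau> (at x) =
      (\<lambda>v. frechet_derivative (u \<circ> h) (at (the_inv_into W h (f x))) (frechet_derivative ?\<tau> (at x) v))"
    by (simp add: fun_eq_iff)
  ultimately show ?thesis by simp
qed

lemma transition_point:
  assumes "(V, f) \<in> A" "(W, h) \<in> A" "x \<in> V" "y \<in> W" "f x = h y"
  shows "x \<in> overlap V f (h ` W)" "the_inv_into W h (f x) = y"
  using assms chart_homeomorphism(2)[OF assms(2)] by (auto simp: overlap_def the_inv_into_f_f)

text \<open>Source of all independence of the chart: the coordinate vectors change by the same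
  linear map for every \<open>u\<close>, in particular for \<open>\<psi>\<close> itself.\<close>

lemma transition_derivative:
  assumes c: "(V, f) \<in> A" "(W, h) \<in> A" and xy: "x \<in> V" "y \<in> W" "f x = h y"
    and u: "(u \<circ> f) differentiable at x"
  shows "frechet_derivative (u \<circ> h) (at y) w =
    frechet_derivative (u \<circ> f) (at x) (frechet_derivative (the_inv_into V f \<circ> h) (at y) w)"
proof -
  note p = transition_point[OF c(2,1) xy(2,1) xy(3)[symmetric]]
  have "(u \<circ> h has_derivative (\<lambda>w. frechet_derivative (u \<circ> f) (at x)
      (frechet_derivative (the_inv_into V f \<circ> h) (at y) w))) (at y)"
    using transition_chain[OF c(2,1) p(1), of u] u unfolding p(2) by simp
  from frechet_derivative_at[OF this] show ?thesis
    by (simp add: fun_eq_iff)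
qed

lemma immersed:
  assumes "(V, f) \<in> A"
  shows "smooth_on V (\<psi> \<circ> f)" "smooth_on V (N \<circ> f)"
    "x \<in> V \<Longrightarrow> inj (frechet_derivative (\<psi> \<circ> f) (at x))"
    "x \<in> V \<Longrightarrow> (\<psi> \<circ> f) differentiable at x" "x \<in> V \<Longrightarrow> (N \<circ> f) differentiable at x"
proof -
  show s: "smooth_on V (\<psi> \<circ> f)" "smooth_on V (N \<circ> f)"
    and "x \<in> V \<Longrightarrow> inj (frechet_derivative (\<psi> \<circ> f) (at x))"
    using surface assms
    by (auto simp: oriented_immersed_surface_def immersion_def unit_normal_def smooth_map_def)
  show "x \<in> V \<Longrightarrow> (\<psi> \<circ> f) differentiable at x" "x \<in> V \<Longrightarrow> (N \<circ> f) differentiable at x"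
    using C1_on_differentiable smooth_onD s by blast+
qed

lemma tangent_plane_chart:
  assumes c: "(V, f) \<in> A" and x: "x \<in> V"
  shows "tangent_plane A \<psi> (f x) = range (frechet_derivative (\<psi> \<circ> f) (at x))"
proof
  show "range (frechet_derivative (\<psi> \<circ> f) (at x)) \<subseteq> tangent_plane A \<psi> (f x)"
    using assms unfolding tangent_plane_def by blast
  show "tangent_plane A \<psi> (f x) \<subseteq> range (frechet_derivative (\<psi> \<circ> f) (at x))"
  proof
    fix X assume "X \<in> tangent_plane A \<psi> (f x)"
    then obtain W h y w where c': "(W, h) \<in> A" "y \<in> W" "f x = h y"
      "X = frechet_derivative (\<psi> \<circ> h) (at y) w"
      unfolding tangent_plane_def by force
    then show "X \<in> range (frechet_derivative (\<psi> \<circ> f) (at x))"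
      using transition_derivative[OF c c'(1) x c'(2,3) immersed(4)[OF c x]] by simp
  qed
qed

lemma dir_deriv_chart:
  assumes c: "(V, f) \<in> A" and x: "x \<in> V" and u: "(u \<circ> f) differentiable at x"
  shows "dir_deriv A \<psi> u (f x) (frechet_derivative (\<psi> \<circ> f) (at x) v) = frechet_derivative (u \<circ> f) (at x) v"
  unfolding dir_deriv_def
proof (rule the_equality)
  show "\<exists>(W, h)\<in>A. \<exists>y\<in>W. \<exists>w. h y = f x \<and>
      frechet_derivative (\<psi> \<circ> f) (at x) v = frechet_derivative (\<psi> \<circ> h) (at y) w \<and>
      frechet_derivative (u \<circ> f) (at x) v = frechet_derivative (u \<circ> h) (at y) w"
    using c x by blast
  fix d
  assume "\<exists>(W, h)\<in>A. \<exists>y\<in>W. \<exists>w. h y = f x \<and>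
      frechet_derivative (\<psi> \<circ> f) (at x) v = frechet_derivative (\<psi> \<circ> h) (at y) w \<and>
      d = frechet_derivative (u \<circ> h) (at y) w"
  then obtain W h y w where c': "(W, h) \<in> A" "y \<in> W" "f x = h y"
    and w: "frechet_derivative (\<psi> \<circ> f) (at x) v = frechet_derivative (\<psi> \<circ> h) (at y) w"
    "d = frechet_derivative (u \<circ> h) (at y) w"
    by force
  note t = transition_derivative[OF c c'(1) x c'(2,3)]
  \<comment> \<open>Injectivity of the differential of \<open>\<psi>\<close> identifies the two
    coordinate vectors that represent the same tangent vector, so the derivatives of
    \<open>u\<close> agree too.\<close>
  have "v = frechet_derivative (the_inv_into V f \<circ> h) (at y) w"
    using w(1) t[OF immersed(4)[OF c x]] immersed(3)[OF c x] by (auto dest: injD)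
  then show "d = frechet_derivative (u \<circ> f) (at x) v"
    using w(2) t[OF u] by simp
qed

lemma surface_patch:
  assumes c: "(V, f) \<in> A"
  shows "surface_patch V (\<psi> \<circ> f) (N \<circ> f)"
proof
  show "open V" "Ck_on (Suc (Suc 0)) V (\<psi> \<circ> f)" "Ck_on (Suc (Suc 0)) V (N \<circ> f)"
    using chart_open[OF c] immersed[OF c] smooth_onD by blast+
  fix x assume x: "x \<in> V"
  let ?D = "frechet_derivative (\<psi> \<circ> f) (at x)"
  define a b where "a = pd 1 (\<psi> \<circ> f) x" and "b = pd 2 (\<psi> \<circ> f) x"
  have l: "linear ?D"
    using immersed(4)[OF c x] linear_frechet_derivative by blast
  have ind: "v *\<^sub>R a + w *\<^sub>R b = 0 \<Longrightarrow> v = 0 \<and> w = 0" for v w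
  proof -
    assume "v *\<^sub>R a + w *\<^sub>R b = 0"
    then have "?D (vector [v, w]) = ?D 0"
      using pd_decompose[OF immersed(4)[OF c x], of "vector [v, w]"] linear_0[OF l] by (simp add: a_def b_def)
    then have "vector [v, w] = (0 :: real^2)"
      using immersed(3)[OF c x] injD by metis
    then show ?thesis
      by (metis vector_2 zero_index)
  qed
  show "gD (\<psi> \<circ> f) x > 0"
  proof -
    have gD: "gD (\<psi> \<circ> f) x = (a \<bullet> a) * (b \<bullet> b) - (a \<bullet> b)\<^sup>2"
      by (simp add: gD_def gE_def gF_def gG_def a_def b_def)
    have "a \<noteq> 0" using ind[of 1 0] by auto
    \<comment> \<open>The vector is \<open>a \<bullet> a\<close> times the component of
      \<open>b\<close> orthogonal to \<open>a\<close>. It is nonzero by independence, so its squared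
      length gives the strict Cauchy-Schwarz inequality.\<close>
    have "((- (a \<bullet> b)) *\<^sub>R a + (a \<bullet> a) *\<^sub>R b) \<bullet> ((- (a \<bullet> b)) *\<^sub>R a + (a \<bullet> a) *\<^sub>R b) =
        (a \<bullet> a) * gD (\<psi> \<circ> f) x"
      unfolding gD by (simp add: inner_add_left inner_add_right inner_diff_left inner_diff_right
          inner_commute[of b a] power2_eq_square algebra_simps)
    moreover have "(- (a \<bullet> b)) *\<^sub>R a + (a \<bullet> a) *\<^sub>R b \<noteq> 0"
      using ind \<open>a \<noteq> 0\<close> by (metis inner_eq_zero_iff)
    ultimately have "(a \<bullet> a) * gD (\<psi> \<circ> f) x > 0"
      by (metis inner_gt_zero_iff)
    then show ?thesis
      using inner_ge_zero[of a] zero_less_mult_pos by (metis less_eq_real_def mult_zero_left order_less_irrefl)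
  qed
  show "(N \<circ> f) x \<bullet> (N \<circ> f) x = 1" "(N \<circ> f) x \<bullet> pd i (\<psi> \<circ> f) x = 0" for i
    using surface tangent_plane_chart[OF c x]
    by (auto simp: oriented_immersed_surface_def unit_normal_def dot_square_norm pd_def)
qed

lemma det_metric_matrix: "det (metric_matrix \<psi> f x) = gD (\<psi> \<circ> f) x"
  by (simp add: det_2 metric_matrix_def gD_def gE_def gF_def gG_def pd_def power2_eq_square inner_commute)

lemma tangent_plane_frame:
  assumes c: "(V, f) \<in> A" and x: "x \<in> V"
  shows "tangent_plane A \<psi> (f x) = {v *\<^sub>R pd 1 (\<psi> \<circ> f) x + w *\<^sub>R pd 2 (\<psi> \<circ> f) x |v w. True}"
proof -
  have "\<exists>z. v *\<^sub>R pd 1 (\<psi> \<circ> f) x + w *\<^sub>R pd 2 (\<psi> \<circ> f) x = frechet_derivative (\<psi> \<circ> f) (at x) z" for v w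
    using pd_decompose[OF immersed(4)[OF c x], of "vector [v, w]"] by (intro exI[of _ "vector [v, w]"]) simp
  then show ?thesis
    unfolding tangent_plane_chart[OF assms] using pd_decompose[OF immersed(4)[OF c x]] by blast
qed

lemma dir_deriv_frame:
  assumes c: "(V, f) \<in> A" and x: "x \<in> V" and u: "(u \<circ> f) differentiable at x"
  shows "dir_deriv A \<psi> u (f x) (v *\<^sub>R pd 1 (\<psi> \<circ> f) x + w *\<^sub>R pd 2 (\<psi> \<circ> f) x) =
    v *\<^sub>R pd 1 (u \<circ> f) x + w *\<^sub>R pd 2 (u \<circ> f) x"
  using dir_deriv_chart[OF assms, of "vector [v, w]"] pd_decompose[OF immersed(4)[OF c x], of "vector [v, w]"]
    pd_decompose[OF u, of "vector [v, w]"] by simp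

lemma shape_eigenvalues_chart:
  assumes c: "(V, f) \<in> A" and x: "x \<in> V"
  shows "shape_eigenvalues A \<psi> N (f x) =
    {k. k\<^sup>2 - shape_trace (\<psi> \<circ> f) (N \<circ> f) x * k + shape_det (\<psi> \<circ> f) (N \<circ> f) x = 0}"
proof -
  interpret surface_patch V "\<psi> \<circ> f" "N \<circ> f" by (rule surface_patch[OF c])
  interpret weingarten_frame "pd 1 (\<psi> \<circ> f) x" "pd 2 (\<psi> \<circ> f) x" "(N \<circ> f) x" "pd 1 (N \<circ> f) x" "pd 2 (N \<circ> f) x"
    by (rule weingarten_frame[OF x])
  note dN = dir_deriv_frame[OF c x immersed(5)[OF c x]]
  let ?X = "\<lambda>v w. v *\<^sub>R pd 1 (\<psi> \<circ> f) x + w *\<^sub>R pd 2 (\<psi> \<circ> f) x"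
  have ex: "(\<exists>X\<in>{?X v w |v w. True}. P X) \<longleftrightarrow> (\<exists>v w. P (?X v w))"
    and all: "(\<forall>X\<in>{?X v w |v w. True}. P X) \<longleftrightarrow> (\<forall>v w. P (?X v w))" for P
    by blast+
  show ?thesis
    unfolding shape_eigenvalues_def second_form_def tangent_plane_frame[OF assms] ex all dN
      shape_trace_eq[OF x] shape_det_eq[OF x] eigenvalue_iff ..
qed

lemma mean_curvature_chart:
  assumes c: "(V, f) \<in> A" and x: "x \<in> V"
  shows "mean_curvature A \<psi> N (f x) = shape_trace (\<psi> \<circ> f) (N \<circ> f) x"
    and "second_form_norm_sq A \<psi> N (f x) =
      (shape_trace (\<psi> \<circ> f) (N \<circ> f) x)\<^sup>2 - 2 * shape_det (\<psi> \<circ> f) (N \<circ> f) x"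
proof -
  interpret surface_patch V "\<psi> \<circ> f" "N \<circ> f" by (rule surface_patch[OF c])
  interpret weingarten_frame "pd 1 (\<psi> \<circ> f) x" "pd 2 (\<psi> \<circ> f) x" "(N \<circ> f) x" "pd 1 (N \<circ> f) x" "pd 2 (N \<circ> f) x"
    by (rule weingarten_frame[OF x])
  note d = discriminant_nonneg[folded shape_trace_eq[OF x] shape_det_eq[OF x]]
  show "mean_curvature A \<psi> N (f x) = shape_trace (\<psi> \<circ> f) (N \<circ> f) x"
    "second_form_norm_sq A \<psi> N (f x) =
      (shape_trace (\<psi> \<circ> f) (N \<circ> f) x)\<^sup>2 - 2 * shape_det (\<psi> \<circ> f) (N \<circ> f) x"
    unfolding mean_curvature_def second_form_norm_sq_def k1_def k2_def shape_eigenvalues_chart[OF assms]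
    using quadratic_roots_Min_Max[OF d] by blast+
qed

lemma surface_gradient_chart:
  assumes c: "(V, f) \<in> A" and x: "x \<in> V" and u: "(u \<circ> f) differentiable at x"
  shows "surface_gradient A \<psi> u (f x) =
    ((gG (\<psi> \<circ> f) x * pd 1 (u \<circ> f) x - gF (\<psi> \<circ> f) x * pd 2 (u \<circ> f) x) / gD (\<psi> \<circ> f) x) *\<^sub>R pd 1 (\<psi> \<circ> f) x +
    ((gE (\<psi> \<circ> f) x * pd 2 (u \<circ> f) x - gF (\<psi> \<circ> f) x * pd 1 (u \<circ> f) x) / gD (\<psi> \<circ> f) x) *\<^sub>R pd 2 (\<psi> \<circ> f) x"
    (is "_ = ?G")
  unfolding surface_gradient_def
proof (rule the_equality)
  interpret surface_patch V "\<psi> \<circ> f" "N \<circ> f" by (rule surface_patch[OF c])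
  define a b where "a = pd 1 (\<psi> \<circ> f) x" and "b = pd 2 (\<psi> \<circ> f) x"
  define D u1 u2 where "D = gD (\<psi> \<circ> f) x" and "u1 = pd 1 (u \<circ> f) x" and "u2 = pd 2 (u \<circ> f) x"
  have D: "D > 0" "D = (a \<bullet> a) * (b \<bullet> b) - (a \<bullet> b)\<^sup>2"
    using gD_pos[OF x] by (simp_all add: D_def gD_def gE_def gF_def gG_def a_def b_def)
  have G: "?G = (((b \<bullet> b) * u1 - (a \<bullet> b) * u2) / D) *\<^sub>R a + (((a \<bullet> a) * u2 - (a \<bullet> b) * u1) / D) *\<^sub>R b"
    by (simp add: a_def b_def D_def u1_def u2_def gE_def gF_def gG_def)
  have "D * (?G \<bullet> a) = D * u1"
  proof -
    have "D * (?G \<bullet> a) = ((b \<bullet> b) * u1 - (a \<bullet> b) * u2) * (a \<bullet> a) + ((a \<bullet> a) * u2 - (a \<bullet> b) * u1) * (b \<bullet> a)"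
      unfolding G using D(1) by (simp add: inner_add_left field_simps)
    then show ?thesis by (simp add: D(2) inner_commute[of b a] power2_eq_square algebra_simps)
  qed
  moreover have "D * (?G \<bullet> b) = D * u2"
  proof -
    have "D * (?G \<bullet> b) = ((b \<bullet> b) * u1 - (a \<bullet> b) * u2) * (a \<bullet> b) + ((a \<bullet> a) * u2 - (a \<bullet> b) * u1) * (b \<bullet> b)"
      unfolding G using D(1) by (simp add: inner_add_left field_simps)
    then show ?thesis by (simp add: D(2) power2_eq_square algebra_simps)
  qed
  ultimately have ip: "?G \<bullet> a = u1" "?G \<bullet> b = u2"
    using D(1) by auto
  have du: "dir_deriv A \<psi> u (f x) (v *\<^sub>R a + w *\<^sub>R b) = v * u1 + w * u2" for v w
    using dir_deriv_frame[OF assms] by (simp add: a_def b_def u1_def u2_def)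
  note tp = tangent_plane_frame[OF c x, folded a_def b_def]
  show mem: "?G \<in> tangent_plane A \<psi> (f x) \<and> (\<forall>X\<in>tangent_plane A \<psi> (f x). ?G \<bullet> X = dir_deriv A \<psi> u (f x) X)"
  proof
    show "?G \<in> tangent_plane A \<psi> (f x)"
      unfolding tp a_def b_def by blast
    show "\<forall>X\<in>tangent_plane A \<psi> (f x). ?G \<bullet> X = dir_deriv A \<psi> u (f x) X"
      unfolding tp using ip du by (auto simp: inner_add_right)
  qed
  fix G' assume G': "G' \<in> tangent_plane A \<psi> (f x) \<and> (\<forall>X\<in>tangent_plane A \<psi> (f x). G' \<bullet> X = dir_deriv A \<psi> u (f x) X)"
  have sub: "G' - ?G \<in> tangent_plane A \<psi> (f x)"
  proof -
    obtain v w v' w' where "G' = v *\<^sub>R a + w *\<^sub>R b" "?G = v' *\<^sub>R a + w' *\<^sub>R b"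
      using G' mem unfolding tp by blast
    then have "G' - ?G = (v - v') *\<^sub>R a + (w - w') *\<^sub>R b"
      by (simp add: scaleR_diff_left)
    then show ?thesis unfolding tp by blast
  qed
  then have "(G' - ?G) \<bullet> (G' - ?G) = 0"
    using G' mem by (simp add: inner_diff_left)
  then show "G' = ?G" by simp
qed

lemma surface_gradient_inner_chart:
  assumes c: "(V, f) \<in> A" and x: "x \<in> V" and u: "(u \<circ> f) differentiable at x" and w: "(w \<circ> f) differentiable at x"
  shows "surface_gradient A \<psi> u (f x) \<bullet> surface_gradient A \<psi> w (f x) = gprod (\<psi> \<circ> f) (u \<circ> f) (w \<circ> f) x"
proof -
  interpret surface_patch V "\<psi> \<circ> f" "N \<circ> f" by (rule surface_patch[OF c])
  define a b where "a = pd 1 (\<psi> \<circ> f) x" and "b = pd 2 (\<psi> \<circ> f) x"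
  define D where "D = gD (\<psi> \<circ> f) x"
  define u1 u2 w1 w2 where "u1 = pd 1 (u \<circ> f) x" and "u2 = pd 2 (u \<circ> f) x"
    and "w1 = pd 1 (w \<circ> f) x" and "w2 = pd 2 (w \<circ> f) x"
  have D: "D > 0" "D = (a \<bullet> a) * (b \<bullet> b) - (a \<bullet> b)\<^sup>2"
    using gD_pos[OF x] by (simp_all add: D_def gD_def gE_def gF_def gG_def a_def b_def)
  have scaled: "D *\<^sub>R surface_gradient A \<psi> u (f x) = ((b \<bullet> b) * u1 - (a \<bullet> b) * u2) *\<^sub>R a + ((a \<bullet> a) * u2 - (a \<bullet> b) * u1) *\<^sub>R b"
    "D *\<^sub>R surface_gradient A \<psi> w (f x) = ((b \<bullet> b) * w1 - (a \<bullet> b) * w2) *\<^sub>R a + ((a \<bullet> a) * w2 - (a \<bullet> b) * w1) *\<^sub>R b"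
    unfolding surface_gradient_chart[OF c x u] surface_gradient_chart[OF c x w]
    using D(1) by (simp_all add: scaleR_add_right D_def u1_def u2_def w1_def w2_def gE_def gF_def gG_def a_def b_def)
  have "D * D * (surface_gradient A \<psi> u (f x) \<bullet> surface_gradient A \<psi> w (f x)) =
      (D *\<^sub>R surface_gradient A \<psi> u (f x)) \<bullet> (D *\<^sub>R surface_gradient A \<psi> w (f x))"
    by simp
  also have "\<dots> = (((b \<bullet> b) * u1 - (a \<bullet> b) * u2) *\<^sub>R a + ((a \<bullet> a) * u2 - (a \<bullet> b) * u1) *\<^sub>R b) \<bullet>
      (((b \<bullet> b) * w1 - (a \<bullet> b) * w2) *\<^sub>R a + ((a \<bullet> a) * w2 - (a \<bullet> b) * w1) *\<^sub>R b)"
    by (simp only: scaled)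
  also have "\<dots> = D * ((b \<bullet> b) * u1 * w1 - (a \<bullet> b) * (u1 * w2 + u2 * w1) + (a \<bullet> a) * u2 * w2)"
    unfolding D(2) by (simp add: inner_add_left inner_add_right inner_commute[of b a] power2_eq_square algebra_simps)
  also have "\<dots> = D * D * gprod (\<psi> \<circ> f) (u \<circ> f) (w \<circ> f) x"
    using D(1) by (simp add: gprod_def D_def u1_def u2_def w1_def w2_def gE_def gF_def gG_def a_def b_def)
  finally show ?thesis using D(1) by simp
qed

end

section \<open>The area measure\<close>

text \<open>Tonelli for the counting measure on the naturals.\<close>

lemma ennreal_suminf_swap:
  fixes f :: "nat \<Rightarrow> nat \<Rightarrow> ennreal"
  shows "(\<Sum>i. \<Sum>j. f i j) = (\<Sum>j. \<Sum>i. f i j)"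
  using nn_integral_suminf[of "\<lambda>j i. f i j" "count_space UNIV"] by (simp add: nn_integral_count_space_nat)

text \<open>Lets a failure of integrability be read as an infinite integral.\<close>

lemma nonneg_absolutely_integrable_iff:
  fixes k :: "'a::euclidean_space \<Rightarrow> real"
  assumes m: "(\<lambda>x. indicator S x * k x) \<in> borel_measurable borel" and nn: "\<And>x. x \<in> S \<Longrightarrow> k x \<ge> 0"
  shows "k absolutely_integrable_on S \<longleftrightarrow> (\<integral>\<^sup>+x. indicator S x * k x \<partial>lborel) < \<infinity>"
proof -
  have "norm (indicator S x * k x) = indicator S x * k x" for x
    using nn[of x] by (cases "x \<in> S") auto
  moreover have "k absolutely_integrable_on S \<longleftrightarrow> integrable lborel (\<lambda>x. indicator S x * k x)"
    using m unfolding set_integrable_def by (subst integrable_completion) simp_all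
  ultimately show ?thesis
    using m by (simp add: integrable_iff_bounded)
qed

text \<open>The change of variables formula is an equivalence of absolute integrability on both
  sides, and so covers infinite values: if one side is not integrable, neither is the other, and
  both integrals are infinite.\<close>

lemma nn_integral_change_of_variables:
  fixes g :: "real^'n::{finite,wellorder} \<Rightarrow> real^'n::_" and k :: "real^'n::_ \<Rightarrow> real"
  assumes S: "S \<in> sets borel"
    and der: "\<And>x. x \<in> S \<Longrightarrow> (g has_derivative g' x) (at x)" and inj: "inj_on g S"
    and k: "\<And>y. y \<in> g ` S \<Longrightarrow> k y \<ge> 0"
    and m1: "(\<lambda>y. indicator (g ` S) y * k y) \<in> borel_measurable borel"
    and m2: "(\<lambda>x. indicator S x * (\<bar>det (matrix (g' x))\<bar> * k (g x))) \<in> borel_measurable borel"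
  shows "(\<integral>\<^sup>+y. indicator (g ` S) y * k y \<partial>lborel) =
    (\<integral>\<^sup>+x. indicator S x * (\<bar>det (matrix (g' x))\<bar> * k (g x)) \<partial>lborel)"
proof -
  let ?D = "\<lambda>x. \<bar>det (matrix (g' x))\<bar> * k (g x)"
  have Dnn: "?D x \<ge> 0" if "x \<in> S" for x
    using that k by simp
  \<comment> \<open>The formula is used for values in \<open>real^1\<close> and then translated back
    to \<open>real\<close>.\<close>
  have "(\<lambda>x. \<bar>det (matrix (g' x))\<bar> *\<^sub>R (vec (k (g x)) :: real^1)) absolutely_integrable_on S \<and>
      integral S (\<lambda>x. \<bar>det (matrix (g' x))\<bar> *\<^sub>R (vec (k (g x)) :: real^1)) = vec b \<longleftrightarrow>
    (\<lambda>y. vec (k y) :: real^1) absolutely_integrable_on (g ` S) \<and> integral (g ` S) (\<lambda>y. vec (k y) :: real^1) = vec b" for b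
  proof (rule has_absolute_integral_change_of_variables)
    show "S \<in> sets lebesgue" using S by auto
    show "(g has_derivative g' x) (at x within S)" if "x \<in> S" for x
      using der[OF that] has_derivative_at_withinI by blast
  qed (rule inj)
  then have cov: "?D absolutely_integrable_on S \<and> integral S ?D = b \<longleftrightarrow>
      k absolutely_integrable_on (g ` S) \<and> integral (g ` S) k = b" for b
    by (simp add: absolutely_integrable_on_1_iff integral_on_1_eq)
  show ?thesis
  proof (cases "k absolutely_integrable_on (g ` S)")
    case True
    then have D: "?D absolutely_integrable_on S" "integral S ?D = integral (g ` S) k"
      using cov[of "integral (g ` S) k"] by auto
    have kI: "(k has_integral integral (g ` S) k) (g ` S)"
      by (rule integrable_integral[OF set_lebesgue_integral_eq_integral(1)[OF True]])
    have DI: "(?D has_integral integral (g ` S) k) S"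
      using integrable_integral[OF set_lebesgue_integral_eq_integral(1)[OF D(1)]] D(2) by simp
    show ?thesis
      using nn_integral_has_integral_lebesgue[OF k kI] nn_integral_has_integral_lebesgue[OF Dnn DI] by simp
  next
    case False
    then have "\<not> ?D absolutely_integrable_on S"
      using cov by blast
    then have "\<not> (\<integral>\<^sup>+x. indicator S x * ?D x \<partial>lborel) < \<infinity>"
      using nonneg_absolutely_integrable_iff[OF m2 Dnn] by blast
    moreover have "\<not> (\<integral>\<^sup>+y. indicator (g ` S) y * k y \<partial>lborel) < \<infinity>"
      using False nonneg_absolutely_integrable_iff[OF m1 k] by blast
    ultimately show ?thesis
      by (simp add: not_less top_unique)
  qed
qed

text \<open>The Gram matrix changes by the rule g' = J^T g J, so its determinant picks up the square
  of the Jacobian.\<close>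

lemma gD_linear_change:
  assumes "\<And>i. pd i f x = pd i \<tau> x $ 1 *\<^sub>R pd 1 h y + pd i \<tau> x $ 2 *\<^sub>R pd 2 h y"
    and "\<tau> differentiable at x"
  shows "gD f x = (det (matrix (frechet_derivative \<tau> (at x))))\<^sup>2 * gD h y"
proof -
  define p q r t where "p = pd 1 \<tau> x $ 1" and "q = pd 1 \<tau> x $ 2" and "r = pd 2 \<tau> x $ 1" and "t = pd 2 \<tau> x $ 2"
  have "det (matrix (frechet_derivative \<tau> (at x))) = p * t - r * q"
    by (simp add: det_2 matrix_def pd_def p_def q_def r_def t_def)
  moreover have "gD f x = (p * t - r * q)\<^sup>2 * gD h y"
    unfolding gD_def gE_def gF_def gG_def assms(1) p_def[symmetric] q_def[symmetric] r_def[symmetric] t_def[symmetric]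
    by (simp add: inner_add_left inner_add_right inner_commute[of "pd 2 h y" "pd 1 h y"] power2_eq_square algebra_simps)
  ultimately show ?thesis by simp
qed

context surface_patch
begin

lemma continuous_metric:
  "continuous_on U (gE \<Psi>)" "continuous_on U (gF \<Psi>)" "continuous_on U (gG \<Psi>)" "continuous_on U (gD \<Psi>)"
proof -
  show *: "continuous_on U (gE \<Psi>)" "continuous_on U (gF \<Psi>)" "continuous_on U (gG \<Psi>)"
    unfolding gE_def[abs_def] gF_def[abs_def] gG_def[abs_def]
    by (intro continuous_on_inner continuous_on_pd \<Psi>1)+
  show "continuous_on U (gD \<Psi>)"
    unfolding gD_def[abs_def] by (intro continuous_intros *)
qed

lemma continuous_shape: "continuous_on U (shape_trace \<Psi> n)" "continuous_on U (shape_det \<Psi> n)"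
proof -
  have c: "continuous_on U (\<lambda>x. pd i n x \<bullet> pd j \<Psi> x)" for i j
    by (intro continuous_on_inner continuous_on_pd \<Psi>1 n1)
  have nz: "\<forall>x\<in>U. gD \<Psi> x \<noteq> 0"
    using gD_pos by force
  show "continuous_on U (shape_trace \<Psi> n)" "continuous_on U (shape_det \<Psi> n)"
    unfolding shape_trace_def[abs_def] shape_det_def[abs_def]
    by (intro continuous_intros continuous_metric c nz)+
qed

lemma continuous_gprod:
  assumes "C1_on U u" "C1_on U w"
  shows "continuous_on U (gprod \<Psi> u w)"
proof -
  have nz: "\<forall>x\<in>U. gD \<Psi> x \<noteq> 0"
    using gD_pos by force
  show ?thesis
    unfolding gprod_def[abs_def]
    by (intro continuous_intros continuous_metric continuous_on_pd assms nz)
qed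

end

section \<open>Existence and uniqueness of the area measure\<close>

context oriented_surface
begin

abbreviation area_density :: "(real^2 \<Rightarrow> 'm) \<Rightarrow> real^2 \<Rightarrow> real" where
  "area_density f x \<equiv> sqrt (gD (\<psi> \<circ> f) x)"

text \<open>The area measure of one chart, extended by zero to the surface. The restriction to
  \<open>V\<close> comes before the push-forward because \<open>f\<close> may fail to be measurable
  outside \<open>V\<close>.\<close>

definition chart_measure :: "(real^2) set \<Rightarrow> (real^2 \<Rightarrow> 'm) \<Rightarrow> 'm measure" where
  "chart_measure V f = distr (density (restrict_space lborel V) (\<lambda>x. ennreal (area_density f x))) borel f"

lemma chart_measure_sets [simp]: "sets (chart_measure V f) = sets borel" "space (chart_measure V f) = UNIV"
  by (simp_all add: chart_measure_def)

lemma area_density_continuous: "(V, f) \<in> A \<Longrightarrow> continuous_on V (area_density f)"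
  using surface_patch.continuous_metric(4)[OF surface_patch] by (intro continuous_intros)

lemma area_density_nonneg: "(V, f) \<in> A \<Longrightarrow> x \<in> V \<Longrightarrow> area_density f x \<ge> 0"
  using surface_patch.gD_pos[OF surface_patch] by (simp add: less_imp_le)

lemma chart_measurable:
  assumes "(V, f) \<in> A"
  shows "V \<in> sets borel" "f \<in> restrict_space lborel V \<rightarrow>\<^sub>M borel"
    "area_density f \<in> borel_measurable (restrict_space lborel V)"
proof -
  show "V \<in> sets borel" using chart_open[OF assms] by simp
  have *: "g \<in> restrict_space lborel V \<rightarrow>\<^sub>M borel" if "continuous_on V g"
    for g :: "real^2 \<Rightarrow> 'b::topological_space"
    using borel_measurable_continuous_on_restrict[OF that]
    by (simp add: measurable_def sets_restrict_space space_restrict_space)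
  show "f \<in> restrict_space lborel V \<rightarrow>\<^sub>M borel"
    "area_density f \<in> borel_measurable (restrict_space lborel V)"
    using * chart_homeomorphism(1)[OF assms] area_density_continuous[OF assms] by blast+
qed

lemma emeasure_chart_measure:
  assumes c: "(V, f) \<in> A" and C: "C \<in> sets borel"
  shows "emeasure (chart_measure V f) C = (\<integral>\<^sup>+x. indicator (overlap V f C) x * area_density f x \<partial>lborel)"
proof -
  note [measurable] = chart_measurable[OF c] C
  let ?R = "restrict_space lborel V"
  have pre: "f -` C \<inter> space ?R \<in> sets ?R"
    by measurable
  have "emeasure (chart_measure V f) C = (\<integral>\<^sup>+x. ennreal (area_density f x) * indicator (f -` C \<inter> space ?R) x \<partial>?R)"
    unfolding chart_measure_def using chart_measurable[OF c] pre
    by (subst emeasure_distr) (auto simp: C emeasure_density)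
  also have "\<dots> = (\<integral>\<^sup>+x. ennreal (area_density f x) * indicator (f -` C \<inter> space ?R) x * indicator V x \<partial>lborel)"
    by (rule nn_integral_restrict_space) (simp add: chart_measurable[OF c])
  also have "\<dots> = (\<integral>\<^sup>+x. indicator (overlap V f C) x * area_density f x \<partial>lborel)"
    by (intro nn_integral_cong) (auto simp: overlap_def indicator_def space_restrict_space)
  finally show ?thesis .
qed

lemma overlap_borel:
  assumes "(V, f) \<in> A" "C \<in> sets borel"
  shows "overlap V f C \<in> sets borel"
proof -
  have "f -` C \<inter> space (restrict_space lborel V) \<in> sets (restrict_space lborel V)"
    using chart_measurable(2)[OF assms(1)] assms(2) by (rule measurable_sets)
  moreover have "f -` C \<inter> space (restrict_space lborel V) = overlap V f C"
    by (auto simp: overlap_def space_restrict_space)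
  ultimately show ?thesis
    using chart_measurable(1)[OF assms(1)] by (simp add: sets_restrict_space_iff)
qed

text \<open>The image is a preimage under the continuous inverse of the chart.\<close>

lemma chart_image_borel:
  assumes c: "(V, f) \<in> A" and B: "B \<in> sets borel" "B \<subseteq> V"
  shows "f ` B \<in> sets borel"
proof -
  have "the_inv_into V f \<in> restrict_space borel (f ` V) \<rightarrow>\<^sub>M borel"
    by (intro borel_measurable_continuous_on_restrict chart_homeomorphism c)
  from measurable_sets[OF this B(1)]
  have "the_inv_into V f -` B \<inter> f ` V \<in> sets (restrict_space borel (f ` V))"
    by (simp add: space_restrict_space)
  moreover have "the_inv_into V f -` B \<inter> f ` V = f ` B"
    using B(2) chart_homeomorphism(2)[OF c] by (auto simp: the_inv_into_f_f subset_iff)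
  ultimately show ?thesis
    using chart_open(2)[OF c] by (simp add: sets_restrict_space_iff)
qed

lemma area_density_transition:
  assumes c: "(V, f) \<in> A" "(W, h) \<in> A" and x: "x \<in> overlap V f (h ` W)"
  shows "area_density f x =
    \<bar>det (matrix (frechet_derivative (the_inv_into W h \<circ> f) (at x)))\<bar> * area_density h (the_inv_into W h (f x))"
proof -
  let ?\<tau> = "the_inv_into W h \<circ> f"
  let ?y = "the_inv_into W h (f x)"
  have y: "?y \<in> W"
    using transition(2)[OF c x] by (simp add: overlap_def)
  note d = immersed(4)[OF c(2) y]
  have \<tau>: "?\<tau> differentiable at x"
    by (rule C1_on_differentiable[OF transition(1)[OF c] x])
  have "pd i (\<psi> \<circ> f) x = frechet_derivative (\<psi> \<circ> h) (at ?y) (pd i ?\<tau> x)" for i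
    using pd_eqI[OF transition_chain[OF c x d]] by (simp add: pd_def)
  then have "pd i (\<psi> \<circ> f) x = pd i ?\<tau> x $ 1 *\<^sub>R pd 1 (\<psi> \<circ> h) ?y + pd i ?\<tau> x $ 2 *\<^sub>R pd 2 (\<psi> \<circ> h) ?y" for i
    using pd_decompose[OF d] by simp
  from gD_linear_change[OF this \<tau>] show ?thesis
    by (simp add: real_sqrt_mult)
qed

text \<open>Change of variables along the transition map, whose Jacobian is exactly the quotient of
  the two area densities.\<close>

lemma chart_measure_compat:
  assumes c: "(V, f) \<in> A" "(W, h) \<in> A" and C: "C \<in> sets borel" "C \<subseteq> f ` V" "C \<subseteq> h ` W"
  shows "emeasure (chart_measure V f) C = emeasure (chart_measure W h) C"
proof -
  let ?\<tau> = "the_inv_into W h \<circ> f"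
  let ?S = "overlap V f C"
  have sub: "?S \<subseteq> overlap V f (h ` W)"
    using C(3) by (auto simp: overlap_def)
  have img: "?\<tau> ` ?S = overlap W h C"
  proof
    show "?\<tau> ` ?S \<subseteq> overlap W h C"
    proof
      fix y assume "y \<in> ?\<tau> ` ?S"
      then obtain x where x: "x \<in> ?S" "y = the_inv_into W h (f x)" by auto
      then show "y \<in> overlap W h C"
        using transition(2)[OF c, of x] transition(3)[OF c, of x] sub by (auto simp: overlap_def)
    qed
    show "overlap W h C \<subseteq> ?\<tau> ` ?S"
    proof
      fix y assume y: "y \<in> overlap W h C"
      then obtain x where x: "x \<in> V" "f x = h y"
        using C(2) by (force simp: overlap_def)
      then have "?\<tau> x = y" "x \<in> ?S"
        using y chart_homeomorphism(2)[OF c(2)] by (auto simp: overlap_def the_inv_into_f_f)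
      then show "y \<in> ?\<tau> ` ?S" by blast
    qed
  qed
  have inj: "inj_on ?\<tau> ?S"
  proof (rule inj_onI)
    fix x y assume xy: "x \<in> ?S" "y \<in> ?S" "?\<tau> x = ?\<tau> y"
    then have "f x = f y"
      using transition(3)[OF c, of x] transition(3)[OF c, of y] sub by (metis comp_apply subsetD)
    then show "x = y"
      using xy chart_homeomorphism(2)[OF c(1)] by (auto simp: overlap_def dest: inj_onD)
  qed
  have meas: "(\<lambda>x. indicator (overlap V' f' C) x * area_density f' x) \<in> borel_measurable borel" if "(V', f') \<in> A" for V' f'
  proof -
    have "overlap V' f' C \<subseteq> V'" by (auto simp: overlap_def)
    from borel_measurable_continuous_on_indicator[OF overlap_borel[OF that C(1)]
        continuous_on_subset[OF area_density_continuous[OF that] this]]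
    show ?thesis by simp
  qed
  have eq: "indicator ?S x * (\<bar>det (matrix (frechet_derivative ?\<tau> (at x)))\<bar> * area_density h (?\<tau> x)) =
      indicator ?S x * area_density f x" for x
    using area_density_transition[OF c, of x] sub by (cases "x \<in> ?S") auto
  have "(\<integral>\<^sup>+y. indicator (?\<tau> ` ?S) y * area_density h y \<partial>lborel) =
    (\<integral>\<^sup>+x. indicator ?S x * (\<bar>det (matrix (frechet_derivative ?\<tau> (at x)))\<bar> * area_density h (?\<tau> x)) \<partial>lborel)"
  proof (rule nn_integral_change_of_variables[OF overlap_borel[OF c(1) C(1)]])
    show "(?\<tau> has_derivative frechet_derivative ?\<tau> (at x)) (at x)" if "x \<in> ?S" for x
      using C1_on_has_derivative[OF transition(1)[OF c]] that sub by blast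
    show "area_density h y \<ge> 0" if "y \<in> ?\<tau> ` ?S" for y
      using that area_density_nonneg[OF c(2)] unfolding img by (auto simp: overlap_def)
  qed (use inj meas[OF c(1)] meas[OF c(2)] in \<open>simp_all only: eq img\<close>)
  then show ?thesis
    unfolding eq img by (simp add: emeasure_chart_measure[OF c(1) C(1)] emeasure_chart_measure[OF c(2) C(1)])
qed

lemma chart_Union: "(\<Union>(V, f)\<in>A. f ` V) = UNIV"
  using surface by (simp add: oriented_immersed_surface_def smooth_surface_def)

text \<open>Here second countability enters, through the Lindelof property. Countably many charts
  are what makes the gluing of measures possible.\<close>

lemma countable_atlas:
  obtains Vs fs where "\<And>n::nat. (Vs n, fs n) \<in> A" "(\<Union>n. fs n ` Vs n) = UNIV"
proof -
  let ?F = "(\<lambda>(V, f). f ` V) ` A"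
  have "open S" if "S \<in> ?F" for S
    using that chart_open by auto
  then obtain F' where F': "F' \<subseteq> ?F" "countable F'" "\<Union>F' = \<Union>?F"
    using Lindelof by metis
  obtain A' where A': "A' \<subseteq> A" "countable A'" "F' = (\<lambda>(V, f). f ` V) ` A'"
    using F'(1,2) by (metis countable_subset_image)
  note un = chart_Union
  \<comment> \<open>A type is inhabited, so an empty family cannot cover it; an enumeration needs at
    least one chart.\<close>
  have ne: "A' \<noteq> {}"
    using un F'(3) A'(3) by force
  define c where "c = from_nat_into A'"
  have range: "range c = A'"
    unfolding c_def using range_from_nat_into[OF ne A'(2)] .
  show ?thesis
  proof (rule that[of "\<lambda>n. fst (c n)" "\<lambda>n. snd (c n)"])
    show "(fst (c n), snd (c n)) \<in> A" for n
      using range A'(1) by auto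
    have "(\<Union>n. snd (c n) ` fst (c n)) = \<Union>((\<lambda>(V, f). f ` V) ` range c)"
      by (simp add: case_prod_beta image_image)
    then show "(\<Union>n. snd (c n) ` fst (c n)) = UNIV"
      using un F'(3) A'(3) range by simp
  qed
qed

lemma overlap_image: "C \<subseteq> f ` V \<Longrightarrow> f ` overlap V f C = C"
  by (auto simp: overlap_def)

lemma overlap_of_image:
  assumes "(V, f) \<in> A" "B \<subseteq> V"
  shows "overlap V f (f ` B) = B"
proof -
  have "f x \<in> f ` B \<longleftrightarrow> x \<in> B" if "x \<in> V" for x
    using inj_on_image_mem_iff[OF chart_homeomorphism(2)[OF assms(1)] that assms(2)] .
  then show ?thesis
    using assms(2) unfolding overlap_def by blast
qed

text \<open>The property that describes \<open>area_measure\<close>, quantified over Borel sets of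
  the surface instead of the plane, the form in which measures can be cut and summed.\<close>

definition is_area_measure :: "'m measure \<Rightarrow> bool" where
  "is_area_measure m \<longleftrightarrow> sets m = sets borel \<and>
     (\<forall>(V, f)\<in>A. \<forall>C\<in>sets borel. C \<subseteq> f ` V \<longrightarrow> emeasure m C = emeasure (chart_measure V f) C)"

lemma is_area_measureD:
  assumes "is_area_measure m" "(V, f) \<in> A" "C \<in> sets borel" "C \<subseteq> f ` V"
  shows "emeasure m C = emeasure (chart_measure V f) C"
  using bspec[OF conjunct2[OF assms(1)[unfolded is_area_measure_def]] assms(2)] assms(3,4) by simp

lemma is_area_measure_iff:
  "is_area_measure m \<longleftrightarrow> sets m = sets borel \<and> (\<forall>(V, f)\<in>A. \<forall>B\<in>sets borel. B \<subseteq> V \<longrightarrow>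
     emeasure m (f ` B) = (\<integral>\<^sup>+x\<in>B. ennreal (sqrt (det (metric_matrix \<psi> f x))) \<partial>lborel))"
proof -
  have 1: "emeasure (chart_measure V f) (f ` B) = (\<integral>\<^sup>+x\<in>B. ennreal (sqrt (det (metric_matrix \<psi> f x))) \<partial>lborel)"
    if "(V, f) \<in> A" "B \<in> sets borel" "B \<subseteq> V" for V f B
    unfolding emeasure_chart_measure[OF that(1) chart_image_borel[OF that]] overlap_of_image[OF that(1,3)]
      det_metric_matrix by (intro nn_integral_cong) (auto simp: indicator_def)
  have eqv: "(\<forall>C\<in>sets borel. C \<subseteq> f ` V \<longrightarrow> emeasure m C = emeasure (chart_measure V f) C) \<longleftrightarrow>
    (\<forall>B\<in>sets borel. B \<subseteq> V \<longrightarrow>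
      emeasure m (f ` B) = (\<integral>\<^sup>+x\<in>B. ennreal (sqrt (det (metric_matrix \<psi> f x))) \<partial>lborel))" (is "?L \<longleftrightarrow> ?R")
    if c: "(V, f) \<in> A" for V f
  proof
    assume L: ?L
    show ?R
    proof (intro ballI impI)
      fix B :: "(real^2) set" assume B: "B \<in> sets borel" "B \<subseteq> V"
      have "emeasure m (f ` B) = emeasure (chart_measure V f) (f ` B)"
        by (rule mp[OF bspec[OF L chart_image_borel[OF c B]] image_mono[OF B(2)]])
      then show "emeasure m (f ` B) = (\<integral>\<^sup>+x\<in>B. ennreal (sqrt (det (metric_matrix \<psi> f x))) \<partial>lborel)"
        using 1[OF c B] by simp
    qed
  next
    assume R: ?R
    show ?L
    proof (intro ballI impI)
      fix C :: "'m set" assume C: "C \<in> sets borel" "C \<subseteq> f ` V"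
      have B: "overlap V f C \<in> sets borel" "overlap V f C \<subseteq> V"
        using overlap_borel[OF c C(1)] by (auto simp: overlap_def)
      have "emeasure m (f ` overlap V f C) = emeasure (chart_measure V f) (f ` overlap V f C)"
        by (rule trans[OF mp[OF bspec[OF R B(1)] B(2)] 1[OF c B, symmetric]])
      then show "emeasure m C = emeasure (chart_measure V f) C"
        unfolding overlap_image[OF C(2)] .
    qed
  qed
  show ?thesis
    unfolding is_area_measure_def
  proof (rule conj_cong[OF refl], rule ball_cong[OF refl], clarify)
    fix V f assume "(V, f) \<in> A"
    then show "(\<forall>C\<in>sets borel. C \<subseteq> f ` V \<longrightarrow> emeasure m C = emeasure (chart_measure V f) C) \<longleftrightarrow>
      (\<forall>B\<in>sets borel. B \<subseteq> V \<longrightarrow>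
        emeasure m (f ` B) = (\<integral>\<^sup>+x\<in>B. ennreal (sqrt (det (metric_matrix \<psi> f x))) \<partial>lborel))"
      by (rule eqv)
  qed
qed

text \<open>A countable atlas is cut into disjoint Borel pieces \<open>P n\<close>, each inside one
  chart. Additivity then forces the value on every Borel set to be the sum \<open>\<mu>\<close>.
  Conversely \<open>\<mu>\<close> is a measure, and by \<open>chart_measure_compat\<close> it agrees
  with every chart, not only with those used to build it.\<close>

lemma ex1_area_measure: "\<exists>!m. is_area_measure m"
proof -
  obtain Vs fs where at: "\<And>n::nat. (Vs n, fs n) \<in> A" and cov: "(\<Union>n. fs n ` Vs n) = UNIV"
    by (rule countable_atlas) blast
  define P where "P = disjointed (\<lambda>n. fs n ` Vs n)"
  define \<mu> where "\<mu> = (\<lambda>C. \<Sum>n. emeasure (chart_measure (Vs n) (fs n)) (C \<inter> P n))"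
  have P: "P n \<in> sets borel" "P n \<subseteq> fs n ` Vs n" "disjoint_family P" "(\<Union>n. P n) = UNIV" for n
  proof -
    have "range (\<lambda>n. fs n ` Vs n) \<subseteq> sets borel"
      using chart_open(2)[OF at] by auto
    then show "P n \<in> sets borel"
      unfolding P_def using sets.range_disjointed_sets by blast
    show "P n \<subseteq> fs n ` Vs n"
      unfolding P_def by (rule disjointed_subset)
  qed (auto simp: P_def disjoint_family_disjointed UN_disjointed_eq cov)
  have disj: "disjoint_family (\<lambda>n. C \<inter> P n)" for C
    using P(3) unfolding disjoint_family_on_def by blast
  have uniq: "emeasure m C = \<mu> C" if m: "is_area_measure m" and C: "C \<in> sets borel" for m C
  proof -
    have s: "sets m = sets borel"
      using m by (simp add: is_area_measure_def)
    have "emeasure m C = emeasure m (\<Union>n. C \<inter> P n)"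
      using P(4) by (simp flip: Int_UN_distrib)
    also have "\<dots> = (\<Sum>n. emeasure m (C \<inter> P n))"
      using P(1) C by (intro suminf_emeasure[symmetric] disj) (auto simp: s)
    also have "\<dots> = \<mu> C"
    proof -
      have "emeasure m (C \<inter> P n) = emeasure (chart_measure (Vs n) (fs n)) (C \<inter> P n)" for n
        by (rule is_area_measureD[OF m at]) (use P(1,2)[of n] C in auto)
      then show ?thesis by (simp add: \<mu>_def)
    qed
    finally show ?thesis .
  qed
  define m where "m = measure_of UNIV (sets (borel :: 'm measure)) \<mu>"
  have sm: "sets m = sets borel"
    unfolding m_def using sets.sigma_sets_eq[of "borel :: 'm measure"] by simp
  have em: "emeasure m C = \<mu> C" if "C \<in> sets borel" for C
    unfolding m_def
  proof (rule emeasure_measure_of_sigma)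
    show "sigma_algebra UNIV (sets (borel :: 'm measure))"
      using sets.sigma_algebra_axioms[of "borel :: 'm measure"] by simp
    show "positive (sets borel) \<mu>"
      by (simp add: positive_def \<mu>_def)
    show "countably_additive (sets borel) \<mu>"
    proof (rule countably_additiveI)
      fix F :: "nat \<Rightarrow> 'm set"
      assume F: "range F \<subseteq> sets borel" "disjoint_family F"
      have "(\<Sum>i. \<mu> (F i)) = (\<Sum>n. \<Sum>i. emeasure (chart_measure (Vs n) (fs n)) (F i \<inter> P n))"
        unfolding \<mu>_def by (rule ennreal_suminf_swap)
      also have "(\<Sum>i. emeasure (chart_measure (Vs n) (fs n)) (F i \<inter> P n)) =
          emeasure (chart_measure (Vs n) (fs n)) (\<Union>i. F i \<inter> P n)" for n
        using F P(1)[of n] by (intro suminf_emeasure) (auto simp: disjoint_family_on_def)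
      then have "(\<Sum>n. \<Sum>i. emeasure (chart_measure (Vs n) (fs n)) (F i \<inter> P n)) = \<mu> (\<Union>i. F i)"
        by (simp add: \<mu>_def)
      finally show "(\<Sum>i. \<mu> (F i)) = \<mu> (\<Union>i. F i)" .
    qed
  qed (rule that)
  have "is_area_measure m"
    unfolding is_area_measure_def
  proof (intro conjI sm ballI, clarify)
    fix V f and C :: "'m set" assume c: "(V, f) \<in> A" and C: "C \<in> sets borel" "C \<subseteq> f ` V"
    have "emeasure (chart_measure (Vs n) (fs n)) (C \<inter> P n) = emeasure (chart_measure V f) (C \<inter> P n)" for n
      using P(1,2)[of n] C by (intro chart_measure_compat at c) auto
    then have "emeasure m C = (\<Sum>n. emeasure (chart_measure V f) (C \<inter> P n))"
      using em[OF C(1)] by (simp add: \<mu>_def)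
    also have "\<dots> = emeasure (chart_measure V f) (\<Union>n. C \<inter> P n)"
      using P(1) C by (intro suminf_emeasure disj) auto
    also have "(\<Union>n. C \<inter> P n) = C"
      using P(4) by (simp flip: Int_UN_distrib)
    finally show "emeasure m C = emeasure (chart_measure V f) C" .
  qed
  moreover have "m' = m" if "is_area_measure m'" for m'
    using that sm uniq[OF that] em by (intro measure_eqI) (auto simp: is_area_measure_def)
  ultimately show ?thesis by blast
qed

lemma area_measure: "is_area_measure (area_measure A \<psi>)"
proof -
  have "area_measure A \<psi> = (THE m. is_area_measure m)"
    unfolding area_measure_def is_area_measure_iff ..
  then show ?thesis
    using theI'[OF ex1_area_measure] by simp
qed

lemma sets_area_measure [simp]: "sets (area_measure A \<psi>) = sets borel"
  using area_measure by (simp add: is_area_measure_def)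

lemma emeasure_area_measure:
  "(V, f) \<in> A \<Longrightarrow> C \<in> sets borel \<Longrightarrow> C \<subseteq> f ` V \<Longrightarrow>
    emeasure (area_measure A \<psi>) C = emeasure (chart_measure V f) C"
  by (rule is_area_measureD[OF area_measure])

section \<open>Integration with respect to the area measure\<close>

lemma restricted_area_measure:
  assumes c: "(V, f) \<in> A"
  shows "density (area_measure A \<psi>) (indicator (f ` V)) = chart_measure V f"
proof (rule measure_eqI)
  show "sets (density (area_measure A \<psi>) (indicator (f ` V))) = sets (chart_measure V f)"
    by simp
  fix C assume "C \<in> sets (density (area_measure A \<psi>) (indicator (f ` V)))"
  then have C: "C \<in> sets borel" by simp
  have fV: "f ` V \<in> sets borel" using chart_open(2)[OF c] by simp
  have "overlap V f (f ` V \<inter> C) = overlap V f C"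
    by (auto simp: overlap_def)
  then have "emeasure (chart_measure V f) (f ` V \<inter> C) = emeasure (chart_measure V f) C"
    using C fV by (simp add: emeasure_chart_measure[OF c])
  then show "emeasure (density (area_measure A \<psi>) (indicator (f ` V))) C = emeasure (chart_measure V f) C"
    using C fV emeasure_area_measure[OF c, of "f ` V \<inter> C"] by (simp add: emeasure_restricted)
qed

lemma integral_area_measure_chart:
  fixes g :: "'m \<Rightarrow> real"
  assumes c: "(V, f) \<in> A" and g: "g \<in> borel_measurable borel" and g0: "\<And>p. p \<notin> f ` V \<Longrightarrow> g p = 0"
  shows "integral\<^sup>L (area_measure A \<psi>) g = integral\<^sup>L lborel (\<lambda>x. indicator V x * (area_density f x * g (f x)))"
proof -
  have fV: "f ` V \<in> sets borel" using chart_open(2)[OF c] by simp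
  have g': "g \<in> borel_measurable (area_measure A \<psi>)"
    using g by (simp cong: measurable_cong_sets)
  have ind: "(indicator (f ` V) :: 'm \<Rightarrow> real) \<in> borel_measurable (area_measure A \<psi>)"
    by (rule borel_measurable_indicator) (simp add: fV)
  have "(\<lambda>p. indicator (f ` V) p *\<^sub>R g p) = g"
    using g0 by (auto simp: indicator_def fun_eq_iff)
  then have "integral\<^sup>L (area_measure A \<psi>) g =
      integral\<^sup>L (density (area_measure A \<psi>) (\<lambda>p. ennreal (indicator (f ` V) p))) g"
    using integral_density[OF g' ind] by simp
  also have "density (area_measure A \<psi>) (\<lambda>p. ennreal (indicator (f ` V) p)) = chart_measure V f"
    using restricted_area_measure[OF c] by (simp add: ennreal_indicator)
  also have "integral\<^sup>L (chart_measure V f) g =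
      integral\<^sup>L (density (restrict_space lborel V) (\<lambda>x. ennreal (area_density f x))) (\<lambda>x. g (f x))"
    unfolding chart_measure_def using chart_measurable[OF c] g by (intro integral_distr) simp_all
  also have "\<dots> = integral\<^sup>L (restrict_space lborel V) (\<lambda>x. area_density f x *\<^sub>R g (f x))"
  proof (rule integral_density)
    show "(\<lambda>x. g (f x)) \<in> borel_measurable (restrict_space lborel V)"
      using measurable_compose[OF chart_measurable(2)[OF c] g] .
    show "AE x in restrict_space lborel V. 0 \<le> area_density f x"
      using area_density_nonneg[OF c] by (auto simp: space_restrict_space)
  qed (rule chart_measurable[OF c])
  also have "\<dots> = integral\<^sup>L lborel (\<lambda>x. indicator V x *\<^sub>R (area_density f x *\<^sub>R g (f x)))"
    by (rule integral_restrict_space) (simp add: chart_measurable[OF c])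
  finally show ?thesis by simp
qed

lemma emeasure_area_chart_compact:
  assumes c: "(V, f) \<in> A" and K: "compact K" "K \<subseteq> V"
  shows "emeasure (area_measure A \<psi>) (f ` K) < \<infinity>"
proof -
  have KB: "K \<in> sets borel" using K(1) by (simp add: borel_compact)
  note fK = chart_image_borel[OF c KB K(2)]
  have "emeasure (area_measure A \<psi>) (f ` K) = (\<integral>\<^sup>+x. indicator K x * area_density f x \<partial>lborel)"
    using emeasure_area_measure[OF c fK image_mono[OF K(2)]] emeasure_chart_measure[OF c fK]
      overlap_of_image[OF c K(2)] by simp
  moreover have "integrable lborel (\<lambda>x. indicator K x *\<^sub>R area_density f x)"
    by (rule borel_integrable_compact[OF K(1) continuous_on_subset[OF area_density_continuous[OF c] K(2)]])
  moreover have "norm (indicator K x * area_density f x) = indicator K x * area_density f x" for x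
    using area_density_nonneg[OF c] K(2) by (cases "x \<in> K") auto
  ultimately show ?thesis
    by (simp add: integrable_iff_bounded)
qed

lemma continuous_on_charts:
  fixes g :: "'m \<Rightarrow> 'b::topological_space"
  assumes "\<And>V f. (V, f) \<in> A \<Longrightarrow> continuous_on V (g \<circ> f)"
  shows "continuous_on UNIV g"
proof -
  have "continuous_on (f ` V) g" if c: "(V, f) \<in> A" for V f
  proof -
    have "continuous_on (f ` V) ((g \<circ> f) \<circ> the_inv_into V f)"
      by (rule continuous_on_compose[OF chart_homeomorphism(3)[OF c]])
        (use assms[OF c] the_inv_into_onto[OF chart_homeomorphism(2)[OF c]] in simp)
    moreover have "((g \<circ> f) \<circ> the_inv_into V f) q = g q" if "q \<in> f ` V" for q
      using f_the_inv_into_f[OF chart_homeomorphism(2)[OF c] that] by simp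
    ultimately show ?thesis
      using continuous_on_cong by blast
  qed
  then have "continuous_on (\<Union>((\<lambda>(V, f). f ` V) ` A)) g"
    by (intro continuous_on_open_Union) (auto simp: chart_open)
  then show ?thesis
    unfolding chart_Union .
qed

lemma chart_ball_cover:
  obtains V f x r where "(V, f) \<in> A" "x \<in> V" "f x = p" "r > 0" "cball x r \<subseteq> V" "open (f ` ball x r)"
proof -
  obtain V f x where c: "(V, f) \<in> A" "x \<in> V" "f x = p"
    by (rule chart_cover)
  obtain r where r: "r > 0" "cball x r \<subseteq> V"
    using open_contains_cball chart_open(1)[OF c(1)] c(2) by metis
  have "ball x r \<subseteq> V" using r(2) ball_subset_cball by blast
  then have "f ` ball x r = the_inv_into V f -` ball x r \<inter> f ` V"
    using chart_homeomorphism(2)[OF c(1)] by (auto simp: the_inv_into_f_f subset_iff)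
  moreover have "open (f ` V \<inter> the_inv_into V f -` ball x r)"
    by (intro continuous_open_preimage chart_homeomorphism chart_open c open_ball)
  ultimately have "open (f ` ball x r)"
    by (simp add: Int_commute)
  with that c r show ?thesis by blast
qed

text \<open>Finitely many chart balls cover \<open>K\<close>, and each has finite area because the
  density is bounded on the compact closed ball.\<close>

lemma emeasure_area_compact:
  assumes "compact K"
  shows "emeasure (area_measure A \<psi>) K < \<infinity>"
proof -
  have "\<forall>p\<in>K. \<exists>S. p \<in> S \<and> open S \<and> emeasure (area_measure A \<psi>) S < \<infinity>"
  proof
    fix p
    obtain V f x r where c: "(V, f) \<in> A" "x \<in> V" "f x = p" "r > 0" "cball x r \<subseteq> V" "open (f ` ball x r)"
      by (rule chart_ball_cover)
    have "emeasure (area_measure A \<psi>) (f ` ball x r) \<le> emeasure (area_measure A \<psi>) (f ` cball x r)"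
      using chart_image_borel[OF c(1) _ c(5)] by (intro emeasure_mono image_mono) auto
    also have "\<dots> < \<infinity>"
      by (rule emeasure_area_chart_compact[OF c(1) compact_cball c(5)])
    finally show "\<exists>S. p \<in> S \<and> open S \<and> emeasure (area_measure A \<psi>) S < \<infinity>"
      using c by (intro exI[of _ "f ` ball x r"]) auto
  qed
  then obtain S where S: "\<And>p. p \<in> K \<Longrightarrow> p \<in> S p \<and> open (S p) \<and> emeasure (area_measure A \<psi>) (S p) < \<infinity>"
    by metis
  obtain D where D: "D \<subseteq> K" "finite D" "K \<subseteq> (\<Union>p\<in>D. S p)"
    using compactE_image[OF assms, of K S] S by blast
  have "emeasure (area_measure A \<psi>) K \<le> emeasure (area_measure A \<psi>) (\<Union>p\<in>D. S p)"
    using D S by (intro emeasure_mono) (auto intro!: borel_open)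
  also have "\<dots> \<le> (\<Sum>p\<in>D. emeasure (area_measure A \<psi>) (S p))"
    using D S by (intro emeasure_subadditive_finite) (auto intro!: borel_open)
  also have "\<dots> < \<infinity>"
    using D S by (auto simp: subset_iff less_top)
  finally show ?thesis .
qed

lemma integrable_area_continuous:
  fixes g :: "'m \<Rightarrow> real"
  assumes g: "continuous_on UNIV g" and K: "compact K" and g0: "\<And>p. p \<notin> K \<Longrightarrow> g p = 0"
  shows "integrable (area_measure A \<psi>) g"
proof -
  have "bounded (g ` K)"
    using compact_imp_bounded[OF compact_continuous_image[OF continuous_on_subset[OF g subset_UNIV] K]] .
  then obtain B where B: "\<And>p. p \<in> K \<Longrightarrow> norm (g p) \<le> B"
    unfolding bounded_iff by blast
  show ?thesis
  proof (rule integrableI_bounded_set)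
    show "K \<in> sets (area_measure A \<psi>)"
      using compact_imp_closed[OF K] by simp
    show "g \<in> borel_measurable (area_measure A \<psi>)"
      using borel_measurable_continuous_onI[OF g] by (simp cong: measurable_cong_sets)
  qed (use B g0 emeasure_area_compact[OF K] in auto)
qed

end

section \<open>The weak equation of the angle function\<close>

lemma has_real_derivative_pos_part_sq: "((\<lambda>t::real. (max 0 t)\<^sup>2) has_real_derivative 2 * max 0 t) (at t)"
proof (cases t "0 :: real" rule: linorder_cases)
  case less
  show ?thesis
    by (rule has_field_derivative_transform_within_open[where f = "\<lambda>_. 0" and S = "{..<0}"])
      (use less in auto)
next
  case equal
  \<comment> \<open>Caratheodory's criterion at the corner: the function equals
    \<open>max 0 t * t\<close>, with the continuous slope \<open>max 0\<close>.\<close>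
  have "isCont (max 0) (0::real)"
    by (intro continuous_intros)
  then have "((\<lambda>t::real. (max 0 t)\<^sup>2) has_real_derivative 0) (at 0)"
    unfolding CARAT_DERIV by (intro exI[of _ "max 0"]) (auto simp: power2_eq_square max_def)
  with equal show ?thesis by simp
next
  case greater
  have "((\<lambda>t. t\<^sup>2) has_real_derivative 2 * max 0 t) (at t)"
    using greater by (auto intro!: derivative_eq_intros)
  then show ?thesis
    by (rule has_field_derivative_transform_within_open[where S = "{0<..}"]) (use greater in auto)
qed

text \<open>A bump of class C1 is smooth enough, since the weak equation differentiates its test
  functions only once.\<close>

lemma C1_on_bump:
  fixes a :: "'a::euclidean_space"
  shows "C1_on UNIV (\<lambda>x. (max 0 (r\<^sup>2 - (x - a) \<bullet> (x - a)))\<^sup>2 :: real)"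
proof -
  have id: "C1_on UNIV (\<lambda>x::'a. x - a)"
    by (rule C1_onI[where f' = "\<lambda>x v. v"]) (auto intro!: derivative_eq_intros)
  have q: "C1_on UNIV (\<lambda>x. r\<^sup>2 - (x - a) \<bullet> (x - a))"
    by (rule C1_on_diff[OF C1_on_const C1_on_inner[OF id id]])
  show ?thesis
    by (rule C1_on_compose_real[OF q has_real_derivative_pos_part_sq])
      (intro continuous_intros)
qed

lemma Ck_on_deriv:
  fixes g :: "real \<Rightarrow> real"
  assumes "Ck_on (Suc k) S g" "open S"
  shows "Ck_on k S (deriv g)" "x \<in> S \<Longrightarrow> (g has_real_derivative deriv g x) (at x)"
proof -
  have d: "(g has_real_derivative deriv g x) (at x)" if "x \<in> S" for x
    using assms(1) that by (simp add: Ck_on.simps DERIV_deriv_iff_real_differentiable)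
  have eq: "deriv g x = frechet_derivative g (at x) 1" if "x \<in> S" for x
    using frechet_derivative_at[OF d[OF that, unfolded has_field_derivative_def]]
    by (metis mult.right_neutral)
  have "Ck_on k S (\<lambda>x. frechet_derivative g (at x) 1)"
    using assms(1) by (simp add: Ck_on.simps)
  from Ck_on_cong[OF assms(2) this eq] show "Ck_on k S (deriv g)" .
  show "x \<in> S \<Longrightarrow> (g has_real_derivative deriv g x) (at x)" by (rule d)
qed

lemma surface_patch_subset:
  "surface_patch V \<Psi> n \<Longrightarrow> open U \<Longrightarrow> U \<subseteq> V \<Longrightarrow> surface_patch U \<Psi> n"
  unfolding surface_patch_def by (auto intro: Ck_on_subset)

context surface_patch
begin

text \<open>Positivity of the inverse metric, by completing the square after multiplication by
  \<open>gE \<Psi> x\<close>.\<close>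

lemma gprod_self_nonneg:
  assumes x: "x \<in> U"
  shows "gG \<Psi> x * v\<^sup>2 - 2 * gF \<Psi> x * v * w + gE \<Psi> x * w\<^sup>2 \<ge> 0"
proof -
  have D: "gE \<Psi> x * gG \<Psi> x - (gF \<Psi> x)\<^sup>2 > 0"
    using gD_pos[OF x] by (simp add: gD_def)
  then have "gE \<Psi> x \<noteq> 0" by auto
  then have E: "gE \<Psi> x > 0" by (simp add: gE_def)
  have "gE \<Psi> x * (gG \<Psi> x * v\<^sup>2 - 2 * gF \<Psi> x * v * w + gE \<Psi> x * w\<^sup>2) =
      (gE \<Psi> x * w - gF \<Psi> x * v)\<^sup>2 + (gE \<Psi> x * gG \<Psi> x - (gF \<Psi> x)\<^sup>2) * v\<^sup>2"
    by (simp add: power2_eq_square algebra_simps)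
  also have "\<dots> \<ge> 0" using D by simp
  finally show ?thesis using E by (simp add: zero_le_mult_iff)
qed

text \<open>The difference of the two sides is the squared length of grad u - (u / w) grad
  w.\<close>

lemma picone:
  assumes x: "x \<in> U" and u: "C1_on U u" and w: "C1_on U w" and pos: "\<And>y. y \<in> U \<Longrightarrow> w y > 0"
  shows "gprod \<Psi> (\<lambda>y. u y * u y / w y) w x \<le> gprod \<Psi> u u x"
proof -
  have wx: "w x > 0" using pos x by blast
  have f: "C1_on U (\<lambda>y. u y * u y / w y)"
    using pos by (intro C1_on_divide C1_on_mult u w) force
  have pdf: "pd i (\<lambda>y. u y * u y / w y) x = 2 * (u x / w x) * pd i u x - (u x / w x)\<^sup>2 * pd i w x" for i
  proof -
    \<comment> \<open>The derivative of the quotient is read off from the product rule for quotient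
      times \<open>w\<close>, which equals the square of \<open>u\<close> near
      \<open>x\<close>.\<close>
    have "pd i (\<lambda>y. (u y * u y / w y) * w y) x = pd i (\<lambda>y. u y * u y) x"
      by (rule pd_cong[OF U x]) (use pos in force)
    then have "(u x * u x / w x) * pd i w x + pd i (\<lambda>y. u y * u y / w y) x * w x = 2 * u x * pd i u x"
      using pd_mult[OF C1_on_differentiable[OF f x] C1_on_differentiable[OF w x]]
        pd_mult[OF C1_on_differentiable[OF u x] C1_on_differentiable[OF u x]] by simp
    then show ?thesis
      using wx by (simp add: field_simps power2_eq_square)
  qed
  define s where "s = u x / w x"
  have "gD \<Psi> x * (gprod \<Psi> u u x - gprod \<Psi> (\<lambda>y. u y * u y / w y) w x) =
      gG \<Psi> x * (pd 1 u x - s * pd 1 w x)\<^sup>2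
      - 2 * gF \<Psi> x * (pd 1 u x - s * pd 1 w x) * (pd 2 u x - s * pd 2 w x)
      + gE \<Psi> x * (pd 2 u x - s * pd 2 w x)\<^sup>2"
  proof -
    have gp: "gD \<Psi> x * gprod \<Psi> g h x = gG \<Psi> x * pd 1 g x * pd 1 h x
        - gF \<Psi> x * (pd 1 g x * pd 2 h x + pd 2 g x * pd 1 h x) + gE \<Psi> x * pd 2 g x * pd 2 h x" for g h
      using gD_pos[OF x] by (simp add: gprod_def)
    then show ?thesis
      unfolding right_diff_distrib gp pdf s_def[symmetric] by (simp add: power2_eq_square algebra_simps)
  qed
  also have "\<dots> \<ge> 0" by (rule gprod_self_nonneg[OF x])
  finally show ?thesis
    using gD_pos[OF x] by (simp add: zero_le_mult_iff)
qed

end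

section \<open>C1 functions and bumps on the surface\<close>

context oriented_surface
begin

text \<open>Relative to a set \<open>S\<close>, meant to be open, so that a function can be treated
  on a chart and off its support separately and then glued by \<open>C1_map_on_Un\<close>.\<close>

definition C1_map_on :: "'m set \<Rightarrow> ('m \<Rightarrow> real) \<Rightarrow> bool" where
  "C1_map_on S u \<longleftrightarrow> (\<forall>V f. (V, f) \<in> A \<longrightarrow> C1_on (overlap V f S) (u \<circ> f))"

lemma overlap_UNIV [simp]: "overlap V f UNIV = V"
  by (simp add: overlap_def)

lemma C1_map_on_chart: "C1_map_on UNIV u \<Longrightarrow> (V, f) \<in> A \<Longrightarrow> C1_on V (u \<circ> f)"
  unfolding C1_map_on_def by fastforce

lemma C1_map_on_differentiable:
  "C1_map_on UNIV u \<Longrightarrow> (V, f) \<in> A \<Longrightarrow> x \<in> V \<Longrightarrow> (u \<circ> f) differentiable at x"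
  using C1_on_differentiable[OF C1_map_on_chart] .

lemma C1_map_on_cong:
  assumes "C1_map_on S u" "open S" "\<And>p. p \<in> S \<Longrightarrow> w p = u p"
  shows "C1_map_on S w"
  unfolding C1_map_on_def
proof (intro allI impI)
  fix V f assume c: "(V, f) \<in> A"
  show "C1_on (overlap V f S) (w \<circ> f)"
    by (rule C1_on_cong[OF _ open_overlap[OF c assms(2)], of "u \<circ> f"])
      (use assms c in \<open>auto simp: C1_map_on_def overlap_def\<close>)
qed

lemma C1_map_on_Un:
  assumes "C1_map_on S u" "C1_map_on T u" "open S" "open T"
  shows "C1_map_on (S \<union> T) u"
  unfolding C1_map_on_def
proof (intro allI impI)
  fix V f assume c: "(V, f) \<in> A"
  have "overlap V f (S \<union> T) = overlap V f S \<union> overlap V f T"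
    by (auto simp: overlap_def)
  moreover have "C1_on (overlap V f S \<union> overlap V f T) (u \<circ> f)"
    using assms c by (intro C1_on_Un open_overlap) (auto simp: C1_map_on_def)
  ultimately show "C1_on (overlap V f (S \<union> T)) (u \<circ> f)" by simp
qed

lemma C1_map_on_const: "C1_map_on S (\<lambda>_. c)"
  unfolding C1_map_on_def comp_def by (simp add: C1_on_const)

lemma C1_map_on_mult: "C1_map_on S u \<Longrightarrow> C1_map_on S w \<Longrightarrow> C1_map_on S (\<lambda>p. u p * w p)"
  unfolding C1_map_on_def comp_def using C1_on_mult by blast

lemma C1_map_on_add: "C1_map_on S u \<Longrightarrow> C1_map_on S w \<Longrightarrow> C1_map_on S (\<lambda>p. u p + w p)"
  unfolding C1_map_on_def comp_def using C1_on_add by blast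

lemma C1_map_on_sum: "(\<And>i. i \<in> I \<Longrightarrow> C1_map_on S (u i)) \<Longrightarrow> C1_map_on S (\<lambda>p. \<Sum>i\<in>I. u i p)"
  by (induction I rule: infinite_finite_induct) (auto intro: C1_map_on_const C1_map_on_add)

lemma C1_map_on_divide:
  assumes "C1_map_on S u" "C1_map_on S w" "\<And>p. p \<in> S \<Longrightarrow> w p \<noteq> 0"
  shows "C1_map_on S (\<lambda>p. u p / w p)"
  unfolding C1_map_on_def comp_def
proof (intro allI impI)
  fix V f assume c: "(V, f) \<in> A"
  show "C1_on (overlap V f S) (\<lambda>x. u (f x) / w (f x))"
    using assms c by (intro C1_on_divide) (auto simp: C1_map_on_def comp_def overlap_def)
qed

lemma C1_map_on_subset:
  assumes "C1_map_on S u" "T \<subseteq> S"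
  shows "C1_map_on T u"
  unfolding C1_map_on_def
proof (intro allI impI)
  fix V f assume "(V, f) \<in> A"
  then have "C1_on (overlap V f S) (u \<circ> f)"
    using assms(1) by (simp add: C1_map_on_def)
  moreover have "overlap V f T \<subseteq> overlap V f S"
    using assms(2) by (auto simp: overlap_def)
  ultimately show "C1_on (overlap V f T) (u \<circ> f)"
    by (rule C1_on_subset)
qed

lemma C1_map_on_continuous: "C1_map_on UNIV u \<Longrightarrow> continuous_on UNIV u"
  by (rule continuous_on_charts) (rule C1_on_imp_continuous_on[OF C1_map_on_chart])

lemma smooth_map_imp_C1_map_on: "smooth_map A u \<Longrightarrow> C1_map_on UNIV u"
  unfolding C1_map_on_def smooth_map_def by (auto intro: smooth_onD)

lemma angle_fun_comp: "angle_fun N \<circ> f = (\<lambda>x. (N \<circ> f) x \<bullet> e3)"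
  and height_comp: "height \<psi> \<circ> f = (\<lambda>x. (\<psi> \<circ> f) x \<bullet> e3)"
  by (simp_all add: fun_eq_iff angle_fun_def height_def)

lemma C1_map_on_angle_fun: "C1_map_on UNIV (angle_fun N)"
  and C1_map_on_height: "C1_map_on UNIV (height \<psi>)"
  unfolding C1_map_on_def angle_fun_comp height_comp overlap_UNIV
  using C1_on_inner[OF smooth_onD C1_on_const] immersed by blast+

lemma surface_gradient_inner_continuous:
  assumes "C1_map_on UNIV u" "C1_map_on UNIV w"
  shows "continuous_on UNIV (\<lambda>p. surface_gradient A \<psi> u p \<bullet> surface_gradient A \<psi> w p)"
proof (rule continuous_on_charts)
  fix V f assume c: "(V, f) \<in> A"
  have cont: "continuous_on V (gprod (\<psi> \<circ> f) (u \<circ> f) (w \<circ> f))"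
    by (rule surface_patch.continuous_gprod[OF surface_patch[OF c]]) (rule C1_map_on_chart[OF _ c], rule assms)+
  have eq: "((\<lambda>p. surface_gradient A \<psi> u p \<bullet> surface_gradient A \<psi> w p) \<circ> f) x = gprod (\<psi> \<circ> f) (u \<circ> f) (w \<circ> f) x"
    if "x \<in> V" for x
    using surface_gradient_inner_chart[OF c that] C1_map_on_differentiable[OF _ c that] assms by simp
  show "continuous_on V ((\<lambda>p. surface_gradient A \<psi> u p \<bullet> surface_gradient A \<psi> w p) \<circ> f)"
    by (rule continuous_on_eq[OF cont eq[symmetric]])
qed

lemma second_form_norm_sq_continuous: "continuous_on UNIV (second_form_norm_sq A \<psi> N)"
proof (rule continuous_on_charts)
  fix V f assume c: "(V, f) \<in> A"
  note s = surface_patch.continuous_shape[OF surface_patch[OF c]]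
  have cont: "continuous_on V (\<lambda>x. (shape_trace (\<psi> \<circ> f) (N \<circ> f) x)\<^sup>2 - 2 * shape_det (\<psi> \<circ> f) (N \<circ> f) x)"
    by (intro continuous_intros s)
  have eq: "(second_form_norm_sq A \<psi> N \<circ> f) x = (shape_trace (\<psi> \<circ> f) (N \<circ> f) x)\<^sup>2 - 2 * shape_det (\<psi> \<circ> f) (N \<circ> f) x"
    if "x \<in> V" for x
    using mean_curvature_chart(2)[OF c that] by simp
  show "continuous_on V (second_form_norm_sq A \<psi> N \<circ> f)"
    by (rule continuous_on_eq[OF cont eq[symmetric]])
qed

lemma surface_gradient_inner_add:
  assumes "C1_map_on UNIV u" "C1_map_on UNIV v" "C1_map_on UNIV w"
  shows "surface_gradient A \<psi> (\<lambda>p. u p + v p) p \<bullet> surface_gradient A \<psi> w p =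
    surface_gradient A \<psi> u p \<bullet> surface_gradient A \<psi> w p + surface_gradient A \<psi> v p \<bullet> surface_gradient A \<psi> w p"
proof -
  obtain V f x where c: "(V, f) \<in> A" "x \<in> V" "f x = p" by (rule chart_cover)
  note d = C1_map_on_differentiable[OF _ c(1,2)]
  have "pd i ((\<lambda>p. u p + v p) \<circ> f) x = pd i (u \<circ> f) x + pd i (v \<circ> f) x" for i
    using pd_add[OF d[OF assms(1)] d[OF assms(2)]] by (simp add: comp_def)
  then have "gprod (\<psi> \<circ> f) ((\<lambda>p. u p + v p) \<circ> f) (w \<circ> f) x =
      gprod (\<psi> \<circ> f) (u \<circ> f) (w \<circ> f) x + gprod (\<psi> \<circ> f) (v \<circ> f) (w \<circ> f) x"
    unfolding gprod_def add_divide_distrib[symmetric] by (simp add: algebra_simps)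
  then show ?thesis
    unfolding c(3)[symmetric]
      surface_gradient_inner_chart[OF c(1,2) d[OF C1_map_on_add[OF assms(1,2)]] d[OF assms(3)]]
      surface_gradient_inner_chart[OF c(1,2) d[OF assms(1)] d[OF assms(3)]]
      surface_gradient_inner_chart[OF c(1,2) d[OF assms(2)] d[OF assms(3)]] .
qed

lemma surface_gradient_inner_eq_0:
  assumes S: "open S" "p \<in> S" "\<And>q. q \<in> S \<Longrightarrow> u q = 0"
    and u: "C1_map_on UNIV u" and w: "C1_map_on UNIV w"
  shows "surface_gradient A \<psi> u p \<bullet> surface_gradient A \<psi> w p = 0"
proof -
  obtain V f x where c: "(V, f) \<in> A" "x \<in> V" "f x = p" by (rule chart_cover)
  note d = C1_map_on_differentiable[OF _ c(1,2)]
  have x: "x \<in> overlap V f S"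
    using c S(2) by (simp add: overlap_def)
  have "pd i (u \<circ> f) x = pd i (\<lambda>_. 0::real) x" for i
    by (rule pd_cong[OF open_overlap[OF c(1) S(1)] x]) (simp add: overlap_def S(3))
  then show ?thesis
    unfolding c(3)[symmetric] surface_gradient_inner_chart[OF c(1,2) d[OF u] d[OF w]]
    by (simp add: gprod_def)
qed

lemma bump_function:
  assumes c: "(V, f) \<in> A" and r: "cball a r \<subseteq> V" "r > 0"
  obtains b where "C1_map_on UNIV b" "\<And>p. b p \<ge> 0" "\<And>p. p \<in> f ` ball a r \<Longrightarrow> b p > 0"
    "\<And>p. p \<notin> f ` cball a r \<Longrightarrow> b p = 0"
proof -
  define \<beta> where "\<beta> = (\<lambda>x. (max 0 (r\<^sup>2 - (x - a) \<bullet> (x - a)))\<^sup>2)"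
  define b where "b = (\<lambda>p. if p \<in> f ` V then \<beta> (the_inv_into V f p) else 0)"
  have \<beta>0: "\<beta> x = 0 \<longleftrightarrow> x \<notin> ball a r" for x
  proof -
    have "(x - a) \<bullet> (x - a) = (dist a x)\<^sup>2"
      by (simp add: dist_norm norm_minus_commute[of a x] power2_norm_eq_inner)
    moreover have "(dist a x)\<^sup>2 < r\<^sup>2 \<longleftrightarrow> dist a x < r"
      using power_mono_iff[of r "dist a x" 2] r(2) by (simp add: not_le[symmetric])
    ultimately show ?thesis by (auto simp: \<beta>_def max_def)
  qed
  have closed: "closed (f ` cball a r)"
    using compact_continuous_image[OF continuous_on_subset[OF chart_homeomorphism(1)[OF c] r(1)] compact_cball]
    by (rule compact_imp_closed)
  have bf: "b (f x) = \<beta> x" if "x \<in> V" for x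
    using that chart_homeomorphism(2)[OF c] by (simp add: b_def the_inv_into_f_f)
  have b0: "b p = 0" if "p \<notin> f ` cball a r" for p
  proof (cases "p \<in> f ` V")
    case True
    then obtain x where "x \<in> V" "p = f x" by blast
    with that show ?thesis using bf \<beta>0[of x] by auto
  qed (simp add: b_def)
  have "C1_map_on (f ` V) b"
    unfolding C1_map_on_def
  proof (intro allI impI)
    fix W h assume c': "(W, h) \<in> A"
    have "C1_on (overlap W h (f ` V)) (\<lambda>x. \<beta> ((the_inv_into V f \<circ> h) x))"
      unfolding \<beta>_def
      by (rule C1_on_compose[OF transition(1)[OF c' c] C1_on_bump]) simp
    then show "C1_on (overlap W h (f ` V)) (b \<circ> h)"
      by (rule C1_on_cong[OF _ open_overlap[OF c' chart_open(2)[OF c]]]) (simp add: overlap_def b_def)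
  qed
  moreover have "C1_map_on (- f ` cball a r) b"
    by (rule C1_map_on_cong[OF C1_map_on_const[of _ 0]]) (use closed b0 in auto)
  ultimately have "C1_map_on (f ` V \<union> - f ` cball a r) b"
    using chart_open(2)[OF c] closed by (intro C1_map_on_Un) auto
  moreover have "f ` V \<union> - f ` cball a r = UNIV"
    using r(1) by auto
  ultimately have "C1_map_on UNIV b" by simp
  moreover have "b p > 0" if p: "p \<in> f ` ball a r" for p
  proof -
    obtain x where x: "x \<in> ball a r" "p = f x" using p by blast
    then have "x \<in> V" using r(1) by auto
    then show ?thesis
      using bf[of x] \<beta>0[of x] x by (simp add: \<beta>_def less_le)
  qed
  moreover have "b p \<ge> 0" for p
    by (simp add: b_def \<beta>_def)
  ultimately show ?thesis using that b0 by blast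
qed

end

section \<open>From the equation in a patch to the whole surface\<close>

locale phi_minimal_surface = oriented_surface A \<psi> N
  for A :: "'m::{t2_space, second_countable_topology} param set" and \<psi> N :: "'m \<Rightarrow> real^3" +
  fixes \<alpha> :: real and \<phi> :: "real \<Rightarrow> real"
  assumes smooth: "smooth_on {\<alpha><..} \<phi>"
    and above: "\<And>p. height \<psi> p > \<alpha>"
    and minimal: "phi_minimal \<phi> A \<psi> N"
begin

abbreviation "\<eta> \<equiv> angle_fun N"
abbreviation "weight p \<equiv> exp (\<phi> (height \<psi> p))"
abbreviation "normS p \<equiv> second_form_norm_sq A \<psi> N p"
abbreviation "\<phi>2 p \<equiv> deriv (deriv \<phi>) (height \<psi> p)"
abbreviation "grad u \<equiv> surface_gradient A \<psi> u"

lemma \<phi>_deriv: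
  "t > \<alpha> \<Longrightarrow> (\<phi> has_real_derivative deriv \<phi> t) (at t)"
  "t > \<alpha> \<Longrightarrow> (deriv \<phi> has_real_derivative deriv (deriv \<phi>) t) (at t)"
  "continuous_on {\<alpha><..} (deriv (deriv \<phi>))"
proof -
  have o: "open {\<alpha><..}" by simp
  note 1 = Ck_on_deriv[OF smooth_onD[OF smooth] o]
  note 2 = Ck_on_deriv[OF 1(1) o]
  show "t > \<alpha> \<Longrightarrow> (\<phi> has_real_derivative deriv \<phi> t) (at t)"
    using 1(2) by simp
  show "t > \<alpha> \<Longrightarrow> (deriv \<phi> has_real_derivative deriv (deriv \<phi>) t) (at t)"
    using 2(2) by simp
  show "continuous_on {\<alpha><..} (deriv (deriv \<phi>))"
    using 2(1)[of 0] by (simp add: Ck_on.simps)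
qed

lemma continuous_weight: "continuous_on UNIV weight" and continuous_\<phi>2: "continuous_on UNIV \<phi>2"
proof -
  have h: "continuous_on UNIV (height \<psi>)"
    by (rule C1_map_on_continuous[OF C1_map_on_height])
  have "continuous_on {\<alpha><..} \<phi>"
    using \<phi>_deriv(1) by (auto intro!: continuous_at_imp_continuous_on DERIV_isCont)
  from continuous_on_compose2[OF this h] continuous_on_compose2[OF \<phi>_deriv(3) h]
  show "continuous_on UNIV weight" "continuous_on UNIV \<phi>2"
    using above by (auto intro!: continuous_intros)
qed

text \<open>The equation for the angle function tested with \<open>u\<close>: the divergence has
  been moved onto \<open>u\<close> by parts.\<close>

definition weak_integrand :: "('m \<Rightarrow> real) \<Rightarrow> 'm \<Rightarrow> real" where
  "weak_integrand u p = weight p *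
     (grad u p \<bullet> grad \<eta> p - (normS p + \<phi>2 p * (1 - (\<eta> p)\<^sup>2)) * \<eta> p * u p)"

lemma weak_integrand_continuous:
  assumes u: "C1_map_on UNIV u"
  shows "continuous_on UNIV (weak_integrand u)"
  unfolding weak_integrand_def[abs_def]
  by (intro continuous_intros continuous_weight continuous_\<phi>2 second_form_norm_sq_continuous
      surface_gradient_inner_continuous C1_map_on_continuous C1_map_on_angle_fun u)

lemma weak_integrand_eq_0:
  assumes u: "C1_map_on UNIV u" and K: "compact K" "\<And>q. q \<notin> K \<Longrightarrow> u q = 0" and p: "p \<notin> K"
  shows "weak_integrand u p = 0"
proof -
  have "grad u p \<bullet> grad \<eta> p = 0"
    by (rule surface_gradient_inner_eq_0[of "- K", OF _ _ _ u C1_map_on_angle_fun])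
      (use K p compact_imp_closed in auto)
  then show ?thesis
    using K(2)[OF p] by (simp add: weak_integrand_def)
qed

lemma weak_integrand_integrable:
  assumes u: "C1_map_on UNIV u" and K: "compact K" "\<And>q. q \<notin> K \<Longrightarrow> u q = 0"
  shows "integrable (area_measure A \<psi>) (weak_integrand u)"
  by (rule integrable_area_continuous[OF weak_integrand_continuous[OF u] K(1)])
    (use weak_integrand_eq_0[OF u K] in blast)

lemma weak_integrand_add:
  assumes "C1_map_on UNIV u" "C1_map_on UNIV v"
  shows "weak_integrand (\<lambda>p. u p + v p) p = weak_integrand u p + weak_integrand v p"
  unfolding weak_integrand_def surface_gradient_inner_add[OF assms C1_map_on_angle_fun]
  by (simp add: algebra_simps)

text \<open>A chart domain may be disconnected, and then its orientation sign may vary; the ball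
  supplies a connected patch. Half the radius makes the support a compact subset of the open
  ball.\<close>

lemma weak_equation_local:
  assumes c: "(V, f) \<in> A" and r: "cball a r \<subseteq> V" "r > 0"
    and u: "C1_map_on UNIV u" and u0: "\<And>p. p \<notin> f ` cball a (r / 2) \<Longrightarrow> u p = 0"
  shows "integral\<^sup>L (area_measure A \<psi>) (weak_integrand u) = 0"
proof -
  let ?K = "cball a (r / 2)" and ?U = "ball a r"
  have KU: "?K \<subseteq> ?U" "?U \<subseteq> V"
    using r by auto
  have fK: "compact (f ` ?K)"
    using KU by (intro compact_continuous_image continuous_on_subset[OF chart_homeomorphism(1)[OF c]]) auto
  interpret V: surface_patch V "\<psi> \<circ> f" "N \<circ> f" by (rule surface_patch[OF c])
  interpret U: surface_patch ?U "\<psi> \<circ> f" "N \<circ> f"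
    by (rule surface_patch_subset[OF V.surface_patch_axioms _ KU(2)]) simp
  have inj: "f x \<notin> f ` ?K" if "x \<in> V" "x \<notin> ?K" for x
    using that KU inj_on_image_mem_iff[OF chart_homeomorphism(2)[OF c] that(1), of ?K] by auto
  have wf: "weak_integrand u (f x) = exp (\<phi> ((\<psi> \<circ> f) x \<bullet> e3)) * (gprod (\<psi> \<circ> f) (u \<circ> f) (\<lambda>x. (N \<circ> f) x \<bullet> e3) x -
      ((shape_trace (\<psi> \<circ> f) (N \<circ> f) x)\<^sup>2 - 2 * shape_det (\<psi> \<circ> f) (N \<circ> f) x
        + deriv (deriv \<phi>) ((\<psi> \<circ> f) x \<bullet> e3) * (1 - ((N \<circ> f) x \<bullet> e3)\<^sup>2)) * ((N \<circ> f) x \<bullet> e3) * (u \<circ> f) x)"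
    if x: "x \<in> V" for x
    unfolding weak_integrand_def mean_curvature_chart(2)[OF c x]
      surface_gradient_inner_chart[OF c x C1_map_on_differentiable[OF u c x] C1_map_on_differentiable[OF C1_map_on_angle_fun c x]]
      angle_fun_comp
    by (simp add: angle_fun_def height_def)
  have "integral\<^sup>L (area_measure A \<psi>) (weak_integrand u) =
      integral\<^sup>L lborel (\<lambda>x. indicator V x * (area_density f x * weak_integrand u (f x)))"
  proof (rule integral_area_measure_chart[OF c])
    show "weak_integrand u \<in> borel_measurable borel"
      by (rule borel_measurable_continuous_onI[OF weak_integrand_continuous[OF u]])
    show "weak_integrand u p = 0" if "p \<notin> f ` V" for p
      by (rule weak_integrand_eq_0[OF u fK u0]) (use that KU in auto)
  qed
  also have "(\<lambda>x. indicator V x * (area_density f x * weak_integrand u (f x))) =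
    (\<lambda>x. indicator ?U x * (exp (\<phi> ((\<psi> \<circ> f) x \<bullet> e3)) * sqrt (gD (\<psi> \<circ> f) x) *
      (gprod (\<psi> \<circ> f) (u \<circ> f) (\<lambda>x. (N \<circ> f) x \<bullet> e3) x -
      ((shape_trace (\<psi> \<circ> f) (N \<circ> f) x)\<^sup>2 - 2 * shape_det (\<psi> \<circ> f) (N \<circ> f) x
        + deriv (deriv \<phi>) ((\<psi> \<circ> f) x \<bullet> e3) * (1 - ((N \<circ> f) x \<bullet> e3)\<^sup>2)) * ((N \<circ> f) x \<bullet> e3) * (u \<circ> f) x)))"
  proof
    fix x
    consider "x \<in> ?U" | "x \<in> V - ?U" | "x \<notin> V" by blast
    then show "indicator V x * (area_density f x * weak_integrand u (f x)) =
      indicator ?U x * (exp (\<phi> ((\<psi> \<circ> f) x \<bullet> e3)) * sqrt (gD (\<psi> \<circ> f) x) *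
      (gprod (\<psi> \<circ> f) (u \<circ> f) (\<lambda>x. (N \<circ> f) x \<bullet> e3) x -
      ((shape_trace (\<psi> \<circ> f) (N \<circ> f) x)\<^sup>2 - 2 * shape_det (\<psi> \<circ> f) (N \<circ> f) x
        + deriv (deriv \<phi>) ((\<psi> \<circ> f) x \<bullet> e3) * (1 - ((N \<circ> f) x \<bullet> e3)\<^sup>2)) * ((N \<circ> f) x \<bullet> e3) * (u \<circ> f) x))"
    proof cases
      case 1
      then have "x \<in> V" using KU by blast
      with 1 show ?thesis
        unfolding wf[OF \<open>x \<in> V\<close>] by simp
    next
      case 2
      then have "f x \<notin> f ` ?K" using inj KU by blast
      then have "weak_integrand u (f x) = 0"
        using weak_integrand_eq_0[OF u fK u0] by blast
      with 2 show ?thesis by (simp del: mem_ball)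
    next
      case 3
      then have "x \<notin> ?U" using KU by blast
      with 3 show ?thesis by (simp del: mem_ball)
    qed
  qed
  also have "integral\<^sup>L lborel \<dots> = 0"
  proof (rule has_bochner_integral_integral_eq, rule U.weak_angle_equation)
    show "connected ?U" by simp
    show "\<alpha> < t \<Longrightarrow> (\<phi> has_real_derivative deriv \<phi> t) (at t)"
      "\<alpha> < t \<Longrightarrow> (deriv \<phi> has_real_derivative deriv (deriv \<phi>) t) (at t)" for t
      by (rule \<phi>_deriv(1), assumption, rule \<phi>_deriv(2), assumption)
    show "continuous_on {\<alpha><..} (deriv (deriv \<phi>))" by (rule \<phi>_deriv)
    show "\<alpha> < (\<psi> \<circ> f) x \<bullet> e3" for x
      using above[of "f x"] by (simp add: height_def)
    show "shape_trace (\<psi> \<circ> f) (N \<circ> f) x = - deriv \<phi> ((\<psi> \<circ> f) x \<bullet> e3) * ((N \<circ> f) x \<bullet> e3)" if "x \<in> ?U" for x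
      using minimal mean_curvature_chart(1)[OF c subsetD[OF KU(2) that]]
      by (simp add: phi_minimal_def height_def angle_fun_def)
    show "compact ?K" "?K \<subseteq> ?U" using KU by auto
    show "C1_on ?U (u \<circ> f)"
      by (rule C1_on_subset[OF C1_map_on_chart[OF u c] KU(2)])
    show "(u \<circ> f) x = 0" if "x \<in> ?U - ?K" for x
      using that inj KU u0 by auto
  qed
  finally show ?thesis .
qed

text \<open>Finitely many local bumps have a sum \<open>\<sigma>\<close> that is positive on
  \<open>K\<close>. Dividing \<open>u\<close> by \<open>\<sigma>\<close> once and multiplying by
  each bump splits \<open>u\<close> into pieces to which the local equation applies.\<close>

lemma weak_equation:
  assumes u: "C1_map_on UNIV u" and K: "compact K" and u0: "\<And>p. p \<notin> K \<Longrightarrow> u p = 0"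
  shows "integral\<^sup>L (area_measure A \<psi>) (weak_integrand u) = 0"
proof -
  \<comment> \<open>A nonnegative bump supported in a half ball of some chart ball, as
    \<open>weak_equation_local\<close> demands, and positive on the open set \<open>S\<close>;
    compactness of \<open>K\<close> then selects finitely many.\<close>
  define good where "good = (\<lambda>b S. C1_map_on UNIV b \<and> (\<forall>p. b p \<ge> 0) \<and> open S \<and> (\<forall>p\<in>S. b p > (0::real)) \<and>
    (\<exists>V f a r. (V, f) \<in> A \<and> cball a r \<subseteq> V \<and> r > 0 \<and> (\<forall>p. p \<notin> f ` cball a (r / 2) \<longrightarrow> b p = 0)))"
  have "\<exists>b S. good b S \<and> q \<in> S" for q
  proof -
    obtain V f a r where c: "(V, f) \<in> A" "a \<in> V" "f a = q" "r > 0" "cball a r \<subseteq> V"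
      by (rule chart_ball_cover) blast
    have r2: "cball a (r / 2) \<subseteq> V" "r / 2 > 0" "ball a (r / 2) \<subseteq> V"
      using c(4,5) by auto
    obtain b where b: "C1_map_on UNIV b" "\<And>p. b p \<ge> 0" "\<And>p. p \<in> f ` ball a (r / 2) \<Longrightarrow> b p > 0"
      "\<And>p. p \<notin> f ` cball a (r / 2) \<Longrightarrow> b p = 0"
      using bump_function[OF c(1) r2(1,2)] by blast
    have "open {p. b p > 0}"
      using open_Collect_less[OF continuous_on_const C1_map_on_continuous[OF b(1)]] .
    moreover have "q \<in> {p. b p > 0}"
      using b(3)[of q] c(3) r2(2) by force
    ultimately have "good b {p. b p > 0}"
      unfolding good_def using b c by blast
    then show ?thesis using \<open>q \<in> {p. b p > 0}\<close> by blast
  qed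
  then obtain b S where bS: "\<And>q. good (b q) (S q)" "\<And>q. q \<in> S q"
    by metis
  obtain D where D: "D \<subseteq> K" "finite D" "K \<subseteq> (\<Union>q\<in>D. S q)"
  proof (rule compactE_image[OF K, of K S])
    show "open (S q)" for q
      using bS(1)[of q] unfolding good_def by blast
    show "K \<subseteq> (\<Union>q\<in>K. S q)"
      using bS(2) by blast
  qed
  define \<sigma> where "\<sigma> = (\<lambda>p. \<Sum>q\<in>D. b q p)"
  have bC: "C1_map_on UNIV (b q)" and bnn: "b q p \<ge> 0" for q p
    using bS(1)[of q] unfolding good_def by blast+
  have \<sigma>: "C1_map_on UNIV \<sigma>"
    unfolding \<sigma>_def by (intro C1_map_on_sum bC)
  have \<sigma>pos: "\<sigma> p > 0" if p: "p \<in> K" for p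
  proof -
    obtain q where "q \<in> D" "p \<in> S q" using D(3) p by blast
    then have "b q p > 0" using bS(1)[of q] unfolding good_def by blast
    then show ?thesis
      unfolding \<sigma>_def using D(2) \<open>q \<in> D\<close> bnn by (intro sum_pos2[of D q]) auto
  qed
  \<comment> \<open>Where \<open>\<sigma>\<close> vanishes the point lies off \<open>K\<close>, so
    \<open>u\<close> is zero and the quotient is 0. The sets where \<open>\<sigma>\<close> is
    positive and where \<open>u\<close> vanishes off \<open>K\<close> are open and cover the
    surface, so \<open>F\<close> is C1.\<close>
  define F where "F = (\<lambda>p. u p / \<sigma> p)"
  have "C1_map_on {p. \<sigma> p > 0} F"
    unfolding F_def by (rule C1_map_on_divide) (auto intro: C1_map_on_subset u \<sigma>)
  moreover have "C1_map_on (- K) F"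
    by (rule C1_map_on_cong[OF C1_map_on_const[of _ 0]])
      (use K u0 compact_imp_closed in \<open>auto simp: F_def\<close>)
  ultimately have "C1_map_on ({p. \<sigma> p > 0} \<union> - K) F"
    using open_Collect_less[OF continuous_on_const C1_map_on_continuous[OF \<sigma>]] K compact_imp_closed
    by (intro C1_map_on_Un) auto
  moreover have "{p. \<sigma> p > 0} \<union> - K = UNIV"
    using \<sigma>pos by auto
  ultimately have F: "C1_map_on UNIV F" by simp
  have bF: "C1_map_on UNIV (\<lambda>p. b q p * F p)" for q
    by (rule C1_map_on_mult[OF bC F])
  have F0: "F p = 0" if "p \<notin> K" for p
    using u0[OF that] by (simp add: F_def)
  have "integral\<^sup>L (area_measure A \<psi>) (weak_integrand (\<lambda>p. \<Sum>q\<in>D'. b q p * F p)) = 0" if "finite D'" for D'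
    using that
  proof (induction D' rule: finite_induct)
    case empty
    have "weak_integrand (\<lambda>p. 0) p = 0" for p
      by (rule weak_integrand_eq_0[OF C1_map_on_const compact_empty]) auto
    then show ?case by simp
  next
    case (insert q D')
    have sumC: "C1_map_on UNIV (\<lambda>p. \<Sum>q\<in>D'. b q p * F p)"
      by (intro C1_map_on_sum bF)
    have "integral\<^sup>L (area_measure A \<psi>) (weak_integrand (\<lambda>p. b q p * F p)) = 0"
    proof -
      obtain V f a r where "(V, f) \<in> A" "cball a r \<subseteq> V" "r > 0" "\<And>p. p \<notin> f ` cball a (r / 2) \<Longrightarrow> b q p = 0"
        using bS(1)[of q] unfolding good_def by blast
      then show ?thesis
        by (intro weak_equation_local[OF _ _ _ bF]) auto
    qed
    moreover have "weak_integrand (\<lambda>p. \<Sum>q\<in>insert q D'. b q p * F p) p =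
        weak_integrand (\<lambda>p. b q p * F p) p + weak_integrand (\<lambda>p. \<Sum>q\<in>D'. b q p * F p) p" for p
      using insert weak_integrand_add[OF bF sumC] by simp
    moreover have "integrable (area_measure A \<psi>) (weak_integrand (\<lambda>p. b q p * F p))"
      "integrable (area_measure A \<psi>) (weak_integrand (\<lambda>p. \<Sum>q\<in>D'. b q p * F p))"
      using F0 by (auto intro!: weak_integrand_integrable[OF _ K] bF sumC)
    ultimately show ?case
      using insert by simp
  qed
  from this[OF D(2)] have "integral\<^sup>L (area_measure A \<psi>) (weak_integrand (\<lambda>p. \<Sum>q\<in>D. b q p * F p)) = 0" .
  moreover have "(\<lambda>p. \<Sum>q\<in>D. b q p * F p) = u"
  proof
    fix p
    have "(\<Sum>q\<in>D. b q p * F p) = \<sigma> p * F p"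
      by (simp add: \<sigma>_def sum_distrib_right)
    also have "\<dots> = u p"
      using \<sigma>pos[of p] u0[of p] by (cases "p \<in> K") (auto simp: F_def)
    finally show "(\<Sum>q\<in>D. b q p * F p) = u p" .
  qed
  ultimately show ?thesis by simp
qed

end

section \<open>Stability\<close>

context phi_minimal_surface
begin

lemma normS_nonneg: "normS p \<ge> 0"
  by (simp add: second_form_norm_sq_def)

text \<open>A zero of a nonnegative angle function is a minimum, so there the vertical direction is a
  tangent vector in the kernel of the shape operator, and the mean curvature vanishes as well.\<close>

lemma normS_eq_0:
  assumes nonneg: "\<And>q. \<eta> q \<ge> 0" and zero: "\<eta> p = 0"
  shows "normS p = 0"
proof -
  obtain V f x where c: "(V, f) \<in> A" "x \<in> V" "f x = p" by (rule chart_cover)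
  interpret surface_patch V "\<psi> \<circ> f" "N \<circ> f" by (rule surface_patch[OF c(1)])
  interpret weingarten_frame "pd 1 (\<psi> \<circ> f) x" "pd 2 (\<psi> \<circ> f) x" "(N \<circ> f) x" "pd 1 (N \<circ> f) x" "pd 2 (N \<circ> f) x"
    by (rule weingarten_frame[OF c(2)])
  have "((\<eta> \<circ> f) has_derivative frechet_derivative (\<eta> \<circ> f) (at x)) (at x)"
    using C1_map_on_differentiable[OF C1_map_on_angle_fun c(1,2)] by (simp add: frechet_derivative_works)
  from differential_zero_maxmin[OF c(2) chart_open(1)[OF c(1)] this]
  have "frechet_derivative (\<eta> \<circ> f) (at x) = (\<lambda>v. 0)"
    using nonneg zero c(3) by simp
  then have "pd i (\<eta> \<circ> f) x = 0" for i
    by (simp add: pd_def)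
  moreover have "pd i (\<eta> \<circ> f) x = pd i (N \<circ> f) x \<bullet> e3" for i
    unfolding angle_fun_comp
    by (rule pd_bounded_linear[OF bounded_linear_inner_left immersed(5)[OF c(1,2)]])
  ultimately have "pd i (N \<circ> f) x \<bullet> e3 = 0" for i
    by simp
  moreover have "(N \<circ> f) x \<bullet> e3 = 0"
    using zero c(3) by (simp add: angle_fun_def)
  ultimately have "shape_det (\<psi> \<circ> f) (N \<circ> f) x = 0"
    unfolding shape_det_eq[OF c(2)] by (intro gauss_eq_0_if_vertical)
  moreover have "shape_trace (\<psi> \<circ> f) (N \<circ> f) x = 0"
    using minimal zero mean_curvature_chart(1)[OF c(1,2)] c(3) by (simp add: phi_minimal_def)
  ultimately show ?thesis
    using mean_curvature_chart(2)[OF c(1,2)] c(3) by simp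
qed

text \<open>The weak equation for \<open>F\<close> removes the integral of
  \<open>weak_integrand F\<close>, so a pointwise comparison \<open>pw\<close> with the integrand of
  Q suffices.\<close>

lemma Q_form_lower_bound:
  assumes nonneg: "\<And>q. \<eta> q \<ge> 0" and convex: "\<And>q. \<phi>2 q \<ge> 0" and \<epsilon>: "\<epsilon> > 0"
    and u: "C1_map_on UNIV u" and K: "compact K" and u0: "\<And>p. p \<notin> K \<Longrightarrow> u p = 0"
  shows "integrable (area_measure A \<psi>) (\<lambda>p. weight p * normS p * (u p)\<^sup>2 * (\<epsilon> / (\<eta> p + \<epsilon>)))"
    and "Q_form \<phi> A \<psi> N u \<ge>
      - integral\<^sup>L (area_measure A \<psi>) (\<lambda>p. weight p * normS p * (u p)\<^sup>2 * (\<epsilon> / (\<eta> p + \<epsilon>)))"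
proof -
  define w where "w = (\<lambda>p. \<eta> p + \<epsilon>)"
  define F where "F = (\<lambda>p. u p * u p / w p)"
  define R where "R = (\<lambda>p. weight p * normS p * (u p)\<^sup>2 * (\<epsilon> / (\<eta> p + \<epsilon>)))"
  define q where "q = (\<lambda>p. weight p * ((norm (grad u p))\<^sup>2 - (normS p - \<phi>2 p * (\<eta> p)\<^sup>2) * (u p)\<^sup>2))"
  have wpos: "w p > 0" for p
    using nonneg[of p] \<epsilon> by (simp add: w_def)
  have w: "C1_map_on UNIV w"
    unfolding w_def by (intro C1_map_on_add C1_map_on_angle_fun C1_map_on_const)
  have F: "C1_map_on UNIV F"
    unfolding F_def using wpos by (intro C1_map_on_divide C1_map_on_mult u w) (metis less_irrefl)
  have F0: "F p = 0" if "p \<notin> K" for p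
    using u0[OF that] by (simp add: F_def)
  have c\<eta>: "continuous_on UNIV \<eta>" and cu: "continuous_on UNIV u"
    using C1_map_on_continuous C1_map_on_angle_fun u by blast+
  have "continuous_on UNIV R"
    unfolding R_def using wpos
    by (intro continuous_intros continuous_weight second_form_norm_sq_continuous c\<eta> cu)
      (auto simp: w_def less_le)
  then have R: "integrable (area_measure A \<psi>) R"
    by (rule integrable_area_continuous[OF _ K]) (simp add: R_def u0)
  then show "integrable (area_measure A \<psi>) (\<lambda>p. weight p * normS p * (u p)\<^sup>2 * (\<epsilon> / (\<eta> p + \<epsilon>)))"
    by (simp add: R_def)
  have "continuous_on UNIV q"
    unfolding q_def power2_norm_eq_inner
    by (intro continuous_intros continuous_weight continuous_\<phi>2 second_form_norm_sq_continuous c\<eta> cu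
        surface_gradient_inner_continuous u)
  then have q: "integrable (area_measure A \<psi>) q"
  proof (rule integrable_area_continuous[OF _ K])
    fix p assume p: "p \<notin> K"
    have "grad u p \<bullet> grad u p = 0"
      by (rule surface_gradient_inner_eq_0[of "- K", OF _ _ _ u u])
        (use K p u0 compact_imp_closed in auto)
    then show "q p = 0"
      using u0[OF p] by (simp add: q_def power2_norm_eq_inner)
  qed
  have pw: "weak_integrand F p - R p \<le> q p" for p
  proof -
    obtain V f x where c: "(V, f) \<in> A" "x \<in> V" "f x = p" by (rule chart_cover)
    note d = C1_map_on_differentiable[OF _ c(1,2)]
    interpret surface_patch V "\<psi> \<circ> f" "N \<circ> f" by (rule surface_patch[OF c(1)])
    \<comment> \<open>Adding a constant does not change the gradient, so Picone's inequality with
      the positive function \<open>w\<close> bounds the product of grad F with grad eta.\<close>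
    have pdw: "pd i (w \<circ> f) x = pd i (\<eta> \<circ> f) x" for i
      using pd_add[OF d[OF C1_map_on_angle_fun] d[OF C1_map_on_const[of _ \<epsilon>]], of i]
      by (simp add: w_def comp_def)
    have "grad F p \<bullet> grad \<eta> p = gprod (\<psi> \<circ> f) (F \<circ> f) (\<eta> \<circ> f) x"
      using surface_gradient_inner_chart[OF c(1,2) d[OF F] d[OF C1_map_on_angle_fun]] c(3) by simp
    also have "\<dots> = gprod (\<psi> \<circ> f) (F \<circ> f) (w \<circ> f) x"
      by (simp add: gprod_def pdw)
    also have "\<dots> = gprod (\<psi> \<circ> f) (\<lambda>y. (u \<circ> f) y * (u \<circ> f) y / (w \<circ> f) y) (w \<circ> f) x"
      by (simp add: F_def comp_def)
    also have "\<dots> \<le> gprod (\<psi> \<circ> f) (u \<circ> f) (u \<circ> f) x"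
      by (rule picone[OF c(2) C1_map_on_chart[OF u c(1)] C1_map_on_chart[OF w c(1)]]) (simp add: wpos)
    also have "\<dots> = (norm (grad u p))\<^sup>2"
      using surface_gradient_inner_chart[OF c(1,2) d[OF u] d[OF u]] c(3) by (simp add: power2_norm_eq_inner)
    finally have pic: "grad F p \<bullet> grad \<eta> p \<le> (norm (grad u p))\<^sup>2" .
    \<comment> \<open>Writing eta / (eta + epsilon) as 1 - epsilon / (eta + epsilon) separates the
      term of Q from the error.\<close>
    have "\<eta> p * F p = (u p)\<^sup>2 - (u p)\<^sup>2 * (\<epsilon> / (\<eta> p + \<epsilon>))"
    proof -
      have "\<eta> p + \<epsilon> \<noteq> 0" using wpos[of p] by (simp add: w_def)
      then show ?thesis
        by (simp add: F_def w_def field_simps power2_eq_square)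
    qed
    then have e: "normS p * \<eta> p * F p = normS p * (u p)\<^sup>2 - normS p * (u p)\<^sup>2 * (\<epsilon> / (\<eta> p + \<epsilon>))"
      by (simp add: right_diff_distrib mult.assoc)
    have "\<eta> p * F p \<le> (u p)\<^sup>2"
    proof -
      have "(u p)\<^sup>2 * (\<epsilon> / (\<eta> p + \<epsilon>)) \<ge> 0"
        using nonneg[of p] \<epsilon> by simp
      then show ?thesis
        using \<open>\<eta> p * F p = _\<close> by linarith
    qed
    moreover have "0 \<le> \<eta> p * F p"
      using nonneg[of p] wpos[of p] by (simp add: F_def less_imp_le)
    \<comment> \<open>With t = \<open>\<eta> p * F p\<close> between 0 and u^2, one has (1 - eta^2)
      t \<ge> - eta^2 t \<ge> - eta^2 u^2; multiplying by phi'' \<ge> 0 preserves the order.\<close>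
    ultimately have conv: "\<phi>2 p * (1 - (\<eta> p)\<^sup>2) * \<eta> p * F p \<ge> - (\<phi>2 p * (\<eta> p)\<^sup>2 * (u p)\<^sup>2)"
    proof -
      have "- ((\<eta> p)\<^sup>2 * (u p)\<^sup>2) \<le> - ((\<eta> p)\<^sup>2 * (\<eta> p * F p))"
        using \<open>\<eta> p * F p \<le> (u p)\<^sup>2\<close> by (simp add: mult_left_mono)
      also have "\<dots> \<le> (1 - (\<eta> p)\<^sup>2) * (\<eta> p * F p)"
        using \<open>0 \<le> \<eta> p * F p\<close> by (simp add: left_diff_distrib)
      finally show ?thesis
        using mult_left_mono[OF _ convex[of p], of "- ((\<eta> p)\<^sup>2 * (u p)\<^sup>2)"] by (simp add: mult.assoc)
    qed
    have "grad F p \<bullet> grad \<eta> p - (normS p + \<phi>2 p * (1 - (\<eta> p)\<^sup>2)) * \<eta> p * F p - normS p * (u p)\<^sup>2 * (\<epsilon> / (\<eta> p + \<epsilon>))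
        \<le> (norm (grad u p))\<^sup>2 - (normS p - \<phi>2 p * (\<eta> p)\<^sup>2) * (u p)\<^sup>2"
      using pic e conv by (simp add: algebra_simps)
    from mult_left_mono[OF this, of "weight p"] show ?thesis
      by (simp add: weak_integrand_def R_def q_def algebra_simps)
  qed
  have "integral\<^sup>L (area_measure A \<psi>) (\<lambda>p. weak_integrand F p - R p) \<le> integral\<^sup>L (area_measure A \<psi>) q"
    using weak_integrand_integrable[OF F K F0] R q pw by (intro integral_mono) auto
  then have "- integral\<^sup>L (area_measure A \<psi>) R \<le> integral\<^sup>L (area_measure A \<psi>) q"
    using weak_integrand_integrable[OF F K F0] R weak_equation[OF F K F0] by simp
  then show "Q_form \<phi> A \<psi> N u \<ge>
      - integral\<^sup>L (area_measure A \<psi>) (\<lambda>p. weight p * normS p * (u p)\<^sup>2 * (\<epsilon> / (\<eta> p + \<epsilon>)))"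
    by (simp add: Q_form_def R_def q_def)
qed

text \<open>The errors are at most the integrable function \<open>g\<close>, so dominated
  convergence along epsilon = 1 / (n + 1) only asks for pointwise convergence.\<close>

lemma stable_if_angle_nonneg:
  assumes nonneg: "\<And>q. \<eta> q \<ge> 0" and convex: "\<And>q. \<phi>2 q \<ge> 0"
  shows "phi_stable \<phi> A \<psi> N"
  unfolding phi_stable_def
proof (intro allI impI)
  fix u :: "'m \<Rightarrow> real" assume u: "smooth_map A u \<and> compact (closure {p. u p \<noteq> 0})"
  define K where "K = closure {p. u p \<noteq> 0}"
  have uC: "C1_map_on UNIV u" and K: "compact K"
    using u smooth_map_imp_C1_map_on by (auto simp: K_def)
  have u0: "u p = 0" if "p \<notin> K" for p
    using that closure_subset[of "{p. u p \<noteq> 0}"] by (auto simp: K_def)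
  define \<epsilon> where "\<epsilon> = (\<lambda>n. 1 / real (Suc n))"
  define g where "g = (\<lambda>p. weight p * normS p * (u p)\<^sup>2)"
  define r where "r = (\<lambda>n p. g p * (\<epsilon> n / (\<eta> p + \<epsilon> n)))"
  have \<epsilon>: "\<epsilon> n > 0" for n
    by (simp add: \<epsilon>_def)
  have \<epsilon>0: "\<epsilon> \<longlonglongrightarrow> 0"
    using LIMSEQ_inverse_real_of_nat by (simp add: \<epsilon>_def inverse_eq_divide)
  note low = Q_form_lower_bound[OF nonneg convex \<epsilon> uC K u0, folded g_def]
  have rint: "integrable (area_measure A \<psi>) (r n)" for n
    using low(1)[of n] by (simp add: r_def g_def)
  have "continuous_on UNIV g"
    unfolding g_def
    by (intro continuous_intros continuous_weight second_form_norm_sq_continuous C1_map_on_continuous[OF uC])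
  then have gint: "integrable (area_measure A \<psi>) g"
    by (rule integrable_area_continuous[OF _ K]) (simp add: g_def u0)
  have gnn: "g p \<ge> 0" for p
    by (simp add: g_def normS_nonneg)
  have lim: "(\<lambda>n. r n p) \<longlonglongrightarrow> 0" for p
  proof (cases "\<eta> p = 0")
    \<comment> \<open>Here the quotient is 1 for every \<open>n\<close> and does not decay; it is
      the factor \<open>g p\<close> that vanishes.\<close>
    case True
    then show ?thesis
      using normS_eq_0[OF nonneg True] by (simp add: r_def g_def)
  next
    case False
    have "(\<lambda>n. g p * (\<epsilon> n / (\<eta> p + \<epsilon> n))) \<longlonglongrightarrow> g p * (0 / (\<eta> p + 0))"
      by (intro tendsto_intros \<epsilon>0) (use False in simp)
    then show ?thesis by (simp add: r_def)
  qed
  have bound: "norm (r n p) \<le> g p" for n p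
  proof -
    have e: "0 \<le> \<epsilon> n / (\<eta> p + \<epsilon> n)" "\<epsilon> n / (\<eta> p + \<epsilon> n) \<le> 1"
      using \<epsilon>[of n] nonneg[of p] by (simp_all add: divide_le_eq_1)
    have "0 \<le> r n p" "r n p \<le> g p"
      unfolding r_def by (rule mult_nonneg_nonneg[OF gnn e(1)] mult_left_le[OF e(2) gnn])+
    then show ?thesis by simp
  qed
  have "(\<lambda>n. integral\<^sup>L (area_measure A \<psi>) (r n)) \<longlonglongrightarrow> integral\<^sup>L (area_measure A \<psi>) (\<lambda>p. 0)"
    by (rule integral_dominated_convergence[where w = g])
      (use rint gint lim bound in \<open>auto intro: borel_measurable_integrable\<close>)
  from tendsto_minus[OF this]
  have lim0: "(\<lambda>n. - integral\<^sup>L (area_measure A \<psi>) (r n)) \<longlonglongrightarrow> 0"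
    by simp
  have "- integral\<^sup>L (area_measure A \<psi>) (r n) \<le> Q_form \<phi> A \<psi> N u" for n
    using low(2)[of n] by (simp add: r_def g_def)
  then show "Q_form \<phi> A \<psi> N u \<ge> 0"
    by (intro LIMSEQ_le_const2[OF lim0] exI[of _ 0]) simp
qed

end

theorem proposition4p4:
  fixes \<alpha> :: real
    and \<phi> :: "real \<Rightarrow> real"
    and A :: "'m::{t2_space, second_countable_topology} param set"
    and \<psi> N :: "'m \<Rightarrow> real^3"
  assumes "smooth_on {\<alpha><..} \<phi>"
    and "\<And>t. t > \<alpha> \<Longrightarrow> deriv \<phi> t > 0"
    and "\<And>t. t > \<alpha> \<Longrightarrow> deriv (deriv \<phi>) t \<ge> 0"
    and "oriented_immersed_surface A \<psi> N"
    and "\<And>p. height \<psi> p > \<alpha>"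
    and "phi_minimal \<phi> A \<psi> N"
    and "\<And>p. mean_curvature A \<psi> N p \<le> 0"
  shows "phi_stable \<phi> A \<psi> N"
proof -
  interpret phi_minimal_surface A \<psi> N \<alpha> \<phi>
    by unfold_locales (use assms in auto)
  show ?thesis
  proof (rule stable_if_angle_nonneg)
    fix p
    have "deriv \<phi> (height \<psi> p) * angle_fun N p \<ge> 0"
      using assms(6) assms(7)[of p] by (simp add: phi_minimal_def)
    then show "angle_fun N p \<ge> 0"
      using assms(2)[OF assms(5)[of p]] by (simp add: zero_le_mult_iff)
    show "deriv (deriv \<phi>) (height \<psi> p) \<ge> 0"
      using assms(3)[OF assms(5)] .
  qed
qed

end
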